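(* Let $f:\mathbb{R}^n\to\mathbb{R}$ be bounded and uniformly continuous, and for $n$-dimensional controls $\alpha,\beta\in\mathcal{C}$ define $$J_f[\alpha,\beta] := \mathbf{E}\bigg[\int_0^1 e^{-\frac{1}{2}\int_0^t\|\beta_s\|^2ds}\langle \alpha_t,\beta_t\rangle\,dt + e^{-\frac{1}{2}\int_0^1\|\beta_t\|^2dt}\, f\bigg(W_1 + \int_0^1 \alpha_t\,dt\bigg)\bigg].$$ Then $$\Phi^{-1}\bigg(\int \Phi(f)\,d\gamma_n\bigg) = \sup_{\alpha\in\mathcal{S}}\inf_{\beta\in\mathcal{C}} J_f[\alpha(\beta),\beta] = \inf_{\alpha\in\mathcal{S}}\sup_{\beta\in\mathcal{C}} J_f[\alpha(\beta),\beta].$$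
   Context: $\gamma_n$ is the standard Gaussian measure on $\mathbb{R}^n$, and $\Phi(x):=\gamma_1((-\infty,x])$. $(\Omega,\mathcal{F},\{\mathcal{F}_t\},\mathbf{P})$ is a probability space with a complete and right-continuous filtration, and $\{W_t\}$ is a standard $n$-dimensional $\mathcal{F}_t$-Brownian motion (the filtration may be larger than the one generated by $W$). A control is a progressively measurable $n$-dimensional process $\beta=\{\beta_t\}_{t\in[0,1]}$. $\mathcal{C}$ denotes the family of all controls such that $\mathbf{E}[\int_0^1\|\beta_s\|^2ds]<\infty$. A strategy (Elliott-Kalton strategy) is a map $\alpha:\mathcal{C}\to\mathcal{C}$ such that for every $t\in[0,1]$ and $\beta,\beta'\in\mathcal{C}$ with $\beta_s(\omega)=\beta'_s(\omega)$ for a.e. $(s,\omega)\in[0,t]\times\Omega$, we have $\alpha_s(\beta)(\omega)=\alpha_s(\beta')(\omega)$ for a.e. $(s,\omega)\in[0,t]\times\Omega$. $\mathcal{S}$ denotes the family of all strategies such that $\sup\{\mathbf{E}[\int_0^1\|\alpha_s(\beta)\|^2ds] : \beta\in\mathcal{C},\ \mathbf{E}[\int_0^1\|\beta_s\|^2ds]\le R\}<\infty$ for all $R<\infty$. *)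

theory Defs
  imports "HOL-Probability.Probability"
begin

definition std_gaussian :: "(real ^ 'n) measure" where
  "std_gaussian = density lborel (\<lambda>x. ennreal (\<Prod>i\<in>UNIV. std_normal_density (x $ i)))"

definition Phi :: "real \<Rightarrow> real" where
  "Phi = cdf std_normal_distribution"

text \<open>
  All processes are indexed by \<^typ>\<open>real\<close>, but only their values at times in \<open>{0..1}\<close> are constrained
  or used. A filtration or Brownian motion on \<open>[0,\<infinity>)\<close> is covered by restricting it to \<open>{0..1}\<close>.
  Completeness of the filtration means that each \<open>F t\<close> contains all null sets of the complete
  probability space \<open>M\<close>.
\<close>

definition complete_rc_filtration :: "'w measure \<Rightarrow> (real \<Rightarrow> 'w measure) \<Rightarrow> bool" where
  "complete_rc_filtration M F \<longleftrightarrow>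
     (\<forall>t\<in>{0..1}. subalgebra M (F t)) \<and>
     (\<forall>s\<in>{0..1}. \<forall>t\<in>{0..1}. s \<le> t \<longrightarrow> sets (F s) \<subseteq> sets (F t)) \<and>
     (\<forall>t\<in>{0..1}. null_sets M \<subseteq> sets (F t)) \<and>
     (\<forall>t\<in>{0..<1}. sets (F t) = (\<Inter>u\<in>{t<..1}. sets (F u)))"

definition brownian_motion ::
  "'w measure \<Rightarrow> (real \<Rightarrow> 'w measure) \<Rightarrow> (real \<Rightarrow> 'w \<Rightarrow> real ^ 'n) \<Rightarrow> bool" where
  "brownian_motion M F W \<longleftrightarrow>
     (\<forall>t\<in>{0..1}. W t \<in> borel_measurable (F t)) \<and>
     (AE \<omega> in M. W 0 \<omega> = 0) \<and>
     (AE \<omega> in M. continuous_on {0..1} (\<lambda>t. W t \<omega>)) \<and>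
     (\<forall>s t. 0 \<le> s \<and> s < t \<and> t \<le> 1 \<longrightarrow>
        distr M borel (\<lambda>\<omega>. W t \<omega> - W s \<omega>) = distr std_gaussian borel (\<lambda>x. sqrt (t - s) *\<^sub>R x) \<and>
        prob_space.indep_set M (sets (F s))
          {(\<lambda>\<omega>. W t \<omega> - W s \<omega>) -` A \<inter> space M | A. A \<in> sets borel})"

definition progressively_measurable ::
  "(real \<Rightarrow> 'w measure) \<Rightarrow> (real \<Rightarrow> 'w \<Rightarrow> real ^ 'n) \<Rightarrow> bool" where
  "progressively_measurable F \<beta> \<longleftrightarrow>
     (\<forall>t\<in>{0..1}. (\<lambda>(s, \<omega>). \<beta> s \<omega>)
        \<in> borel_measurable (restrict_space borel {0..t} \<Otimes>\<^sub>M F t))"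

definition energy :: "'w measure \<Rightarrow> (real \<Rightarrow> 'w \<Rightarrow> real ^ 'n) \<Rightarrow> ennreal" where
  "energy M \<beta> = (\<integral>\<^sup>+\<omega>. (\<integral>\<^sup>+s\<in>{0..1}. ennreal ((norm (\<beta> s \<omega>))\<^sup>2) \<partial>lborel) \<partial>M)"

definition controls ::
  "'w measure \<Rightarrow> (real \<Rightarrow> 'w measure) \<Rightarrow> (real \<Rightarrow> 'w \<Rightarrow> real ^ 'n) set" where
  "controls M F = {\<beta>. progressively_measurable F \<beta> \<and> energy M \<beta> < \<infinity>}"

definition agree_upto ::
  "'w measure \<Rightarrow> real \<Rightarrow> (real \<Rightarrow> 'w \<Rightarrow> real ^ 'n) \<Rightarrow> (real \<Rightarrow> 'w \<Rightarrow> real ^ 'n) \<Rightarrow> bool" where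
  "agree_upto M t \<beta> \<beta>' \<longleftrightarrow>
     (AE (s, \<omega>) in restrict_space lborel {0..t} \<Otimes>\<^sub>M M. \<beta> s \<omega> = \<beta>' s \<omega>)"

definition elliott_kalton_strategy ::
  "'w measure \<Rightarrow> (real \<Rightarrow> 'w measure) \<Rightarrow>
   ((real \<Rightarrow> 'w \<Rightarrow> real ^ 'n) \<Rightarrow> (real \<Rightarrow> 'w \<Rightarrow> real ^ 'n)) \<Rightarrow> bool" where
  "elliott_kalton_strategy M F \<alpha> \<longleftrightarrow>
     \<alpha> \<in> controls M F \<rightarrow> controls M F \<and>
     (\<forall>t\<in>{0..1}. \<forall>\<beta>\<in>controls M F. \<forall>\<beta>'\<in>controls M F.
        agree_upto M t \<beta> \<beta>' \<longrightarrow> agree_upto M t (\<alpha> \<beta>) (\<alpha> \<beta>'))"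

definition strategies ::
  "'w measure \<Rightarrow> (real \<Rightarrow> 'w measure) \<Rightarrow>
   ((real \<Rightarrow> 'w \<Rightarrow> real ^ 'n) \<Rightarrow> (real \<Rightarrow> 'w \<Rightarrow> real ^ 'n)) set" where
  "strategies M F = {\<alpha>. elliott_kalton_strategy M F \<alpha> \<and>
     (\<forall>R<\<infinity>. (SUP \<beta>\<in>{\<beta>\<in>controls M F. energy M \<beta> \<le> R}. energy M (\<alpha> \<beta>)) < \<infinity>)}"

definition J ::
  "'w measure \<Rightarrow> (real \<Rightarrow> 'w \<Rightarrow> real ^ 'n) \<Rightarrow> (real ^ 'n \<Rightarrow> real) \<Rightarrow>
   (real \<Rightarrow> 'w \<Rightarrow> real ^ 'n) \<Rightarrow> (real \<Rightarrow> 'w \<Rightarrow> real ^ 'n) \<Rightarrow> real" where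
  "J M W f \<alpha> \<beta> = (\<integral>\<omega>.
     (LINT t:{0..1}|lborel.
        exp (- (1 / 2) * (LINT s:{0..t}|lborel. (norm (\<beta> s \<omega>))\<^sup>2)) * (\<alpha> t \<omega> \<bullet> \<beta> t \<omega>))
     + exp (- (1 / 2) * (LINT t:{0..1}|lborel. (norm (\<beta> t \<omega>))\<^sup>2))
       * f (W 1 \<omega> + (LINT t:{0..1}|lborel. \<alpha> t \<omega>)) \<partial>M)"

end

theory Submission
  imports Defs
begin

text \<open>
  Put \<open>u t x = inv Phi (E (Phi (f (x + W 1 - W t))))\<close>. Since \<open>E (Phi (f (x + W 1 - W t)))\<close> solves the
  heat equation and the second derivative of \<open>Phi\<close> is \<open>- x\<close> times the first, \<open>u\<close> solves
  \<open>u\<^sub>t + \<Delta>u / 2 = u |\<nabla>u|\<^sup>2 / 2\<close>. Expanding the discounted value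
  \<open>exp (- \<integral> |\<beta>|\<^sup>2 / 2) u\<close> along the state \<open>W + \<integral> \<alpha>\<close> gives
  \<open>J \<alpha> \<beta> - u 0 0 = E (\<integral> exp (- \<integral> |\<beta>|\<^sup>2 / 2) (\<alpha> \<bullet> (\<beta> + \<nabla>u) + u (|\<nabla>u|\<^sup>2 - |\<beta>|\<^sup>2) / 2))\<close>.
  The integrand vanishes for \<open>\<beta> = - \<nabla>u\<close> whatever \<open>\<alpha>\<close> is, and for \<open>\<alpha> = (u / 2) (\<beta> - \<nabla>u)\<close>
  whatever \<open>\<beta>\<close> is. Hence every strategy meets a control with payoff close to \<open>u 0 0\<close>, and some
  strategy has payoff close to \<open>u 0 0\<close> against all controls; these two facts give both equalities.

  Stochastic calculus is avoided by freezing both feedbacks on a grid. The function \<open>f\<close> is first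
  mollified, which makes the gradient of \<open>u\<close> Lipschitz; one step of the expansion then needs only
  the independence of increments, Gaussian moments of order at most four, and a Taylor expansion of
  \<open>inv Phi\<close>. The errors are uniform in \<open>\<beta>\<close>, although its energy is unbounded, because
  \<open>exp (- \<integral> |\<beta>|\<^sup>2 / 2) |\<beta>|\<^sup>2\<close> has integral at most \<open>2\<close>.
\<close>

section \<open>The Gaussian distribution function\<close>

text \<open>The formula for \<alpha> is dictated by a factorisation: with \<open>du\<close> for the
  gradient, |\<beta>|^2 - |du|^2 = (\<beta> - du) \<bullet> (\<beta> + du), and \<alpha> has to
  supply the factor that multiplies \<beta> + du. The two halves meet different obstacles. A control
  has to be built against a strategy that has no formula and is non-anticipating only up to null
  sets; what helps is that the feedback is bounded by a constant independent of the grid, so the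
  strategy answers with bounded energy. A strategy has to face controls of arbitrary energy; there
  the errors are bounded by decrements of the discount, which sum to at most 1, up to a power of the
  step size. The limits are taken in a fixed order. The mollification error is chosen first and
  fixes the constant \<open>K\<close> in all regularity bounds; then the grid is refined. With
  \<open>l\<close> the fourth root of the step size there are l^-4 steps, so an error counts as
  small when it is of smaller order than l^4 per step or telescopes with a small factor.\<close>

lemma std_normal_density_pos: "0 < std_normal_density x"
  by (simp add: normal_density_pos)

lemma std_normal_density_le_1: "std_normal_density x \<le> 1"
proof -
  have "1 \<le> sqrt (2 * pi)" using pi_ge_two by (simp add: real_le_rsqrt)
  then have "1 / sqrt (2 * pi) \<le> 1" by simp
  moreover have "exp (- x\<^sup>2 / 2) \<le> 1" by simp
  ultimately show ?thesis unfolding std_normal_density_def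
    by (meson exp_ge_zero mult_le_one)
qed

lemma DERIV_std_normal_density [derivative_intros]:
  assumes "(g has_real_derivative g') (at x within S)"
  shows "((\<lambda>x. std_normal_density (g x)) has_real_derivative
           (- g x * std_normal_density (g x)) * g') (at x within S)"
proof -
  have "((\<lambda>x. std_normal_density x) has_real_derivative - x * std_normal_density x) (at x)" for x
    unfolding std_normal_density_def
    by (auto intro!: derivative_eq_intros simp: field_simps)
  from DERIV_chain2[OF this assms] show ?thesis .
qed

text \<open>From |x| \<le> 1 + x^2 / 2 \<le> exp (x^2 / 2). Up to sign the left side is the second
  derivative of \<open>Phi\<close>.\<close>

lemma abs_mult_std_normal_density_le_1: "\<bar>x * std_normal_density x\<bar> \<le> 1"
proof -
  have a: "1 / sqrt (2 * pi) \<le> 1" using pi_ge_two by (simp add: real_le_rsqrt)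
  have "\<bar>x\<bar> \<le> 1 + x\<^sup>2 / 2"
    using zero_le_power2[of "\<bar>x\<bar> - 1"] by (simp add: power2_diff)
  also have "\<dots> \<le> exp (x\<^sup>2 / 2)" by (rule exp_ge_add_one_self)
  finally have "\<bar>x\<bar> * exp (- x\<^sup>2 / 2) \<le> exp (x\<^sup>2 / 2) * exp (- x\<^sup>2 / 2)"
    by (intro mult_right_mono) auto
  then have b: "\<bar>x\<bar> * exp (- x\<^sup>2 / 2) \<le> 1" by (simp flip: exp_add)
  have "\<bar>x * std_normal_density x\<bar> = (1 / sqrt (2 * pi)) * (\<bar>x\<bar> * exp (- x\<^sup>2 / 2))"
    unfolding std_normal_density_def by (simp add: abs_mult)
  also have "\<dots> \<le> 1" using a b by (meson abs_ge_zero exp_ge_zero mult_le_one mult_nonneg_nonneg)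
  finally show ?thesis .
qed

interpretation std_normal: real_distribution std_normal_distribution
  by (rule real_dist_normal_dist)

text \<open>Moves the base point of the distribution function from minus infinity to a finite
  \<open>a\<close>, so that the fundamental theorem of calculus on a compact interval can
  differentiate \<open>Phi\<close>.\<close>

lemma Phi_diff:
  assumes "a \<le> u"
  shows "Phi u = Phi a + (LBINT y=a..u. std_normal_density y)"
proof (cases "a = u")
  case False
  with assms have "a < u" by simp
  then have "Phi u - Phi a = measure std_normal_distribution {a<..u}"
    unfolding Phi_def by (rule std_normal.cdf_diff_eq)
  also have "\<dots> = (\<integral>x. indicator {a<..u} x \<partial>std_normal_distribution)" by simp
  also have "\<dots> = (LBINT y:{a<..u}. std_normal_density y)"
    unfolding set_lebesgue_integral_def
    by (subst integral_density) (auto simp: mult.commute)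
  also have "\<dots> = (LBINT y=a..u. std_normal_density y)"
    using assms by (simp add: interval_integral_Ioc)
  finally show ?thesis by simp
qed simp

lemma DERIV_Phi: "(Phi has_real_derivative std_normal_density x) (at x)"
proof -
  let ?a = "x - 1" and ?b = "x + 1"
  have "continuous_on {?a..?b} std_normal_density"
    unfolding std_normal_density_def by (intro continuous_intros) auto
  from interval_integral_FTC2[OF _ _ this, of ?a x]
  have "((\<lambda>u. LBINT y=?a..u. std_normal_density y) has_real_derivative std_normal_density x)
          (at x within {?a..?b})"
    by (simp add: has_real_derivative_iff_has_vector_derivative)
  then have "((\<lambda>u. Phi ?a + (LBINT y=?a..u. std_normal_density y)) has_real_derivative
      std_normal_density x) (at x within {?a..?b})"
    by (auto intro!: derivative_eq_intros)
  then have "(Phi has_real_derivative std_normal_density x) (at x within {?a..?b})"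
    unfolding has_field_derivative_def
    by (rule has_derivative_transform[rotated 2]) (auto simp: Phi_diff[symmetric])
  then have "(Phi has_real_derivative std_normal_density x) (at x within {?a<..<?b})"
    by (rule has_field_derivative_subset) auto
  then show ?thesis by (simp add: at_within_open_NO_MATCH)
qed

lemma isCont_Phi: "isCont Phi x"
  using DERIV_Phi DERIV_isCont by blast

lemma Phi_strict_mono: "x < y \<Longrightarrow> Phi x < Phi y"
  by (rule DERIV_pos_imp_increasing) (use DERIV_Phi std_normal_density_pos in blast)+

lemma Phi_mono: "x \<le> y \<Longrightarrow> Phi x \<le> Phi y"
  using Phi_strict_mono[of x y] by (cases "x = y") auto

lemma Phi_bounds: "0 \<le> Phi x" "Phi x \<le> 1"
  unfolding Phi_def by (auto intro: std_normal.cdf_nonneg std_normal.cdf_bounded_prob)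

lemma inv_Phi_Phi [simp]: "inv Phi (Phi x) = x"
  by (rule inv_f_f) (metis Phi_strict_mono injI less_irrefl linorder_neqE_linordered_idom)

text \<open>\<open>inv\<close> is a choice function, arbitrary off the range of \<open>Phi\<close>.
  A number between two values of \<open>Phi\<close> lies in the range by the intermediate value
  theorem, and bracketing is the form in which this is checked throughout.\<close>

lemma Phi_inv_Phi:
  assumes "Phi a \<le> y" "y \<le> Phi b"
  shows "Phi (inv Phi y) = y" "a \<le> inv Phi y" "inv Phi y \<le> b"
proof -
  have "a \<le> b" using assms Phi_strict_mono[of b a] by fastforce
  then obtain x where x: "a \<le> x" "x \<le> b" "Phi x = y"
    using IVT[of Phi a y b] assms isCont_Phi by blast
  then have "inv Phi y = x" by auto
  with x show "Phi (inv Phi y) = y" "a \<le> inv Phi y" "inv Phi y \<le> b" by auto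
qed

lemma DERIV_inv_Phi:
  assumes "Phi a < y" "y < Phi b"
  shows "(inv Phi has_real_derivative 1 / std_normal_density (inv Phi y)) (at y)"
proof -
  have "Phi (inv Phi y) = y" using assms by (intro Phi_inv_Phi(1)[of a _ b]) auto
  have "isCont (inv Phi) (Phi (inv Phi y))"
    by (rule isCont_inverse_function[of 1]) (auto simp: isCont_Phi)
  then have c: "isCont (inv Phi) y" using \<open>Phi (inv Phi y) = y\<close> by simp
  have "(inv Phi has_real_derivative inverse (std_normal_density (inv Phi y))) (at y)"
    using DERIV_inverse_function[OF DERIV_Phi _ assms _ c] Phi_inv_Phi(1)[of a _ b]
      std_normal_density_pos[of "inv Phi y"] by simp
  then show ?thesis by (simp add: field_simps)
qed

lemma std_normal_density_mono_abs:
  assumes "\<bar>x\<bar> \<le> \<bar>c\<bar>"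
  shows "std_normal_density c \<le> std_normal_density x"
proof -
  have "x\<^sup>2 \<le> c\<^sup>2" using assms abs_le_square_iff by blast
  then show ?thesis unfolding std_normal_density_def by (simp add: divide_right_mono)
qed

text \<open>Lagrange remainder with the second derivative bounded by
  \<open>abs_mult_std_normal_density_le_1\<close>. It supplies the quadratic remainder when
  \<open>Phi\<close> is composed with the mollified function.\<close>

lemma Phi_Taylor2: "\<bar>Phi b - Phi a - std_normal_density a * (b - a)\<bar> \<le> (b - a)\<^sup>2"
proof (cases "a = b")
  case False
  define diff where "diff m = (if m = 0 then Phi else if m = 1 then std_normal_density
     else (\<lambda>x. - x * std_normal_density x))" for m :: nat
  have "\<exists>t. (if b < a then b < t \<and> t < a else a < t \<and> t < b) \<and>
    Phi b = (\<Sum>m<2. (diff m a / fact m) * (b - a)^m) + (diff 2 t / fact 2) * (b - a)^2"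
  proof (rule Taylor[of 2 diff Phi "min a b" "max a b"])
    have "m = 0 \<or> m = 1" if "m < 2" for m :: nat using that by auto
    then show "\<forall>m t. m < 2 \<and> min a b \<le> t \<and> t \<le> max a b \<longrightarrow>
        (diff m has_real_derivative diff (Suc m) t) (at t)"
      unfolding diff_def by (auto intro!: derivative_eq_intros DERIV_Phi)
  qed (use False in \<open>auto simp: diff_def\<close>)
  then obtain t where "Phi b = (\<Sum>m<2. (diff m a / fact m) * (b - a)^m)
      + (diff 2 t / fact 2) * (b - a)^2" by blast
  then have "Phi b - Phi a - std_normal_density a * (b - a)
      = - (t * std_normal_density t) / 2 * (b - a)\<^sup>2"
    by (simp add: diff_def numeral_2_eq_2)
  moreover have "\<bar>- (t * std_normal_density t) / 2\<bar> * (b - a)\<^sup>2 \<le> 1 * (b - a)\<^sup>2"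
    using abs_mult_std_normal_density_le_1[of t] by (intro mult_right_mono) auto
  ultimately show ?thesis by (simp add: abs_mult)
qed simp

text \<open>With x = \<open>inv Phi y\<close> and density p, the first three derivatives of
  \<open>inv Phi\<close> are 1 / p x, x / (p x)^2 and (1 + 2 x^2) / (p x)^3. They blow up towards 0
  and 1, hence the compact interval. The second is x times the square of the first, which is the
  source of the term u |du|^2 / 2.\<close>

lemma inv_Phi_Taylor:
  fixes c :: real
  obtains L where "L \<ge> 1"
    "\<And>y. y \<in> {Phi (-c)..Phi c} \<Longrightarrow> 1 / std_normal_density (inv Phi y) \<le> L"
    "\<And>y z. y \<in> {Phi (-c)..Phi c} \<Longrightarrow> z \<in> {Phi (-c)..Phi c} \<Longrightarrow>
      \<bar>inv Phi z - inv Phi y\<bar> \<le> L * \<bar>z - y\<bar>"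
    "\<And>y z. y \<in> {Phi (-c)..Phi c} \<Longrightarrow> z \<in> {Phi (-c)..Phi c} \<Longrightarrow>
      \<bar>inv Phi z - inv Phi y - 1 / std_normal_density (inv Phi y) * (z - y)\<bar> \<le> L * (z - y)\<^sup>2"
    "\<And>y z. y \<in> {Phi (-c)..Phi c} \<Longrightarrow> z \<in> {Phi (-c)..Phi c} \<Longrightarrow>
      \<bar>inv Phi z - inv Phi y - 1 / std_normal_density (inv Phi y) * (z - y)
        - inv Phi y / (2 * (std_normal_density (inv Phi y))\<^sup>2) * (z - y)\<^sup>2\<bar> \<le> L * \<bar>z - y\<bar> ^ 3"
proof -
  let ?p = std_normal_density
  let ?I = "{Phi (-c)..Phi c}"
  define d :: real where "d = ?p c"
  \<comment> \<open>The three derivative bounds at the worst case |x| = |c|, p x = d; the leading 1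
    secures \<open>L \<ge> 1\<close>.\<close>
  define L where "L = 1 + 1 / d + \<bar>c\<bar> / d\<^sup>2 + (1 + 2 * c\<^sup>2) / d ^ 3"
  define diff :: "nat \<Rightarrow> real \<Rightarrow> real" where "diff m = (if m = 0 then inv Phi
    else if m = 1 then (\<lambda>y. 1 / ?p (inv Phi y))
    else if m = 2 then (\<lambda>y. inv Phi y / (?p (inv Phi y))\<^sup>2)
    else (\<lambda>y. (1 + 2 * (inv Phi y)\<^sup>2) / ?p (inv Phi y) ^ 3))" for m
  have pos: "?p x \<noteq> 0" for x using std_normal_density_pos[of x] by simp
  have d0: "0 < d" unfolding d_def by (rule std_normal_density_pos)
  have inI: "\<bar>inv Phi y\<bar> \<le> \<bar>c\<bar> \<and> d \<le> ?p (inv Phi y)" if "y \<in> ?I" for y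
  proof
    show *: "\<bar>inv Phi y\<bar> \<le> \<bar>c\<bar>"
      using that Phi_inv_Phi(2,3)[of "-c" y c] by auto
    show "d \<le> ?p (inv Phi y)" unfolding d_def by (rule std_normal_density_mono_abs[OF *])
  qed
  have D: "(diff m has_real_derivative diff (Suc m) y) (at y)" if "y \<in> ?I" "m < 3" for m y
  proof -
    have m: "m = 0 \<or> m = 1 \<or> m = 2" using that by auto
    \<comment> \<open>\<open>DERIV_inv_Phi\<close> asks for strict inequalities; widening the
      bracket by 1 on both sides includes the end points.\<close>
    have "Phi (- c - 1) < y" "y < Phi (c + 1)"
      using that Phi_strict_mono[of "-c-1" "-c"] Phi_strict_mono[of c "c+1"] by auto
    note DI = DERIV_inv_Phi[OF this]
    note DD = DERIV_std_normal_density[OF DI]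
    have 1: "((\<lambda>y. 1 / ?p (inv Phi y)) has_real_derivative inv Phi y / (?p (inv Phi y))\<^sup>2) (at y)"
      by (rule derivative_eq_intros DD | simp add: pos power2_eq_square)+
    have 2: "((\<lambda>y. inv Phi y / (?p (inv Phi y))\<^sup>2) has_real_derivative
        (1 + 2 * (inv Phi y)\<^sup>2) / ?p (inv Phi y) ^ 3) (at y)"
      by (rule derivative_eq_intros DI DD refl | simp add: pos)+
         (simp add: pos divide_simps, simp add: power2_eq_square power3_eq_cube power4_eq_xxxx algebra_simps)
    show ?thesis using m DI 1 2 unfolding diff_def by auto
  qed
  have e: "1 / ?p (inv Phi y) \<le> 1 / d" "\<bar>inv Phi y / (?p (inv Phi y))\<^sup>2\<bar> \<le> \<bar>c\<bar> / d\<^sup>2"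
     "(1 + 2 * (inv Phi y)\<^sup>2) / ?p (inv Phi y) ^ 3 \<le> (1 + 2 * c\<^sup>2) / d ^ 3"
    if "y \<in> ?I" for y
  proof -
    have a: "\<bar>inv Phi y\<bar> \<le> \<bar>c\<bar>" "d \<le> ?p (inv Phi y)" using inI[OF that] by auto
    then have b: "(inv Phi y)\<^sup>2 \<le> c\<^sup>2" using abs_le_square_iff by blast
    show "1 / ?p (inv Phi y) \<le> 1 / d" using a d0 by (intro divide_left_mono) auto
    have "\<bar>inv Phi y\<bar> / (?p (inv Phi y))\<^sup>2 \<le> \<bar>c\<bar> / d\<^sup>2"
      using a d0 by (intro frac_le power_mono) auto
    then show "\<bar>inv Phi y / (?p (inv Phi y))\<^sup>2\<bar> \<le> \<bar>c\<bar> / d\<^sup>2" by (simp add: abs_divide)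
    show "(1 + 2 * (inv Phi y)\<^sup>2) / ?p (inv Phi y) ^ 3 \<le> (1 + 2 * c\<^sup>2) / d ^ 3"
      using a b d0 by (intro frac_le power_mono) auto
  qed
  have dn: "0 \<le> 1 / d" "0 \<le> \<bar>c\<bar> / d\<^sup>2" "0 \<le> (1 + 2 * c\<^sup>2) / d ^ 3" using d0 by auto
  have bnd: "\<bar>diff m y\<bar> \<le> L" if "y \<in> ?I" "0 < m" for m y
  proof -
    have "0 \<le> 1 / ?p (inv Phi y)" "0 \<le> (1 + 2 * (inv Phi y)\<^sup>2) / ?p (inv Phi y) ^ 3"
      using std_normal_density_pos[of "inv Phi y"] by auto
    moreover have "1 / ?p (inv Phi y) \<le> L" "\<bar>inv Phi y / (?p (inv Phi y))\<^sup>2\<bar> \<le> L"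
      "(1 + 2 * (inv Phi y)\<^sup>2) / ?p (inv Phi y) ^ 3 \<le> L"
      using e[OF that(1)] dn unfolding L_def by linarith+
    ultimately show ?thesis using \<open>0 < m\<close> unfolding diff_def by (simp only: abs_of_nonneg split: if_split) auto
  qed
  have T: "\<bar>inv Phi z - (\<Sum>m<n. diff m y / fact m * (z - y) ^ m)\<bar> \<le> L * \<bar>z - y\<bar> ^ n"
    if "y \<in> ?I" "z \<in> ?I" "0 < n" "n \<le> 3" for y z n
  proof (cases "y = z")
    case True
    have "(\<Sum>m<n. diff m y / fact m * 0 ^ m) = (\<Sum>m\<in>{0}. diff m y / fact m * 0 ^ m)"
      by (rule sum.mono_neutral_right) (use that in auto)
    then show ?thesis using True that by (auto simp: diff_def power_0_left)
  next
    case False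
    have "\<exists>t. (if z < y then z < t \<and> t < y else y < t \<and> t < z) \<and>
      inv Phi z = (\<Sum>m<n. (diff m y / fact m) * (z - y)^m) + (diff n t / fact n) * (z - y)^n"
    proof (rule Taylor[of n diff "inv Phi" "min y z" "max y z"])
      show "\<forall>m t. m < n \<and> min y z \<le> t \<and> t \<le> max y z \<longrightarrow>
          (diff m has_real_derivative diff (Suc m) t) (at t)"
        using that by (intro allI impI D) auto
    qed (use that False in \<open>auto simp: diff_def\<close>)
    then obtain t where t: "if z < y then z < t \<and> t < y else y < t \<and> t < z"
      and eq: "inv Phi z = (\<Sum>m<n. (diff m y / fact m) * (z - y)^m) + (diff n t / fact n) * (z - y)^n"
      by blast
    have "t \<in> ?I" using t that by (auto split: if_splits)
    have "\<bar>diff n t / fact n\<bar> \<le> \<bar>diff n t\<bar> / 1"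
      unfolding abs_divide by (intro divide_left_mono) auto
    also have "\<dots> \<le> L" using bnd[OF \<open>t \<in> ?I\<close> that(3)] by simp
    finally have "\<bar>diff n t / fact n\<bar> * \<bar>z - y\<bar> ^ n \<le> L * \<bar>z - y\<bar> ^ n"
      by (intro mult_right_mono) auto
    moreover have "inv Phi z - (\<Sum>m<n. diff m y / fact m * (z - y) ^ m)
       = diff n t / fact n * (z - y) ^ n" using eq by simp
    ultimately show ?thesis by (simp only: abs_mult power_abs)
  qed
  show ?thesis
  proof
    show "1 \<le> L" unfolding L_def using dn by simp
    show "1 / ?p (inv Phi y) \<le> L" if "y \<in> ?I" for y
      using e(1)[OF that] dn unfolding L_def by linarith
    fix y z assume yz: "y \<in> ?I" "z \<in> ?I"
    show "\<bar>inv Phi z - inv Phi y\<bar> \<le> L * \<bar>z - y\<bar>"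
      using T[OF yz, of 1] by (simp add: diff_def)
    show "\<bar>inv Phi z - inv Phi y - 1 / ?p (inv Phi y) * (z - y)\<bar> \<le> L * (z - y)\<^sup>2"
      using T[OF yz, of 2] by (simp add: diff_def numeral_2_eq_2 algebra_simps)
    show "\<bar>inv Phi z - inv Phi y - 1 / ?p (inv Phi y) * (z - y)
        - inv Phi y / (2 * (?p (inv Phi y))\<^sup>2) * (z - y)\<^sup>2\<bar> \<le> L * \<bar>z - y\<bar> ^ 3"
      using T[OF yz, of 3] by (simp add: diff_def numeral_3_eq_3 power2_eq_square algebra_simps)
  qed
qed

section \<open>Functions with Lipschitz gradient\<close>

text \<open>\<open>g\<close> is bounded with bounded Lipschitz gradient \<open>D\<close>. The quadratic Taylor remainder already
  makes \<open>D\<close> the gradient and Lipschitz, so no derivatives are mentioned.\<close>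
definition c11 :: "real \<Rightarrow> ('v::euclidean_space \<Rightarrow> real) \<Rightarrow> ('v \<Rightarrow> 'v) \<Rightarrow> bool" where
  "c11 C g D \<longleftrightarrow> (\<forall>x. \<bar>g x\<bar> \<le> C) \<and> (\<forall>x. norm (D x) \<le> C) \<and>
     (\<forall>x k. \<bar>g (x + k) - g x - D x \<bullet> k\<bar> \<le> C * (norm k)\<^sup>2)"

lemma c11D:
  assumes "c11 C g D"
  shows "\<bar>g x\<bar> \<le> C" "norm (D x) \<le> C" "\<bar>g (x + k) - g x - D x \<bullet> k\<bar> \<le> C * (norm k)\<^sup>2" "0 \<le> C"
  using assms unfolding c11_def by (auto intro: order_trans[OF abs_ge_zero])

text \<open>For short \<open>k\<close> the quadratic remainder is at most C |k|, for long
  \<open>k\<close> the bound on \<open>g\<close> itself suffices; the factor 2 serves both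
  cases.\<close>

lemma c11_lipschitz:
  assumes "c11 C g D"
  shows "\<bar>g (x + k) - g x\<bar> \<le> 2 * C * norm k"
proof (cases "norm k \<le> 1")
  case True
  have "\<bar>D x \<bullet> k\<bar> \<le> C * norm k"
    using Cauchy_Schwarz_ineq2[of "D x" k] c11D(2)[OF assms, of x]
    by (meson mult_right_mono norm_ge_zero order_trans)
  moreover have "C * (norm k)\<^sup>2 \<le> C * norm k"
    using c11D(4)[OF assms] True by (intro mult_left_mono) (auto simp: power2_eq_square mult_left_le)
  ultimately show ?thesis using c11D(3)[OF assms, of x k] by linarith
next
  case False
  have "2 * C * 1 \<le> 2 * C * norm k"
    using False c11D(4)[OF assms] by (intro mult_left_mono) auto
  then show ?thesis using c11D(1)[OF assms, of x] c11D(1)[OF assms, of "x + k"] by linarith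
qed

text \<open>Expanding \<open>g (x + k + l)\<close> around \<open>x\<close> and around \<open>x + k\<close> leaves
  \<open>(D (x + k) - D x) \<bullet> l\<close> up to quadratic errors; take \<open>l\<close> parallel to that difference
  and of the length of \<open>k\<close>.\<close>
lemma c11_gradient_lipschitz:
  assumes "c11 C g D"
  shows "norm (D (x + k) - D x) \<le> 6 * C * norm k"
proof (cases "D (x + k) = D x \<or> k = 0")
  case False
  define e where "e = D (x + k) - D x"
  define r where "r = norm k"
  define l where "l = (r / norm e) *\<^sub>R e"
  have e: "norm e > 0" and r: "r > 0" using False by (auto simp: e_def r_def)
  have l: "norm l = r" "e \<bullet> l = r * norm e"
    using e r unfolding l_def by (auto simp: dot_square_norm power2_eq_square)
  have a: "\<bar>g (x + k + l) - g (x + k) - D (x + k) \<bullet> l\<bar> \<le> C * r\<^sup>2"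
    using c11D(3)[OF assms, of "x + k" l] l by simp
  have b: "\<bar>g (x + (k + l)) - g x - D x \<bullet> (k + l)\<bar> \<le> C * (norm (k + l))\<^sup>2"
    using c11D(3)[OF assms] .
  have c: "\<bar>g (x + k) - g x - D x \<bullet> k\<bar> \<le> C * r\<^sup>2"
    using c11D(3)[OF assms, of x k] by (simp add: r_def)
  have "norm (k + l) \<le> 2 * r" using norm_triangle_ineq[of k l] l r_def by simp
  then have "(norm (k + l))\<^sup>2 \<le> (2 * r)\<^sup>2" by (intro power_mono) auto
  then have "C * (norm (k + l))\<^sup>2 \<le> C * (2 * r)\<^sup>2" using c11D(4)[OF assms] by (rule mult_left_mono)
  then have d: "C * (norm (k + l))\<^sup>2 \<le> 4 * (C * r\<^sup>2)" by (simp add: power_mult_distrib)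
  have "r * norm e = D (x + k) \<bullet> l - D x \<bullet> l"
    using l unfolding e_def by (simp add: inner_diff_left)
  also have "\<dots> \<le> 6 * (C * r\<^sup>2)"
    using a b c d by (simp add: inner_add_right add.assoc)
  finally have "r * norm e \<le> r * (6 * C * r)" by (simp add: power2_eq_square algebra_simps)
  then show ?thesis using r unfolding e_def r_def by (simp add: mult_le_cancel_left_pos)
qed (use c11D(4)[OF assms] in auto)

lemma lipschitz_continuous:
  fixes g :: "'v::real_normed_vector \<Rightarrow> 'b::real_normed_vector"
  assumes "\<And>x k. norm (g (x + k) - g x) \<le> L * norm k"
  shows "continuous_on UNIV g"
proof -
  have "isCont g x" for x
  proof -
    have "((\<lambda>k. L * norm k) \<longlongrightarrow> L * norm (0::'v)) (at (0::'v))"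
      using tendsto_mult_left[OF tendsto_norm[OF tendsto_ident_at[of "0::'v" UNIV]], of L] by simp
    then have "((\<lambda>k. L * norm k) \<longlongrightarrow> 0) (at (0::'v))" by simp
    from Lim_null_comparison[OF _ this, of "\<lambda>k. g (x + k) - g x"]
    have "((\<lambda>k. g (x + k) - g x) \<longlongrightarrow> 0) (at 0)" using assms by simp
    then have "((\<lambda>k. g (x + k)) \<longlongrightarrow> g x) (at 0)" by (simp add: LIM_zero_iff)
    then show ?thesis unfolding isCont_def by (rule LIM_offset_zero_cancel)
  qed
  then show ?thesis by (simp add: continuous_at_imp_continuous_on)
qed

lemma c11_continuous:
  assumes "c11 C g D"
  shows "continuous_on UNIV g" "continuous_on UNIV D"
  using lipschitz_continuous[of g "2 * C"] lipschitz_continuous[of D "6 * C"]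
    c11_lipschitz[OF assms] c11_gradient_lipschitz[OF assms] by auto

lemma c11_measurable:
  assumes "c11 C g D"
  shows "g \<in> borel_measurable borel" "D \<in> borel_measurable borel"
  using c11_continuous[OF assms] by (auto intro: borel_measurable_continuous_onI)

text \<open>The hypotheses on \<open>\<phi>\<close> concern only values taken by \<open>g\<close>,
  so that \<open>inv Phi\<close> is admissible although its derivatives are unbounded globally. In
  the constant, 4 C^2 is the square of the Lipschitz constant of \<open>g\<close>, multiplied by the
  remainder of \<open>\<phi>\<close>, and C comes from the gradient and the remainder of
  \<open>g\<close>.\<close>

lemma c11_compose:
  assumes "c11 C g D"
    and "\<And>x y. \<bar>\<phi> (g y) - \<phi> (g x) - \<phi>' (g x) * (g y - g x)\<bar> \<le> L * (g y - g x)\<^sup>2"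
    and "\<And>x. \<bar>\<phi> (g x)\<bar> \<le> L" "\<And>x. \<bar>\<phi>' (g x)\<bar> \<le> L"
  shows "c11 (L * (1 + C + 4 * C\<^sup>2)) (\<lambda>x. \<phi> (g x)) (\<lambda>x. \<phi>' (g x) *\<^sub>R D x)"
proof -
  have L: "0 \<le> L" using assms(3)[of undefined] by linarith
  have C: "0 \<le> C" using c11D[OF assms(1)] by blast
  have "L * 1 \<le> L * (1 + C + 4 * C\<^sup>2)" "L * C \<le> L * (1 + C + 4 * C\<^sup>2)"
    by (rule mult_left_mono; use L C in simp)+
  note bnd = this
  show ?thesis
    unfolding c11_def
  proof (intro conjI allI)
    fix x k
    show "\<bar>\<phi> (g x)\<bar> \<le> L * (1 + C + 4 * C\<^sup>2)" using assms(3)[of x] bnd by linarith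
    have "norm (\<phi>' (g x) *\<^sub>R D x) \<le> L * C"
      using assms(4)[of x] c11D(2)[OF assms(1), of x] by (auto intro!: mult_mono L)
    then show "norm (\<phi>' (g x) *\<^sub>R D x) \<le> L * (1 + C + 4 * C\<^sup>2)" using bnd by linarith
    have "\<bar>g (x + k) - g x\<bar>\<^sup>2 \<le> (2 * C * norm k)\<^sup>2"
      using c11_lipschitz[OF assms(1), of x k] by (intro power_mono) auto
    then have "L * (g (x + k) - g x)\<^sup>2 \<le> L * (2 * C * norm k)\<^sup>2"
      using L by (intro mult_left_mono) auto
    moreover have "\<bar>\<phi>' (g x)\<bar> * \<bar>g (x + k) - g x - D x \<bullet> k\<bar> \<le> L * (C * (norm k)\<^sup>2)"
      using assms(4)[of x] c11D(3)[OF assms(1), of x k] L by (intro mult_mono) auto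
    moreover have "\<phi> (g (x + k)) - \<phi> (g x) - (\<phi>' (g x) *\<^sub>R D x) \<bullet> k
       = (\<phi> (g (x + k)) - \<phi> (g x) - \<phi>' (g x) * (g (x + k) - g x))
         + \<phi>' (g x) * (g (x + k) - g x - D x \<bullet> k)"
      by (simp add: algebra_simps)
    moreover have "0 \<le> L * (norm k)\<^sup>2" using L by simp
    ultimately have "\<bar>\<phi> (g (x + k)) - \<phi> (g x) - (\<phi>' (g x) *\<^sub>R D x) \<bullet> k\<bar>
      \<le> L * (2 * C * norm k)\<^sup>2 + L * (C * (norm k)\<^sup>2) + L * (norm k)\<^sup>2"
      using assms(2)[of "x + k" x] by (simp only: abs_mult[symmetric])
    then show "\<bar>\<phi> (g (x + k)) - \<phi> (g x) - (\<phi>' (g x) *\<^sub>R D x) \<bullet> k\<bar>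
      \<le> L * (1 + C + 4 * C\<^sup>2) * (norm k)\<^sup>2"
      by (simp add: algebra_simps power_mult_distrib)
  qed
qed

lemma norm_integral_le:
  fixes f :: "'a \<Rightarrow> 'b::{banach, second_countable_topology}"
  assumes "integrable M f" "integrable M g" "\<And>x. norm (f x) \<le> g x"
  shows "norm (\<integral>x. f x \<partial>M) \<le> (\<integral>x. g x \<partial>M)"
  using assms by (intro order_trans[OF integral_norm_bound] integral_mono) auto

text \<open>The three conditions in \<open>c11\<close> are linear in the pair (g, D) and invariant
  under translation, so averaging over random shifts keeps even the constant. This makes the
  regularity of the heat flow uniform in time.\<close>

lemma (in prob_space) c11_expectation:
  assumes "c11 C g D" and [measurable]: "Y \<in> borel_measurable M"
  shows "c11 C (\<lambda>x. \<integral>\<omega>. g (x + Y \<omega>) \<partial>M) (\<lambda>x. \<integral>\<omega>. D (x + Y \<omega>) \<partial>M)"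
proof -
  note [measurable] = c11_measurable[OF assms(1)]
  have ig: "integrable M (\<lambda>\<omega>. g (x + Y \<omega>))" for x
    by (rule integrable_const_bound[where B=C]) (use c11D[OF assms(1)] in auto)
  have iD: "integrable M (\<lambda>\<omega>. D (x + Y \<omega>))" for x
    by (rule integrable_const_bound[where B=C]) (use c11D[OF assms(1)] in auto)
  have nb: "norm (\<integral>\<omega>. h \<omega> \<partial>M) \<le> B" if "integrable M h" "\<And>\<omega>. norm (h \<omega>) \<le> B"
    for h :: "'a \<Rightarrow> 'c::euclidean_space" and B
    using norm_integral_le[OF that(1), of "\<lambda>_. B"] that(2) by (simp add: prob_space)
  show ?thesis unfolding c11_def
  proof (intro conjI allI)
    fix x k
    show "\<bar>\<integral>\<omega>. g (x + Y \<omega>) \<partial>M\<bar> \<le> C" using nb[OF ig[of x]] c11D(1)[OF assms(1)] by auto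
    show "norm (\<integral>\<omega>. D (x + Y \<omega>) \<partial>M) \<le> C" using nb[OF iD[of x]] c11D(2)[OF assms(1)] by auto
    have "(\<integral>\<omega>. g (x + k + Y \<omega>) \<partial>M) - (\<integral>\<omega>. g (x + Y \<omega>) \<partial>M) - (\<integral>\<omega>. D (x + Y \<omega>) \<partial>M) \<bullet> k
      = (\<integral>\<omega>. g (x + k + Y \<omega>) - g (x + Y \<omega>) - D (x + Y \<omega>) \<bullet> k \<partial>M)"
      using ig iD by simp
    also have "\<bar>\<dots>\<bar> \<le> C * (norm k)\<^sup>2"
      unfolding real_norm_def[symmetric]
    proof (rule nb)
      show "norm (g (x + k + Y \<omega>) - g (x + Y \<omega>) - D (x + Y \<omega>) \<bullet> k) \<le> C * (norm k)\<^sup>2" for \<omega>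
        using c11D(3)[OF assms(1), of "x + Y \<omega>" k] by (simp add: algebra_simps)
    qed (use ig iD in simp)
    finally show "\<bar>(\<integral>\<omega>. g (x + k + Y \<omega>) \<partial>M) - (\<integral>\<omega>. g (x + Y \<omega>) \<partial>M)
        - (\<integral>\<omega>. D (x + Y \<omega>) \<partial>M) \<bullet> k\<bar> \<le> C * (norm k)\<^sup>2" .
  qed
qed

section \<open>Mollification of bounded uniformly continuous functions\<close>

lemma lborel_integral_shift:
  fixes h :: "'v::euclidean_space \<Rightarrow> 'b::{banach, second_countable_topology}"
  assumes [measurable]: "h \<in> borel_measurable borel"
  shows "(\<integral>z. h (k + z) \<partial>lborel) = (\<integral>z. h z \<partial>lborel)"
proof -
  have "(\<integral>z. h z \<partial>lborel) = (\<integral>z. h z \<partial>distr lborel borel ((+) k))" by (simp add: lborel_distr_plus)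
  also have "\<dots> = (\<integral>z. h (k + z) \<partial>lborel)" by (rule integral_distr) auto
  finally show ?thesis by simp
qed

text \<open>Squaring the positive part of 1 - t smooths its kink: the derivative -2 max 0 (1 - s) is
  2-Lipschitz. The cases place s and t relative to the kink at 1. This is the radial profile of the
  kernel in \<open>mollify\<close>.\<close>

lemma truncated_square_Taylor:
  fixes s t :: real
  shows "\<bar>(max 0 (1 - t))\<^sup>2 - (max 0 (1 - s))\<^sup>2 + 2 * max 0 (1 - s) * (t - s)\<bar> \<le> (t - s)\<^sup>2"
proof -
  have "(1 - t)\<^sup>2 - (1 - s)\<^sup>2 + 2 * (1 - s) * (t - s) = (t - s)\<^sup>2"
    by (simp add: power2_eq_square algebra_simps)
  then have 1: ?thesis if "s \<le> 1" "t \<le> 1" using that by simp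
  have 2: ?thesis if "s \<le> 1" "1 < t"
  proof -
    have "\<bar>(1 - s) * ((t - s) + (t - 1))\<bar> \<le> (t - s)\<^sup>2"
    proof -
      have "(t - s)\<^sup>2 = (1 - s)\<^sup>2 + 2 * (1 - s) * (t - 1) + (t - 1)\<^sup>2"
        by (simp add: power2_eq_square algebra_simps)
      moreover have "(1 - s) * ((t - s) + (t - 1)) = (1 - s)\<^sup>2 + 2 * (1 - s) * (t - 1)"
        by (simp add: power2_eq_square algebra_simps)
      moreover have "0 \<le> (1 - s) * ((t - s) + (t - 1))" using that by simp
      ultimately show ?thesis by simp
    qed
    moreover have "(max 0 (1 - t))\<^sup>2 - (max 0 (1 - s))\<^sup>2 + 2 * max 0 (1 - s) * (t - s)
      = (1 - s) * ((t - s) + (t - 1))"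
      using that by (simp add: max_def power2_eq_square algebra_simps)
    ultimately show ?thesis by simp
  qed
  have 3: ?thesis if "1 < s" "t \<le> 1"
  proof -
    have "(1 - t)\<^sup>2 \<le> (s - t)\<^sup>2" using that by (intro power_mono) auto
    then show ?thesis using that by (simp add: max_def power2_commute)
  qed
  have 4: ?thesis if "1 < s" "1 < t" using that by simp
  show ?thesis using 1 2 3 4 by linarith
qed

text \<open>\<open>g\<close> averages \<open>f\<close> with a kernel \<open>w\<close> supported in
  the ball of radius \<open>r\<close>, in which \<open>f\<close> varies by less than \<epsilon>.
  Substituting z - k for z moves the increment from \<open>f\<close> onto \<open>w\<close>, so only
  the kernel has to be expanded.\<close>

lemma mollify:
  fixes f :: "'v::euclidean_space \<Rightarrow> real"
  assumes f: "\<And>x. \<bar>f x\<bar> \<le> c" and uc: "uniformly_continuous_on UNIV f" and "\<epsilon> > 0"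
  obtains g D C where "c11 C g D" "\<And>x. \<bar>g x - f x\<bar> \<le> \<epsilon>" "\<And>x. \<bar>g x\<bar> \<le> c"
proof -
  have [measurable]: "f \<in> borel_measurable borel"
    by (intro borel_measurable_continuous_onI uniformly_continuous_imp_continuous uc)
  obtain r where r: "r > 0" "\<And>x y. dist y x < r \<Longrightarrow> \<bar>f y - f x\<bar> < \<epsilon>"
    using uc \<open>\<epsilon> > 0\<close> unfolding uniformly_continuous_on_def dist_real_def by auto
  have c0: "0 \<le> c" using f[of undefined] by linarith
  define p :: "'v \<Rightarrow> real" where "p z = max 0 (1 - (norm z)\<^sup>2 / r\<^sup>2)" for z
  define w where "w z = (p z)\<^sup>2" for z
  \<comment> \<open>The gradient of \<open>w\<close>: the chain rule gives 2 p times -2 z /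
    r^2.\<close>
  define dw where "dw z = (- (4 / r\<^sup>2) * p z) *\<^sub>R z" for z
  have [measurable]: "p \<in> borel_measurable borel" "w \<in> borel_measurable borel"
    "dw \<in> borel_measurable borel"
    unfolding p_def[abs_def] w_def[abs_def] dw_def[abs_def] by measurable
  have p01: "0 \<le> p z" "p z \<le> 1" for z unfolding p_def by auto
  have p0: "p z = 0" if "r \<le> norm z" for z
  proof -
    have "r\<^sup>2 \<le> (norm z)\<^sup>2" using that r by (intro power_mono) auto
    then have "1 \<le> (norm z)\<^sup>2 / r\<^sup>2" using r by simp
    then show ?thesis unfolding p_def by simp
  qed
  have w01: "0 \<le> w z" "w z \<le> indicator (cball 0 r) z" for z
    using p01[of z] p0[of z] unfolding w_def
    by (auto simp: power_le_one split: split_indicator)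
  have ball_fin: "integrable lborel (indicator (cball (0::'v) R) :: 'v \<Rightarrow> real)" for R
    using emeasure_bounded_finite[OF bounded_cball, of "0::'v" R] by (simp add: integrable_indicator_iff)
  have dom: "integrable lborel h" if "h \<in> borel_measurable borel"
      "\<And>z. norm (h z) \<le> B * indicator (cball 0 R) z"
    for h :: "'v \<Rightarrow> 'c::euclidean_space" and B R
    by (rule Bochner_Integration.integrable_bound[OF integrable_mult_right[OF ball_fin[of R], of B]])
       (use that in \<open>auto intro!: AE_I2 order_trans[OF that(2)] mult_right_mono simp: abs_mult\<close>)
  have iw: "integrable lborel w" by (rule dom[of _ 1 r]) (use w01 in auto)
  have ifw: "integrable lborel (\<lambda>z. f (x + z) * w (z - k))" for x k
  proof (rule dom[of _ c "r + norm k"])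
    fix z
    have "\<bar>f (x + z)\<bar> * \<bar>w (z - k)\<bar> \<le> c * indicator (cball 0 r) (z - k)"
      using w01[of "z - k"] f[of "x + z"] c0 by (intro mult_mono) auto
    also have "\<dots> \<le> c * indicator (cball 0 (r + norm k)) z"
      using c0 norm_triangle_ineq[of "z - k" k] by (auto split: split_indicator)
    finally show "norm (f (x + z) * w (z - k)) \<le> c * indicator (cball 0 (r + norm k)) z"
      by (simp add: abs_mult)
  qed auto
  have dwb: "norm (dw z) \<le> (4 / r) * indicator (cball 0 r) z" for z
  proof (cases "norm z \<le> r")
    case True
    have "norm (dw z) = (4 / r\<^sup>2) * (p z * norm z)" unfolding dw_def using p01[of z] by simp
    also have "\<dots> \<le> (4 / r\<^sup>2) * (1 * r)"
      using p01[of z] True r by (intro mult_left_mono mult_mono) auto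
    also have "\<dots> = 4 / r" using r by (simp add: power2_eq_square)
    finally show ?thesis using True by simp
  qed (auto simp: dw_def p0)
  have ifdw: "integrable lborel (\<lambda>z. f (x + z) *\<^sub>R dw z)" for x
  proof (rule dom[of _ "c * (4 / r)" r])
    fix z
    show "norm (f (x + z) *\<^sub>R dw z) \<le> c * (4 / r) * indicator (cball 0 r) z"
      using mult_mono[OF f[of "x + z"] dwb[of z] c0] by (simp add: mult.assoc)
  qed auto
  define V where "V = (\<integral>z. w z \<partial>lborel)"
  have "V > 0"
  proof -
    \<comment> \<open>On the ball of radius r / 2 the profile satisfies p \<ge> 1 - 1/4, so w \<ge>
      (3/4)^2.\<close>
    have "0 < (9/16) * measure lborel (cball (0::'v) (r / 2))"
      using content_cball_pos[of "r / 2" "0::'v"] r by simp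
    also have "\<dots> = (\<integral>z. (9/16) * indicator (cball 0 (r / 2)) z \<partial>(lborel :: 'v measure))"
      by simp
    also have "\<dots> \<le> V" unfolding V_def
    proof (rule integral_mono[OF _ iw])
      fix z :: 'v
      show "(9/16) * indicator (cball 0 (r / 2)) z \<le> w z"
      proof (cases "norm z \<le> r / 2")
        case True
        have "(norm z)\<^sup>2 \<le> (r / 2)\<^sup>2" using True by (intro power_mono) auto
        then have "(norm z)\<^sup>2 / r\<^sup>2 \<le> 1/4" using r by (simp add: field_simps power2_eq_square)
        then have "3/4 \<le> p z" unfolding p_def by (intro max.coboundedI2) linarith
        then have "(3/4)\<^sup>2 \<le> w z" unfolding w_def by (intro power_mono) auto
        then show ?thesis using True by (simp add: power2_eq_square)
      qed (use w01(1)[of z] in auto)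
    qed (use ball_fin in simp)
    finally show ?thesis .
  qed
  define g where "g x = (\<integral>z. f (x + z) * w z \<partial>lborel) / V" for x
  define D where "D x = - ((\<integral>z. f (x + z) *\<^sub>R dw z \<partial>lborel) /\<^sub>R V)" for x
  \<comment> \<open>Constant of the kernel expansion. The argument |z|^2 / r^2 changes by (|k|^2 - 2
    z \<bullet> k) / r^2, at most (2 (r + 1) + 1) |k| / r^2 when |z| \<le> r + 1 and |k| \<le> 1;
    its square gives the first summand. The second one absorbs the |k|^2 in that change.\<close>
  define C1 where "C1 = (2 * (r + 1) + 1)\<^sup>2 / r ^ 4 + 2 / r\<^sup>2"
  define vol where "vol R = measure lborel (cball (0::'v) R)" for R
  have gk: "g (x + k) = (\<integral>z. f (x + z) * w (z - k) \<partial>lborel) / V" for x k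
    unfolding g_def using lborel_integral_shift[of "\<lambda>z. f (x + z) * w (z - k)" k]
    by (simp add: add.assoc)
  have gc: "\<bar>g x\<bar> \<le> c" for x
  proof -
    have "\<bar>\<integral>z. f (x + z) * w z \<partial>lborel\<bar> \<le> (\<integral>z. c * w z \<partial>lborel)"
      unfolding real_norm_def[symmetric]
      by (rule norm_integral_le)
         (use ifw[of x 0] iw f w01 in \<open>auto simp: abs_mult intro!: mult_right_mono\<close>)
    then have "\<bar>\<integral>z. f (x + z) * w z \<partial>lborel\<bar> \<le> c * V" using iw by (simp add: V_def)
    then show ?thesis unfolding g_def using \<open>V > 0\<close> by (simp add: abs_divide field_simps)
  qed
  have Dc: "norm (D x) \<le> c * (4 / r) * vol r / V" for x
  proof -
    have "norm (\<integral>z. f (x + z) *\<^sub>R dw z \<partial>lborel) \<le> (\<integral>z. c * (4 / r) * indicator (cball 0 r) z \<partial>(lborel :: 'v measure))"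
    proof (rule norm_integral_le[OF ifdw])
      show "norm (f (x + z) *\<^sub>R dw z) \<le> c * (4 / r) * indicator (cball 0 r) z" for z
        using mult_mono[OF f[of "x + z"] dwb[of z] c0] by (simp add: mult.assoc)
    qed (use ball_fin in simp)
    also have "\<dots> = c * (4 / r) * vol r" by (simp add: vol_def)
    finally show ?thesis unfolding D_def using \<open>V > 0\<close> by (simp add: divide_inverse mult.commute)
  qed
  \<comment> \<open>For |k| \<le> 1 the shifted kernel still lives in the ball of radius r + 1;
    outside it all three terms vanish.\<close>
  have wT: "\<bar>w (z - k) - w z + dw z \<bullet> k\<bar> \<le> C1 * (norm k)\<^sup>2 * indicator (cball 0 (r + 1)) z"
    if k: "norm k \<le> 1" for z k
  proof (cases "norm z \<le> r + 1")
    case True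
    define s where "s = (norm z)\<^sup>2 / r\<^sup>2"
    define t where "t = (norm (z - k))\<^sup>2 / r\<^sup>2"
    have ts: "t - s = ((norm k)\<^sup>2 - 2 * (z \<bullet> k)) / r\<^sup>2"
      unfolding s_def t_def by (simp add: power2_norm_eq_inner inner_diff diff_divide_distrib[symmetric] inner_commute)
    have zk: "\<bar>z \<bullet> k\<bar> \<le> (r + 1) * norm k"
      using Cauchy_Schwarz_ineq2[of z k] True by (meson mult_right_mono norm_ge_zero order_trans)
    have "(norm k)\<^sup>2 \<le> norm k" using k by (simp add: power2_eq_square mult_left_le)
    then have "\<bar>(norm k)\<^sup>2 - 2 * (z \<bullet> k)\<bar> \<le> 2 * ((r + 1) * norm k) + norm k"
      using zk zero_le_power2[of "norm k"] by linarith
    then have "\<bar>(norm k)\<^sup>2 - 2 * (z \<bullet> k)\<bar> \<le> (2 * (r + 1) + 1) * norm k"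
      by (simp add: distrib_right)
    then have "\<bar>(norm k)\<^sup>2 - 2 * (z \<bullet> k)\<bar>\<^sup>2 \<le> ((2 * (r + 1) + 1) * norm k)\<^sup>2"
      by (intro power_mono) auto
    then have A: "(t - s)\<^sup>2 \<le> (2 * (r + 1) + 1)\<^sup>2 / r ^ 4 * (norm k)\<^sup>2"
      unfolding ts using r by (simp add: power_divide power_mult_distrib divide_right_mono flip: power_mult)
    have B: "\<bar>(p (z - k))\<^sup>2 - (p z)\<^sup>2 + 2 * p z * (t - s)\<bar> \<le> (t - s)\<^sup>2"
      using truncated_square_Taylor[of t s] unfolding p_def s_def t_def .
    have C: "2 * p z * (t - s) = dw z \<bullet> k + 2 * p z * ((norm k)\<^sup>2 / r\<^sup>2)"
      unfolding ts dw_def by (simp add: diff_divide_distrib algebra_simps)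
    have D: "\<bar>2 * p z * ((norm k)\<^sup>2 / r\<^sup>2)\<bar> \<le> 2 / r\<^sup>2 * (norm k)\<^sup>2"
    proof -
      have "p z * ((norm k)\<^sup>2 / r\<^sup>2) \<le> 1 * ((norm k)\<^sup>2 / r\<^sup>2)" using p01 by (intro mult_right_mono) auto
      then show ?thesis using p01[of z] by (simp add: abs_mult)
    qed
    have "\<bar>w (z - k) - w z + dw z \<bullet> k\<bar> \<le> C1 * (norm k)\<^sup>2"
      using A B C D unfolding w_def C1_def distrib_right by linarith
    then show ?thesis using True by simp
  next
    case False
    then have "r \<le> norm (z - k)" "r \<le> norm z"
      using norm_triangle_ineq2[of z k] k by auto
    then show ?thesis using False by (simp add: w_def dw_def p0)
  qed
  have gT: "\<bar>g (x + k) - g x - D x \<bullet> k\<bar> \<le> c * C1 * vol (r + 1) / V * (norm k)\<^sup>2" if k: "norm k \<le> 1" for x k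
  proof -
    have i3: "integrable lborel (\<lambda>z. f (x + z) * (dw z \<bullet> k))"
      using integrable_inner_left[OF ifdw[of x], of k] by simp
    have "(\<integral>z. f (x + z) *\<^sub>R dw z \<partial>lborel) \<bullet> k = (\<integral>z. f (x + z) * (dw z \<bullet> k) \<partial>lborel)"
      using integral_inner_left[OF ifdw[of x], of k] by simp
    then have "g (x + k) - g x - D x \<bullet> k
       = ((\<integral>z. f (x + z) * w (z - k) \<partial>lborel) - (\<integral>z. f (x + z) * w (z - 0) \<partial>lborel)
         + (\<integral>z. f (x + z) * (dw z \<bullet> k) \<partial>lborel)) / V"
      unfolding gk g_def[of x] D_def by (simp add: divide_inverse algebra_simps)
    also have "\<dots> = (\<integral>z. f (x + z) * (w (z - k) - w z + dw z \<bullet> k) \<partial>lborel) / V"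
      using ifw[of x k] ifw[of x 0] i3 by (simp add: algebra_simps)
    finally have eq: "g (x + k) - g x - D x \<bullet> k = (\<integral>z. f (x + z) * (w (z - k) - w z + dw z \<bullet> k) \<partial>lborel) / V" .
    have bd: "norm (f (x + z) * (w (z - k) - w z + dw z \<bullet> k)) \<le> c * C1 * (norm k)\<^sup>2 * indicator (cball 0 (r + 1)) z" for z
    proof -
      have "\<bar>f (x + z)\<bar> * \<bar>w (z - k) - w z + dw z \<bullet> k\<bar> \<le> c * (C1 * (norm k)\<^sup>2 * indicator (cball 0 (r + 1)) z)"
        using f wT[OF k, of z] c0 by (intro mult_mono) auto
      then show ?thesis by (simp add: abs_mult mult.assoc)
    qed
    have "norm (\<integral>z. f (x + z) * (w (z - k) - w z + dw z \<bullet> k) \<partial>lborel)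
      \<le> (\<integral>z. c * C1 * (norm k)\<^sup>2 * indicator (cball 0 (r + 1)) z \<partial>(lborel :: 'v measure))"
    proof (rule norm_integral_le[OF _ _ bd])
      show "integrable lborel (\<lambda>z. f (x + z) * (w (z - k) - w z + dw z \<bullet> k))"
        by (rule dom[OF _ bd]) auto
    qed (use ball_fin in simp)
    also have "\<dots> = c * C1 * (norm k)\<^sup>2 * vol (r + 1)" by (simp add: vol_def)
    finally show ?thesis unfolding eq using \<open>V > 0\<close> by (simp add: abs_divide field_simps)
  qed
  define C where "C = 2 * c + c * (4 / r) * vol r / V + c * C1 * vol (r + 1) / V"
  have pos: "0 \<le> c * (4 / r) * vol r / V" "0 \<le> c * C1 * vol (r + 1) / V"
    using c0 r \<open>V > 0\<close> unfolding vol_def C1_def by auto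
  have "c11 C g D" unfolding c11_def
  proof (intro conjI allI)
    fix x k
    show "\<bar>g x\<bar> \<le> C" using gc[of x] pos c0 unfolding C_def by linarith
    show "norm (D x) \<le> C" using Dc[of x] pos c0 unfolding C_def by linarith
    show "\<bar>g (x + k) - g x - D x \<bullet> k\<bar> \<le> C * (norm k)\<^sup>2"
    proof (cases "norm k \<le> 1")
      case True
      have "c * C1 * vol (r + 1) / V * (norm k)\<^sup>2 \<le> C * (norm k)\<^sup>2"
        using pos c0 unfolding C_def by (intro mult_right_mono) auto
      then show ?thesis using gT[OF True, of x] by linarith
    next
      case False
      \<comment> \<open>Long increments: the values of \<open>g\<close> and the linear term are
        bounded separately, because 1 and |k| are at most |k|^2.\<close>
      then have n: "1 \<le> norm k" "norm k \<le> (norm k)\<^sup>2" "1 \<le> (norm k)\<^sup>2"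
        using one_le_power[of "norm k" 2] by (auto simp: power2_eq_square mult_le_cancel_left1)
      have "\<bar>D x \<bullet> k\<bar> \<le> (c * (4 / r) * vol r / V) * norm k"
        using Cauchy_Schwarz_ineq2[of "D x" k] Dc[of x] by (meson mult_right_mono norm_ge_zero order_trans)
      also have "\<dots> \<le> (c * (4 / r) * vol r / V) * (norm k)\<^sup>2" using n pos by (intro mult_left_mono) auto
      finally have "\<bar>g (x + k) - g x - D x \<bullet> k\<bar> \<le> 2 * c * (norm k)\<^sup>2 + (c * (4 / r) * vol r / V) * (norm k)\<^sup>2"
        using gc[of x] gc[of "x + k"] mult_left_mono[OF n(3), of "2 * c"] c0 by linarith
      also have "\<dots> \<le> C * (norm k)\<^sup>2"
        using pos unfolding C_def distrib_right[symmetric] by (intro mult_right_mono) auto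
      finally show ?thesis .
    qed
  qed
  moreover have "\<bar>g x - f x\<bar> \<le> \<epsilon>" for x
  proof -
    have "g x - f x = ((\<integral>z. f (x + z) * w z \<partial>lborel) - (\<integral>z. f x * w z \<partial>lborel)) / V"
      unfolding g_def using \<open>V > 0\<close> by (simp add: diff_divide_distrib V_def)
    also have "\<dots> = (\<integral>z. f (x + z) * w z - f x * w z \<partial>lborel) / V"
      using ifw[of x 0] iw by simp
    finally have eq: "g x - f x = (\<integral>z. f (x + z) * w z - f x * w z \<partial>lborel) / V" .
    have "norm (\<integral>z. f (x + z) * w z - f x * w z \<partial>lborel) \<le> (\<integral>z. \<epsilon> * w z \<partial>lborel)"
    proof (rule norm_integral_le)
      fix z
      show "norm (f (x + z) * w z - f x * w z) \<le> \<epsilon> * w z"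
      proof (cases "norm z < r")
        case True
        then have "\<bar>f (x + z) - f x\<bar> \<le> \<epsilon>" using r(2)[of "x + z" x] by (auto simp: dist_norm)
        then have "\<bar>f (x + z) - f x\<bar> * w z \<le> \<epsilon> * w z" using w01 by (intro mult_right_mono) auto
        then show ?thesis using w01(1)[of z] by (simp add: abs_mult flip: left_diff_distrib)
      qed (simp add: w_def p0)
    qed (use ifw[of x 0] iw in auto)
    then have "\<bar>\<integral>z. f (x + z) * w z - f x * w z \<partial>lborel\<bar> \<le> \<epsilon> * V" using iw by (simp add: V_def)
    then show ?thesis unfolding eq using \<open>V > 0\<close> by (simp add: abs_divide field_simps)
  qed
  ultimately show ?thesis using that gc by blast
qed

section \<open>Gaussian moments\<close>

text \<open>Lebesgue measure is the image of the product of line measures over \<open>Basis\<close>,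
  so the product formula for independent coordinates carries over. \<open>prod_Basis_vec\<close>
  then re-indexes \<open>Basis\<close> by coordinates.\<close>

lemma lborel_prod_integral:
  fixes f :: "'v::euclidean_space \<Rightarrow> real \<Rightarrow> real"
  assumes f: "\<And>b. b \<in> Basis \<Longrightarrow> integrable lborel (f b)"
  shows "integrable lborel (\<lambda>x. \<Prod>b\<in>Basis. f b (x \<bullet> b))"
    and "(\<integral>x. (\<Prod>b\<in>Basis. f b (x \<bullet> b)) \<partial>lborel) = (\<Prod>b\<in>Basis. (\<integral>x. f b x \<partial>lborel))"
proof -
  interpret product_sigma_finite "\<lambda>_::'v. lborel :: real measure"
    by standard
  have m: "(\<lambda>g::'v \<Rightarrow> real. \<Sum>b\<in>Basis. g b *\<^sub>R b) \<in> measurable (\<Pi>\<^sub>M b\<in>Basis. lborel) borel"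
    by measurable
  have [measurable]: "b \<in> Basis \<Longrightarrow> f b \<in> borel_measurable borel" for b
    using borel_measurable_integrable[OF f[of b]] by simp
  have p: "(\<Prod>b\<in>Basis. f b ((\<Sum>b'\<in>Basis. g b' *\<^sub>R b') \<bullet> b)) = (\<Prod>b\<in>Basis. f b (g b))" for g
    by (rule prod.cong) auto
  have "integrable (distr (\<Pi>\<^sub>M b\<in>Basis. lborel) borel (\<lambda>g. \<Sum>b\<in>Basis. g b *\<^sub>R b))
     (\<lambda>x::'v. \<Prod>b\<in>Basis. f b (x \<bullet> b))"
    using product_integrable_prod[of Basis f, OF finite_Basis f]
    by (subst integrable_distr_eq[OF m]) (auto simp: p)
  then show "integrable lborel (\<lambda>x. \<Prod>b\<in>Basis. f b (x \<bullet> b))"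
    by (simp flip: lborel_eq)
  have "(\<integral>x. (\<Prod>b\<in>Basis. f b (x \<bullet> b)) \<partial>distr (\<Pi>\<^sub>M b\<in>Basis. lborel) borel (\<lambda>g. \<Sum>b\<in>Basis. g b *\<^sub>R b :: 'v))
     = (\<Prod>b\<in>Basis. (\<integral>x. f b x \<partial>lborel))"
    using product_integral_prod[of Basis f, OF finite_Basis f]
    by (subst integral_distr[OF m]) (auto simp: p)
  then show "(\<integral>x. (\<Prod>b\<in>Basis. f b (x \<bullet> b)) \<partial>lborel) = (\<Prod>b\<in>Basis. (\<integral>x. f b x \<partial>lborel))"
    by (simp flip: lborel_eq)
qed

lemma prod_Basis_vec:
  fixes f :: "'n::finite \<Rightarrow> 'b::comm_monoid_mult"
  shows "(\<Prod>b\<in>(Basis :: (real ^ 'n) set). f (inv (\<lambda>i. axis i 1) b)) = (\<Prod>i\<in>UNIV. f i)"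
proof -
  have inj: "inj (\<lambda>i::'n. axis i (1::real))" by (simp add: inj_on_def axis_eq_axis)
  have B: "(Basis :: (real ^ 'n) set) = range (\<lambda>i. axis i 1)" by (auto simp: Basis_vec_def)
  show ?thesis unfolding B prod.reindex[OF inj] comp_def inv_f_f[OF inj] ..
qed

lemma lborel_vec_prod_integral:
  fixes f :: "'n::finite \<Rightarrow> real \<Rightarrow> real"
  assumes f: "\<And>i. integrable lborel (f i)"
  shows "integrable lborel (\<lambda>x::real ^ 'n. \<Prod>i\<in>UNIV. f i (x $ i))"
    and "(\<integral>x. (\<Prod>i\<in>UNIV. f i (x $ i)) \<partial>(lborel :: (real ^ 'n) measure)) = (\<Prod>i\<in>UNIV. (\<integral>x. f i x \<partial>lborel))"
proof -
  let ?j = "inv (\<lambda>i::'n. axis i (1::real))"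
  have inj: "inj (\<lambda>i::'n. axis i (1::real))" by (simp add: inj_on_def axis_eq_axis)
  have "f (?j b) (x \<bullet> b) = f (?j b) (x $ ?j b)" if "b \<in> Basis" for b and x :: "real ^ 'n"
    using that by (auto simp: Basis_vec_def inv_f_f[OF inj] inner_axis)
  then have "(\<Prod>b\<in>Basis. f (?j b) (x \<bullet> b)) = (\<Prod>b\<in>Basis. f (?j b) (x $ ?j b))" for x :: "real ^ 'n"
    by (intro prod.cong) auto
  also have "(\<Prod>b\<in>Basis. f (?j b) (x $ ?j b)) = (\<Prod>i\<in>UNIV. f i (x $ i))" for x :: "real ^ 'n"
    by (rule prod_Basis_vec)
  finally have e: "(\<Prod>b\<in>Basis. f (?j b) (x \<bullet> b)) = (\<Prod>i\<in>UNIV. f i (x $ i))" for x :: "real ^ 'n" .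
  show "integrable lborel (\<lambda>x::real ^ 'n. \<Prod>i\<in>UNIV. f i (x $ i))"
    using lborel_prod_integral(1)[of "\<lambda>b. f (?j b)"] f by (simp add: e)
  show "(\<integral>x. (\<Prod>i\<in>UNIV. f i (x $ i)) \<partial>(lborel :: (real ^ 'n) measure)) = (\<Prod>i\<in>UNIV. (\<integral>x. f i x \<partial>lborel))"
    using lborel_prod_integral(2)[of "\<lambda>b. f (?j b)"] f
    by (simp add: e prod_Basis_vec[of "\<lambda>i. integral\<^sup>L lborel (f i)"])
qed

lemma sets_std_gaussian [simp, measurable_cong]: "sets std_gaussian = sets borel"
  and space_std_gaussian [simp]: "space std_gaussian = UNIV"
  by (simp_all add: std_gaussian_def)

lemma std_gaussian_prod:
  fixes g :: "'n::finite \<Rightarrow> real \<Rightarrow> real"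
  assumes [measurable]: "\<And>i. g i \<in> borel_measurable borel"
    and g: "\<And>i. integrable lborel (\<lambda>y. std_normal_density y * g i y)"
  shows "integrable std_gaussian (\<lambda>x::real ^ 'n. \<Prod>i\<in>UNIV. g i (x $ i))"
    and "(\<integral>x. (\<Prod>i\<in>UNIV. g i (x $ i)) \<partial>(std_gaussian :: (real ^ 'n) measure))
      = (\<Prod>i\<in>UNIV. (\<integral>y. std_normal_density y * g i y \<partial>lborel))"
  unfolding std_gaussian_def
  using lborel_vec_prod_integral[of "\<lambda>i y. std_normal_density y * g i y"] g
  by (simp_all add: integrable_density integral_density prod_nonneg prod.distrib)

lemma prob_space_std_gaussian: "prob_space (std_gaussian :: (real ^ 'n::finite) measure)"
proof
  have "integrable std_gaussian (\<lambda>x::real ^ 'n. 1::real)"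
    "(\<integral>x. 1 \<partial>(std_gaussian :: (real ^ 'n) measure)) = (1::real)"
    using std_gaussian_prod[of "\<lambda>(_::'n) _. 1"] by simp_all
  then show "emeasure (std_gaussian :: (real ^ 'n) measure) (space std_gaussian) = 1"
    using nn_integral_eq_integral[of "std_gaussian :: (real ^ 'n) measure" "\<lambda>_. 1"] by simp
qed

text \<open>\<open>std_gaussian_prod\<close> with a power in one or two coordinates and the constant
  1 in the others; mixed second moments vanish because a first moment does.\<close>

lemma std_gaussian_moments:
  fixes i j :: "'n::finite"
  defines "G \<equiv> std_gaussian :: (real ^ 'n) measure"
  shows "integrable G (\<lambda>x. x $ i)" "(\<integral>x. x $ i \<partial>G) = 0"
    and "integrable G (\<lambda>x. x $ i * x $ j)" "(\<integral>x. x $ i * x $ j \<partial>G) = (if i = j then 1 else 0)"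
    and "integrable G (\<lambda>x. (x $ i) ^ 4)" "(\<integral>x. (x $ i) ^ 4 \<partial>G) = 3"
proof -
  have i0: "integrable lborel std_normal_density" "(\<integral>y. std_normal_density y \<partial>lborel) = 1"
    by simp_all
  have i1: "integrable lborel (\<lambda>y. std_normal_density y * y)"
    "(\<integral>y. std_normal_density y * y \<partial>lborel) = 0"
    using std_normal_moment_odd[of 0] by (auto simp: has_bochner_integral_iff)
  have i2: "integrable lborel (\<lambda>y. std_normal_density y * y\<^sup>2)"
    "(\<integral>y. std_normal_density y * y\<^sup>2 \<partial>lborel) = 1"
    using std_normal_moment_even[of 1] by (auto simp: has_bochner_integral_iff)
  have i4: "integrable lborel (\<lambda>y. std_normal_density y * y ^ 4)"
    "(\<integral>y. std_normal_density y * y ^ 4 \<partial>lborel) = 3"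
    using std_normal_moment_even[of 2] by (auto simp: has_bochner_integral_iff fact_numeral)
  have single: "integrable G (\<lambda>x. h (x $ i))" "(\<integral>x. h (x $ i) \<partial>G) = (\<integral>y. std_normal_density y * h y \<partial>lborel)"
    if "integrable lborel (\<lambda>y. std_normal_density y * h y)" "h \<in> borel_measurable borel"
    for h :: "real \<Rightarrow> real" and i
  proof -
    define g where "g k = (if k = i then h else (\<lambda>_. 1))" for k
    have a: "(\<Prod>k\<in>UNIV. g k (x $ k)) = h (x $ i)" for x :: "real ^ 'n"
    proof -
      have "(\<Prod>k\<in>UNIV. g k (x $ k)) = (\<Prod>k\<in>UNIV. if k = i then h (x $ k) else 1)"
        by (rule prod.cong) (auto simp: g_def)
      then show ?thesis by simp
    qed
    have b: "(\<Prod>k\<in>UNIV. (\<integral>y. std_normal_density y * g k y \<partial>lborel)) = (\<integral>y. std_normal_density y * h y \<partial>lborel)"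
    proof -
      have "(\<Prod>k\<in>UNIV. (\<integral>y. std_normal_density y * g k y \<partial>lborel))
         = (\<Prod>k\<in>UNIV. if k = i then (\<integral>y. std_normal_density y * h y \<partial>lborel) else 1)"
        by (rule prod.cong) (auto simp: g_def)
      then show ?thesis by simp
    qed
    show "integrable G (\<lambda>x. h (x $ i))" "(\<integral>x. h (x $ i) \<partial>G) = (\<integral>y. std_normal_density y * h y \<partial>lborel)"
      using std_gaussian_prod[of g] that unfolding a b G_def by (auto simp: g_def)
  qed
  show "integrable G (\<lambda>x. x $ i)" "(\<integral>x. x $ i \<partial>G) = 0"
    using single[of "\<lambda>y. y"] i1 by auto
  show "integrable G (\<lambda>x. (x $ i) ^ 4)" "(\<integral>x. (x $ i) ^ 4 \<partial>G) = 3"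
    using single[of "\<lambda>y. y ^ 4"] i4 by auto
  have "integrable G (\<lambda>x. x $ i * x $ j) \<and> (\<integral>x. x $ i * x $ j \<partial>G) = (if i = j then 1 else 0)"
  proof (cases "i = j")
    case True
    then show ?thesis using single[of "\<lambda>y. y\<^sup>2" i] i2 by (auto simp: power2_eq_square)
  next
    case False
    define g :: "'n \<Rightarrow> real \<Rightarrow> real" where "g k = (if k = i \<or> k = j then (\<lambda>y. y) else (\<lambda>_. 1))" for k
    have a: "(\<Prod>k\<in>UNIV. g k (x $ k)) = x $ i * x $ j" for x :: "real ^ 'n"
    proof -
      have "(\<Prod>k\<in>UNIV. g k (x $ k)) = (\<Prod>k\<in>UNIV. (if k = i then x $ k else 1) * (if k = j then x $ k else 1))"
        using False by (intro prod.cong) (auto simp: g_def)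
      then show ?thesis by (simp add: prod.distrib)
    qed
    have b: "(\<Prod>k\<in>UNIV. (\<integral>y. std_normal_density y * g k y \<partial>lborel)) = 0"
      by (rule prod_zero) (use i1 in \<open>auto simp: g_def intro!: bexI[of _ i]\<close>)
    show ?thesis
      using std_gaussian_prod[of g] i0 i1 False unfolding a b G_def by (auto simp: g_def)
  qed
  then show "integrable G (\<lambda>x. x $ i * x $ j)" "(\<integral>x. x $ i * x $ j \<partial>G) = (if i = j then 1 else 0)"
    by auto
qed

lemma norm_power2_vec: "(norm x)\<^sup>2 = (\<Sum>i\<in>UNIV. (x $ i)\<^sup>2)" for x :: "real ^ 'n"
  unfolding power2_norm_eq_inner inner_vec_def by (simp add: power2_eq_square)

lemma std_gaussian_inner:
  fixes d :: "real ^ 'n::finite"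
  shows "integrable std_gaussian (\<lambda>x. d \<bullet> x)" "(\<integral>x. d \<bullet> x \<partial>std_gaussian) = 0"
    and "integrable std_gaussian (\<lambda>x. (d \<bullet> x)\<^sup>2)" "(\<integral>x. (d \<bullet> x)\<^sup>2 \<partial>std_gaussian) = (norm d)\<^sup>2"
proof -
  note m = std_gaussian_moments[where 'n='n]
  show "integrable std_gaussian (\<lambda>x. d \<bullet> x)" "(\<integral>x. d \<bullet> x \<partial>std_gaussian) = 0"
    unfolding inner_vec_def using m(1,2) by (simp_all add: integral_sum)
  have e: "(d \<bullet> x)\<^sup>2 = (\<Sum>i\<in>UNIV. \<Sum>j\<in>UNIV. (d $ i * d $ j) * (x $ i * x $ j))" for x
    unfolding inner_vec_def power2_eq_square sum_product by (simp add: algebra_simps)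
  show "integrable std_gaussian (\<lambda>x. (d \<bullet> x)\<^sup>2)"
    unfolding e using m(3) by simp
  have "(\<integral>x. (d \<bullet> x)\<^sup>2 \<partial>std_gaussian) = (\<Sum>i\<in>UNIV. \<Sum>j\<in>UNIV. (d $ i * d $ j) * (if i = j then 1 else 0))"
    unfolding e using m(3,4) by (simp add: integral_sum)
  also have "\<dots> = (\<Sum>i\<in>UNIV. \<Sum>j\<in>UNIV. if i = j then d $ i * d $ j else 0)"
    by (intro sum.cong) auto
  also have "\<dots> = (norm d)\<^sup>2"
    unfolding norm_power2_vec by (simp add: power2_eq_square)
  finally show "(\<integral>x. (d \<bullet> x)\<^sup>2 \<partial>std_gaussian) = (norm d)\<^sup>2" .
qed

lemma std_gaussian_norm:
  defines "G \<equiv> std_gaussian :: (real ^ 'n::finite) measure"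
  shows "integrable G (\<lambda>x. (norm x)\<^sup>2)" "(\<integral>x. (norm x)\<^sup>2 \<partial>G) = CARD('n)"
    and "integrable G (\<lambda>x. (norm x) ^ 4)" "(\<integral>x. (norm x) ^ 4 \<partial>G) \<le> 3 * (CARD('n))\<^sup>2"
proof -
  note m = std_gaussian_moments[where 'n='n, folded G_def]
  have [measurable_cong]: "sets G = sets borel" by (simp add: G_def)
  show "integrable G (\<lambda>x. (norm x)\<^sup>2)" "(\<integral>x. (norm x)\<^sup>2 \<partial>G) = CARD('n)"
    unfolding norm_power2_vec using m(3,4) by (simp_all add: power2_eq_square integral_sum)
  \<comment> \<open>Cauchy-Schwarz reduces the fourth moment of the norm to fourth moments of single
    coordinates.\<close>
  have le: "(norm x) ^ 4 \<le> CARD('n) * (\<Sum>i\<in>UNIV. (x $ i) ^ 4)" for x :: "real ^ 'n"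
  proof -
    have "(norm x) ^ 4 = ((norm x)\<^sup>2)\<^sup>2" by simp
    also have "\<dots> = (\<Sum>i\<in>UNIV. 1 * (x $ i)\<^sup>2)\<^sup>2" by (simp add: norm_power2_vec)
    also have "\<dots> \<le> (\<Sum>i\<in>(UNIV::'n set). 1\<^sup>2) * (\<Sum>i\<in>UNIV. ((x $ i)\<^sup>2)\<^sup>2)"
      by (rule Cauchy_Schwarz_ineq_sum)
    finally show ?thesis by (simp flip: power_mult)
  qed
  have i: "integrable G (\<lambda>x. CARD('n) * (\<Sum>i\<in>UNIV. (x $ i) ^ 4))" using m(5) by simp
  show i4: "integrable G (\<lambda>x. (norm x) ^ 4)"
    by (rule Bochner_Integration.integrable_bound[OF i])
       (use le in \<open>auto intro!: order_trans[OF _ abs_ge_self]\<close>)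
  have "(\<integral>x. (norm x) ^ 4 \<partial>G) \<le> (\<integral>x. CARD('n) * (\<Sum>i\<in>UNIV. (x $ i) ^ 4) \<partial>G)"
    by (rule integral_mono[OF i4 i le])
  also have "\<dots> = 3 * (CARD('n))\<^sup>2" using m(5,6) by (simp add: integral_sum power2_eq_square)
  finally show "(\<integral>x. (norm x) ^ 4 \<partial>G) \<le> 3 * (CARD('n))\<^sup>2" .
qed

section \<open>The heat flow along Brownian increments\<close>

lemma Phi_lipschitz: "\<bar>Phi b - Phi a\<bar> \<le> \<bar>b - a\<bar>"
proof -
  have *: "\<bar>Phi b - Phi a\<bar> \<le> \<bar>b - a\<bar>" if "a < b" for a b
  proof -
    obtain z where "Phi b - Phi a = (b - a) * std_normal_density z"
      using MVT2[of a b Phi std_normal_density] \<open>a < b\<close> DERIV_Phi by blast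
    then have "\<bar>Phi b - Phi a\<bar> = (b - a) * std_normal_density z"
      using std_normal_density_pos[of z] \<open>a < b\<close> by simp
    also have "\<dots> \<le> (b - a) * 1"
      using \<open>a < b\<close> std_normal_density_le_1 by (intro mult_left_mono) auto
    finally show ?thesis by simp
  qed
  show ?thesis using *[of a b] *[of b a] by (cases a b rule: linorder_cases) auto
qed

text \<open>Expand both functions along the difference of the gradients with step length r: the
  values contribute 2 A r^2, the remainders 2 C r^2, and dividing by r gives the claim. It turns a
  time difference of order t - s in the values into order sqrt (t - s) in the gradients.\<close>

lemma c11_gradient_close:
  assumes "c11 C g D" "c11 C g' D'" "\<And>x. \<bar>g x - g' x\<bar> \<le> A * r\<^sup>2" "0 < r" "0 \<le> A"
  shows "norm (D x - D' x) \<le> 2 * (A + C) * r"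
proof (cases "D x = D' x")
  case False
  define e where "e = D x - D' x"
  define k where "k = (r / norm e) *\<^sub>R e"
  have e: "norm e > 0" using False by (simp add: e_def)
  have k: "norm k = r" "e \<bullet> k = r * norm e"
    using e \<open>0 < r\<close> unfolding k_def by (auto simp: dot_square_norm power2_eq_square)
  have "\<bar>g (x + k) - g x - D x \<bullet> k\<bar> \<le> C * r\<^sup>2" "\<bar>g' (x + k) - g' x - D' x \<bullet> k\<bar> \<le> C * r\<^sup>2"
    using c11D(3)[OF assms(1), of x k] c11D(3)[OF assms(2), of x k] k by auto
  moreover have "e \<bullet> k = D x \<bullet> k - D' x \<bullet> k" by (simp add: e_def inner_diff_left)
  ultimately have "r * norm e \<le> 2 * (A * r\<^sup>2) + 2 * (C * r\<^sup>2)"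
    using assms(3)[of x] assms(3)[of "x + k"] k(2) by linarith
  then have "r * norm e \<le> r * (2 * (A + C) * r)" by (simp add: power2_eq_square algebra_simps)
  then show ?thesis using \<open>0 < r\<close> unfolding e_def by (simp add: mult_le_cancel_left_pos)
qed (use assms(4,5) c11D(4)[OF assms(1)] in auto)

locale brownian = prob_space M for M :: "'w measure" +
  fixes F :: "real \<Rightarrow> 'w measure" and W :: "real \<Rightarrow> 'w \<Rightarrow> real ^ 'n::finite"
  assumes filtration: "complete_rc_filtration M F" and bm: "brownian_motion M F W"
begin

lemma subalg: "0 \<le> t \<Longrightarrow> t \<le> 1 \<Longrightarrow> subalgebra M (F t)"
  using filtration by (auto simp: complete_rc_filtration_def)

lemma space_F [simp]: "0 \<le> t \<Longrightarrow> t \<le> 1 \<Longrightarrow> space (F t) = space M"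
  using subalg by (auto simp: subalgebra_def)

lemma F_mono: "0 \<le> s \<Longrightarrow> s \<le> t \<Longrightarrow> t \<le> 1 \<Longrightarrow> subalgebra (F t) (F s)"
  using filtration subalg by (auto simp: complete_rc_filtration_def subalgebra_def)

lemma measurable_F_mono:
  "X \<in> measurable (F s) N \<Longrightarrow> 0 \<le> s \<Longrightarrow> s \<le> t \<Longrightarrow> t \<le> 1 \<Longrightarrow> X \<in> measurable (F t) N"
  using measurable_from_subalg[OF F_mono] by blast

lemma measurable_F_M:
  "X \<in> measurable (F s) N \<Longrightarrow> 0 \<le> s \<Longrightarrow> s \<le> 1 \<Longrightarrow> X \<in> measurable M N"
  using measurable_from_subalg[OF subalg] by blast

lemma W_measurable: "0 \<le> s \<Longrightarrow> s \<le> t \<Longrightarrow> t \<le> 1 \<Longrightarrow> W s \<in> borel_measurable (F t)"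
  using bm measurable_F_mono[of "W s" s borel t] by (auto simp: brownian_motion_def)

lemma W_measurable_M [measurable (raw)]: "0 \<le> s \<Longrightarrow> s \<le> 1 \<Longrightarrow> W s \<in> borel_measurable M"
  using W_measurable[of s s] measurable_F_M by blast

lemma increment_distr:
  assumes "0 \<le> s" "s < t" "t \<le> 1"
  shows "distr M borel (\<lambda>\<omega>. W t \<omega> - W s \<omega>) = distr std_gaussian borel (\<lambda>x. sqrt (t - s) *\<^sub>R x)"
  using bm assms by (auto simp: brownian_motion_def)

lemma increment_integral:
  fixes \<phi> :: "real ^ 'n \<Rightarrow> 'b::{banach, second_countable_topology}"
  assumes "0 \<le> s" "s < t" "t \<le> 1" and [measurable]: "\<phi> \<in> borel_measurable borel"
  shows "(\<integral>\<omega>. \<phi> (W t \<omega> - W s \<omega>) \<partial>M) = (\<integral>x. \<phi> (sqrt (t - s) *\<^sub>R x) \<partial>std_gaussian)"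
    and "integrable M (\<lambda>\<omega>. \<phi> (W t \<omega> - W s \<omega>)) \<longleftrightarrow> integrable std_gaussian (\<lambda>x. \<phi> (sqrt (t - s) *\<^sub>R x))"
proof -
  have [measurable]: "W t \<in> borel_measurable M" "W s \<in> borel_measurable M"
    using assms by (auto intro: W_measurable_M)
  have m: "(\<lambda>x::real ^ 'n. sqrt (t - s) *\<^sub>R x) \<in> borel_measurable std_gaussian" by measurable
  have m': "(\<lambda>\<omega>. W t \<omega> - W s \<omega>) \<in> borel_measurable M" by measurable
  note d = increment_distr[OF assms(1-3)]
  show "(\<integral>\<omega>. \<phi> (W t \<omega> - W s \<omega>) \<partial>M) = (\<integral>x. \<phi> (sqrt (t - s) *\<^sub>R x) \<partial>std_gaussian)"
    using integral_distr[OF m' assms(4)] integral_distr[OF m assms(4)] d by simp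
  show "integrable M (\<lambda>\<omega>. \<phi> (W t \<omega> - W s \<omega>)) \<longleftrightarrow> integrable std_gaussian (\<lambda>x. \<phi> (sqrt (t - s) *\<^sub>R x))"
    using integrable_distr_eq[OF m' assms(4)] integrable_distr_eq[OF m assms(4)] d by simp
qed

lemma increment_moments:
  assumes "0 \<le> s" "s < t" "t \<le> 1"
  defines "w \<equiv> \<lambda>\<omega>. W t \<omega> - W s \<omega>"
  shows "integrable M (\<lambda>\<omega>. d \<bullet> w \<omega>)" "(\<integral>\<omega>. d \<bullet> w \<omega> \<partial>M) = 0"
    and "integrable M (\<lambda>\<omega>. (d \<bullet> w \<omega>)\<^sup>2)" "(\<integral>\<omega>. (d \<bullet> w \<omega>)\<^sup>2 \<partial>M) = (t - s) * (norm d)\<^sup>2"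
    and "integrable M (\<lambda>\<omega>. (norm (w \<omega>))\<^sup>2)" "(\<integral>\<omega>. (norm (w \<omega>))\<^sup>2 \<partial>M) = (t - s) * CARD('n)"
    and "integrable M (\<lambda>\<omega>. (norm (w \<omega>)) ^ 4)" "(\<integral>\<omega>. (norm (w \<omega>)) ^ 4 \<partial>M) \<le> (t - s)\<^sup>2 * (3 * (CARD('n))\<^sup>2)"
proof -
  have h: "0 \<le> t - s" using assms by simp
  have h4: "sqrt (t - s) ^ 4 = (t - s)\<^sup>2" using h real_sqrt_pow2[OF h] by (simp add: power2_eq_square power4_eq_xxxx)
  note i = increment_integral[OF assms(1-3)]
  note g = std_gaussian_inner[of d] std_gaussian_norm[where 'n='n]
  show "integrable M (\<lambda>\<omega>. d \<bullet> w \<omega>)" "(\<integral>\<omega>. d \<bullet> w \<omega> \<partial>M) = 0"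
    using i[of "\<lambda>x. d \<bullet> x"] g unfolding w_def by auto
  show "integrable M (\<lambda>\<omega>. (d \<bullet> w \<omega>)\<^sup>2)" "(\<integral>\<omega>. (d \<bullet> w \<omega>)\<^sup>2 \<partial>M) = (t - s) * (norm d)\<^sup>2"
    using i[of "\<lambda>x. (d \<bullet> x)\<^sup>2"] g h unfolding w_def by (auto simp: power_mult_distrib)
  show "integrable M (\<lambda>\<omega>. (norm (w \<omega>))\<^sup>2)" "(\<integral>\<omega>. (norm (w \<omega>))\<^sup>2 \<partial>M) = (t - s) * CARD('n)"
    using i[of "\<lambda>x. (norm x)\<^sup>2"] g h unfolding w_def by (auto simp: power_mult_distrib)
  show "integrable M (\<lambda>\<omega>. (norm (w \<omega>)) ^ 4)"
    using i(2)[of "\<lambda>x. (norm x) ^ 4"] g h unfolding w_def by (auto simp: power_mult_distrib)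
  have "(\<integral>\<omega>. (norm (w \<omega>)) ^ 4 \<partial>M) = (t - s)\<^sup>2 * (\<integral>x. (norm x) ^ 4 \<partial>(std_gaussian :: (real ^ 'n) measure))"
    using i(1)[of "\<lambda>x. (norm x) ^ 4"] h unfolding w_def by (simp add: power_mult_distrib h4)
  also have "\<dots> \<le> (t - s)\<^sup>2 * (3 * (CARD('n))\<^sup>2)"
    using std_gaussian_norm(4)[where 'n='n] by (intro mult_left_mono) auto
  finally show "(\<integral>\<omega>. (norm (w \<omega>)) ^ 4 \<partial>M) \<le> (t - s)\<^sup>2 * (3 * (CARD('n))\<^sup>2)" .
qed

section \<open>Freezing the past: independence of increments and the heat semigroup\<close>

lemma increment_indep:
  assumes "0 \<le> s" "s < t" "t \<le> 1" and X: "X \<in> measurable (F s) N"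
  shows "distr M N X \<Otimes>\<^sub>M distr M borel (\<lambda>\<omega>. W t \<omega> - W s \<omega>)
    = distr M (N \<Otimes>\<^sub>M borel) (\<lambda>\<omega>. (X \<omega>, W t \<omega> - W s \<omega>))"
proof -
  let ?w = "\<lambda>\<omega>. W t \<omega> - W s \<omega>"
  have s: "s \<le> 1" using assms by simp
  have [measurable]: "X \<in> measurable M N" using measurable_F_M[OF X] assms by simp
  have [measurable]: "W t \<in> borel_measurable M" "W s \<in> borel_measurable M"
    using assms by (auto intro: W_measurable_M)
  interpret A: prob_space "distr M N X" by (rule prob_space_distr) simp
  interpret B: prob_space "distr M borel ?w" by (rule prob_space_distr) simp
  have ind: "indep_set (sets (F s)) {?w -` A \<inter> space M | A. A \<in> sets borel}"
    using bm assms(1-3) unfolding brownian_motion_def by blast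
  show ?thesis
  proof (rule pair_measure_eqI)
    fix A B assume AB: "A \<in> sets (distr M N X)" "B \<in> sets (distr M borel ?w)"
    then have [measurable]: "A \<in> sets N" "B \<in> sets borel" by auto
    have "X -` A \<inter> space M \<in> sets (F s)"
      using measurable_sets[OF X, of A] assms(1) s by simp
    then have "prob ((X -` A \<inter> space M) \<inter> (?w -` B \<inter> space M)) = prob (X -` A \<inter> space M) * prob (?w -` B \<inter> space M)"
      by (intro indep_setD[OF ind]) auto
    moreover have "(\<lambda>\<omega>. (X \<omega>, ?w \<omega>)) -` (A \<times> B) \<inter> space M = (X -` A \<inter> space M) \<inter> (?w -` B \<inter> space M)"
      by auto
    ultimately show "emeasure (distr M N X) A * emeasure (distr M borel ?w) B
        = emeasure (distr M (N \<Otimes>\<^sub>M borel) (\<lambda>\<omega>. (X \<omega>, ?w \<omega>))) (A \<times> B)"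
      by (simp add: emeasure_distr emeasure_eq_measure ennreal_mult)
  qed (auto intro: A.sigma_finite_measure B.sigma_finite_measure simp: A.sigma_finite_measure_axioms B.sigma_finite_measure_axioms)
qed

text \<open>Plays the role of conditioning on \<open>F s\<close>: by the product law the past can be
  frozen while the increment is averaged. \<open>N\<close> is arbitrary, so \<open>X\<close> may be
  the identity into \<open>F s\<close>, which freezes the whole path.\<close>

lemma increment_expectation:
  fixes \<phi> :: "'c \<times> (real ^ 'n) \<Rightarrow> 'b::{banach, second_countable_topology}"
  assumes "0 \<le> s" "s < t" "t \<le> 1" and X: "X \<in> measurable (F s) N"
    and [measurable]: "\<phi> \<in> borel_measurable (N \<Otimes>\<^sub>M borel)" and B: "\<And>z. norm (\<phi> z) \<le> B"
  shows "(\<integral>\<omega>. \<phi> (X \<omega>, W t \<omega> - W s \<omega>) \<partial>M)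
      = (\<integral>\<omega>. (\<integral>\<omega>'. \<phi> (X \<omega>, W t \<omega>' - W s \<omega>') \<partial>M) \<partial>M)"
proof -
  let ?w = "\<lambda>\<omega>. W t \<omega> - W s \<omega>"
  have [measurable]: "X \<in> measurable M N" using measurable_F_M[OF X] assms by simp
  have [measurable]: "W t \<in> borel_measurable M" "W s \<in> borel_measurable M"
    using assms by (auto intro: W_measurable_M)
  interpret A: prob_space "distr M N X" by (rule prob_space_distr) simp
  interpret B: prob_space "distr M borel ?w" by (rule prob_space_distr) simp
  interpret P: pair_prob_space "distr M N X" "distr M borel ?w" ..
  have eq: "distr M N X \<Otimes>\<^sub>M distr M borel ?w = distr M (N \<Otimes>\<^sub>M borel) (\<lambda>\<omega>. (X \<omega>, ?w \<omega>))"
    by (rule increment_indep[OF assms(1-4)])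
  have "(\<integral>\<omega>. \<phi> (X \<omega>, ?w \<omega>) \<partial>M) = (\<integral>z. \<phi> z \<partial>distr M (N \<Otimes>\<^sub>M borel) (\<lambda>\<omega>. (X \<omega>, ?w \<omega>)))"
    by (subst integral_distr) auto
  also have "\<dots> = (\<integral>z. \<phi> z \<partial>(distr M N X \<Otimes>\<^sub>M distr M borel ?w))" by (simp add: eq)
  also have "\<dots> = (\<integral>x. (\<integral>y. \<phi> (x, y) \<partial>distr M borel ?w) \<partial>distr M N X)"
  proof (rule P.integral_fst'[symmetric])
    have "\<phi> \<in> borel_measurable (distr M N X \<Otimes>\<^sub>M distr M borel ?w)" by simp
    then show "integrable (distr M N X \<Otimes>\<^sub>M distr M borel ?w) \<phi>"
      by (rule P.P.integrable_const_bound[where B=B, rotated]) (use B in auto)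
  qed
  also have "\<dots> = (\<integral>\<omega>. (\<integral>y. \<phi> (X \<omega>, y) \<partial>distr M borel ?w) \<partial>M)"
    by (subst integral_distr) auto
  also have "\<dots> = (\<integral>\<omega>. (\<integral>\<omega>'. \<phi> (X \<omega>, ?w \<omega>') \<partial>M) \<partial>M)"
    by (intro Bochner_Integration.integral_cong refl) (subst integral_distr, auto)
  finally show ?thesis .
qed

text \<open>Split the increment at \<open>t\<close>: the first part is known at time
  \<open>t\<close>, the second is independent of it. At t = 1 the second part is zero and is treated
  separately, as \<open>increment_expectation\<close> concerns proper intervals.\<close>

lemma heat_semigroup:
  fixes \<psi> :: "real ^ 'n \<Rightarrow> 'b::{banach, second_countable_topology}"
  assumes "0 \<le> s" "s < t" "t \<le> 1"
    and [measurable]: "\<psi> \<in> borel_measurable borel" and B: "\<And>z. norm (\<psi> z) \<le> B"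
  shows "(\<integral>\<omega>. \<psi> (x + (W 1 \<omega> - W s \<omega>)) \<partial>M)
      = (\<integral>\<omega>. (\<integral>\<omega>'. \<psi> (x + (W t \<omega> - W s \<omega>) + (W 1 \<omega>' - W t \<omega>')) \<partial>M) \<partial>M)"
proof (cases "t = 1")
  case False
  have m: "(\<lambda>\<omega>. W t \<omega> - W s \<omega>) \<in> borel_measurable (F t)"
    using assms by (intro borel_measurable_diff W_measurable) auto
  have "(\<integral>\<omega>. \<psi> (x + (W 1 \<omega> - W s \<omega>)) \<partial>M) = (\<integral>\<omega>. (\<lambda>(y, z). \<psi> (x + y + z)) (W t \<omega> - W s \<omega>, W 1 \<omega> - W t \<omega>) \<partial>M)"
    by (simp add: algebra_simps)
  also have "\<dots> = (\<integral>\<omega>. (\<integral>\<omega>'. (\<lambda>(y, z). \<psi> (x + y + z)) (W t \<omega> - W s \<omega>, W 1 \<omega>' - W t \<omega>') \<partial>M) \<partial>M)"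
    by (rule increment_expectation[OF _ _ _ m, where B=B]) (use assms False B in auto)
  finally show ?thesis by simp
qed (use prob_space in simp)

text \<open>Regularity in time comes from regularity in space. In the mean of v t over the increment
  the linear term vanishes, and the quadratic remainder is at most C times the second moment, n (t -
  s) with n the dimension; \<open>c11_gradient_close\<close> with r = sqrt (t - s) then handles the
  gradient.\<close>

lemma heat_flow_step:
  fixes \<psi> :: "real ^ 'n \<Rightarrow> real"
  assumes c: "c11 C \<psi> D" and st: "0 \<le> s" "s < t" "t \<le> 1"
  defines "v \<equiv> \<lambda>t x. \<integral>\<omega>. \<psi> (x + (W 1 \<omega> - W t \<omega>)) \<partial>M"
    and "dv \<equiv> \<lambda>t x. \<integral>\<omega>. D (x + (W 1 \<omega> - W t \<omega>)) \<partial>M"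
  shows "v s x = (\<integral>\<omega>. v t (x + (W t \<omega> - W s \<omega>)) \<partial>M)"
    and "\<bar>v t x - v s x\<bar> \<le> C * CARD('n) * (t - s)"
    and "norm (dv t x - dv s x) \<le> 2 * C * (1 + CARD('n)) * sqrt (t - s)"
proof -
  note [measurable] = c11_measurable[OF c]
  have [measurable]: "W t \<in> borel_measurable M" "W s \<in> borel_measurable M" "W 1 \<in> borel_measurable M"
    using st by (auto intro: W_measurable_M)
  have cv: "c11 C (v r) (dv r)" if "0 \<le> r" "r \<le> 1" for r
    unfolding v_def dv_def by (rule c11_expectation[OF c]) (use that in measurable)
  have tt: "0 \<le> t" "s \<le> 1" using st by auto
  note cvt = cv[OF tt(1) st(3)] and cvs = cv[OF st(1) tt(2)]
  note [measurable] = c11_measurable[OF cvt]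
  show sg: "v s x = (\<integral>\<omega>. v t (x + (W t \<omega> - W s \<omega>)) \<partial>M)" for x
    unfolding v_def using c11D(1)[OF c] by (intro heat_semigroup st, measurable, auto)
  note mom = increment_moments[OF st]
  have iv: "integrable M (\<lambda>\<omega>. v t (x + (W t \<omega> - W s \<omega>)))" for x
    by (rule integrable_const_bound[where B=C]) (use c11D(1)[OF cvt] in auto)
  show dt: "\<bar>v t x - v s x\<bar> \<le> C * CARD('n) * (t - s)" for x
  proof -
    have "(\<integral>\<omega>. v t (x + (W t \<omega> - W s \<omega>)) - v t x - dv t x \<bullet> (W t \<omega> - W s \<omega>) \<partial>M) = v s x - v t x"
      using iv[of x] mom(1,2)[of "dv t x"] sg[of x] by (simp add: prob_space)
    moreover have "norm (\<integral>\<omega>. v t (x + (W t \<omega> - W s \<omega>)) - v t x - dv t x \<bullet> (W t \<omega> - W s \<omega>) \<partial>M)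
      \<le> (\<integral>\<omega>. C * (norm (W t \<omega> - W s \<omega>))\<^sup>2 \<partial>M)"
      by (rule norm_integral_le)
         (use iv[of x] mom(1)[of "dv t x"] mom(5) c11D(3)[OF cvt] in auto)
    ultimately have "\<bar>v s x - v t x\<bar> \<le> C * ((t - s) * CARD('n))"
      using mom(6) by (simp only: integral_mult_right_zero real_norm_def)
    then show ?thesis by (simp only: abs_minus_commute mult.assoc mult.commute[of "t - s"])
  qed
  have "norm (dv t x - dv s x) \<le> 2 * (C * CARD('n) + C) * sqrt (t - s)"
  proof (rule c11_gradient_close[OF cvt cvs])
    show "\<bar>v t y - v s y\<bar> \<le> C * CARD('n) * (sqrt (t - s))\<^sup>2" for y
      using dt[of y] st by simp
  qed (use st c11D(4)[OF c] in auto)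
  then show "norm (dv t x - dv s x) \<le> 2 * C * (1 + CARD('n)) * sqrt (t - s)"
    by (simp add: algebra_simps)
qed

end

section \<open>The value function\<close>

context brownian
begin

text \<open>The second-order term of the expansion of \<open>inv Phi\<close> produces the Ito correction; all other
  terms are of order \<open>(t - s) powr (3/2)\<close> in expectation.\<close>
lemma one_step_expansion:
  assumes st: "0 \<le> s" "s < t" "t \<le> 1"
    and cv: "c11 C v dv" and cvs: "norm dvs \<le> C" and C: "0 \<le> C" and L: "0 \<le> L"
    and G: "\<And>y. \<bar>G (v y) - G vs - G1 * (v y - vs) - G2 * (v y - vs)\<^sup>2\<bar> \<le> L * \<bar>v y - vs\<bar> ^ 3"
    and G2: "\<bar>G2\<bar> \<le> L"
    and mean: "(\<integral>\<omega>. v (x + (W t \<omega> - W s \<omega>)) \<partial>M) = vs"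
    and vt: "\<bar>v x - vs\<bar> \<le> C * CARD('n) * (t - s)"
    and dvt: "norm (dv x - dvs) \<le> 2 * C * (1 + CARD('n)) * sqrt (t - s)"
    and iG: "integrable M (\<lambda>\<omega>. G (v (x + (W t \<omega> - W s \<omega>))))"
  defines "K1 \<equiv> 3 * C * (1 + CARD('n))"
  shows "\<bar>(\<integral>\<omega>. G (v (x + (W t \<omega> - W s \<omega>))) \<partial>M) - G vs - G2 * ((t - s) * (norm dvs)\<^sup>2)\<bar>
      \<le> L * (32 * C ^ 3 + 4 * (C * CARD('n)) ^ 3 + 4 * C * K1 + 4 * K1\<^sup>2)
          * (1 + CARD('n) + 3 * (CARD('n))\<^sup>2) * ((t - s) * sqrt (t - s))"
proof -
  define N :: real where "N = CARD('n)"
  define r where "r = sqrt (t - s)"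
  have r: "0 < r" "r \<le> 1" "r\<^sup>2 = t - s" using st unfolding r_def by auto
  have N: "0 \<le> N" "0 \<le> K1" "K1 = 3 * C * (1 + N)" using C unfolding N_def K1_def by auto
  define w where "w \<omega> = W t \<omega> - W s \<omega>" for \<omega>
  \<comment> \<open>A common majorant of all error terms of third order. Young's inequality bounds
    b^3 by r b^2 and b^4 / r, so only second and fourth moments occur, and with b the length of the
    increment the expectation of \<open>Q\<close> is of order r^3.\<close>
  define Q where "Q b = r * b\<^sup>2 + b ^ 4 / r + r ^ 3" for b :: real
  have Qcube: "b ^ 3 \<le> Q b" "r\<^sup>2 * b \<le> Q b" "b ^ 4 \<le> Q b" "r ^ 4 \<le> Q b" "r ^ 6 \<le> Q b" if "0 \<le> b" for b
  proof -
    have n: "0 \<le> r * b\<^sup>2" "0 \<le> b ^ 4 / r" "0 \<le> r ^ 3" using r by auto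
    have "0 \<le> (r * b - b\<^sup>2)\<^sup>2 / r" using r by simp
    also have "(r * b - b\<^sup>2)\<^sup>2 / r = r * b\<^sup>2 + b ^ 4 / r - 2 * b ^ 3"
      using r by (simp add: power2_eq_square power3_eq_cube power4_eq_xxxx field_simps)
    finally have "2 * b ^ 3 \<le> r * b\<^sup>2 + b ^ 4 / r" by simp
    then show "b ^ 3 \<le> Q b" using n \<open>0 \<le> b\<close> zero_le_power[OF \<open>0 \<le> b\<close>, of 3] unfolding Q_def by linarith
    have "0 \<le> r * (r - b)\<^sup>2" using r by simp
    also have "r * (r - b)\<^sup>2 = r ^ 3 + r * b\<^sup>2 - 2 * (r\<^sup>2 * b)"
      by (simp add: power2_eq_square power3_eq_cube algebra_simps)
    finally show "r\<^sup>2 * b \<le> Q b" using n mult_nonneg_nonneg[OF zero_le_power2[of r] \<open>0 \<le> b\<close>] unfolding Q_def by linarith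
    have "b ^ 4 * r \<le> b ^ 4 * 1" using r by (intro mult_left_mono) auto
    then have "b ^ 4 \<le> b ^ 4 / r" using r by (simp add: field_simps)
    then show "b ^ 4 \<le> Q b" using n unfolding Q_def by linarith
    have "r ^ 4 \<le> r ^ 3" "r ^ 6 \<le> r ^ 3" using r by (auto intro!: power_decreasing)
    then show "r ^ 4 \<le> Q b" "r ^ 6 \<le> Q b" using n unfolding Q_def by linarith+
  qed
  note mom = increment_moments[OF st, folded w_def]
  have iQ: "integrable M (\<lambda>\<omega>. Q (norm (w \<omega>)))"
    unfolding Q_def using mom by simp
  have EQ: "(\<integral>\<omega>. Q (norm (w \<omega>)) \<partial>M) \<le> (1 + N + 3 * N\<^sup>2) * (r\<^sup>2 * r)"
  proof -
    have "(\<integral>\<omega>. Q (norm (w \<omega>)) \<partial>M) = r * (r\<^sup>2 * N) + (\<integral>\<omega>. (norm (w \<omega>)) ^ 4 \<partial>M) / r + r ^ 3"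
      unfolding Q_def using mom r(3) by (simp add: prob_space N_def)
    also have "\<dots> \<le> r * (r\<^sup>2 * N) + ((r\<^sup>2)\<^sup>2 * (3 * N\<^sup>2)) / r + r ^ 3"
      using mom(8) r unfolding N_def by (intro add_mono divide_right_mono) auto
    also have "\<dots> = (1 + N + 3 * N\<^sup>2) * (r\<^sup>2 * r)"
      using r by (simp add: field_simps power2_eq_square power3_eq_cube power4_eq_xxxx)
    finally show ?thesis .
  qed
  define \<delta> where "\<delta> \<omega> = v (x + w \<omega>) - vs" for \<omega>
  have [measurable]: "W t \<in> borel_measurable M" "W s \<in> borel_measurable M"
    using st by (auto intro: W_measurable_M)
  note [measurable] = c11_measurable[OF cv]
  have i\<delta>: "integrable M \<delta>" "(\<integral>\<omega>. \<delta> \<omega> \<partial>M) = 0"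
  proof -
    have "integrable M (\<lambda>\<omega>. v (x + w \<omega>))"
      by (rule integrable_const_bound[where B=C]) (use c11D(1)[OF cv] in \<open>auto simp: w_def\<close>)
    then show "integrable M \<delta>" "(\<integral>\<omega>. \<delta> \<omega> \<partial>M) = 0"
      using mean unfolding \<delta>_def w_def by (auto simp: prob_space)
  qed
  have main: "\<bar>G (v (x + w \<omega>)) - G vs - G1 * \<delta> \<omega> - G2 * (dvs \<bullet> w \<omega>)\<^sup>2\<bar>
      \<le> L * (32 * C ^ 3 + 4 * (C * N) ^ 3 + 4 * C * K1 + 4 * K1\<^sup>2) * Q (norm (w \<omega>))" for \<omega>
  proof -
    define b where "b = norm (w \<omega>)"
    have b: "0 \<le> b" unfolding b_def by simp
    \<comment> \<open>The deviation of the increment of \<open>v\<close> from its linear part at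
      time \<open>s\<close>; it is of second order in b and r, so in the difference of squares below
      it multiplies a first-order factor.\<close>
    define q where "q = \<delta> \<omega> - dvs \<bullet> w \<omega>"
    have lin: "\<bar>\<delta> \<omega>\<bar> \<le> 2 * C * b + C * N * r\<^sup>2"
      using c11_lipschitz[OF cv, of x "w \<omega>"] vt unfolding \<delta>_def b_def N_def r(3) by linarith
    have cube: "\<bar>\<delta> \<omega>\<bar> ^ 3 \<le> (32 * C ^ 3 + 4 * (C * N) ^ 3) * Q b"
    proof -
      have cub: "(a + d) ^ 3 \<le> 4 * (a ^ 3 + d ^ 3)" if "0 \<le> a" "0 \<le> d" for a d :: real
      proof -
        have "0 \<le> 3 * ((a + d) * (a - d)\<^sup>2)" using that by simp
        also have "\<dots> = 4 * (a ^ 3 + d ^ 3) - (a + d) ^ 3"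
          by (simp add: power2_eq_square power3_eq_cube algebra_simps)
        finally show ?thesis by simp
      qed
      have "\<bar>\<delta> \<omega>\<bar> ^ 3 \<le> (2 * C * b + C * N * r\<^sup>2) ^ 3" using lin by (intro power_mono) auto
      also have "\<dots> \<le> 4 * ((2 * C * b) ^ 3 + (C * N * r\<^sup>2) ^ 3)"
        using C N b by (intro cub) auto
      also have "\<dots> = 32 * C ^ 3 * b ^ 3 + 4 * (C * N) ^ 3 * r ^ 6"
        by (simp add: power_mult_distrib flip: power_mult)
      also have "\<dots> \<le> 32 * C ^ 3 * Q b + 4 * (C * N) ^ 3 * Q b"
        using Qcube[OF b] C N by (intro add_mono mult_left_mono) auto
      finally show ?thesis by (simp add: algebra_simps)
    qed
    have q: "\<bar>q\<bar> \<le> K1 * (b\<^sup>2 + r\<^sup>2)"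
    proof -
      have "q = (v (x + w \<omega>) - v x - dv x \<bullet> w \<omega>) + (v x - vs) + (dv x - dvs) \<bullet> w \<omega>"
        unfolding q_def \<delta>_def by (simp add: inner_diff_left)
      moreover have "\<bar>v (x + w \<omega>) - v x - dv x \<bullet> w \<omega>\<bar> \<le> C * b\<^sup>2"
        using c11D(3)[OF cv] unfolding b_def .
      moreover have "\<bar>v x - vs\<bar> \<le> C * N * r\<^sup>2" using vt unfolding N_def r(3) .
      moreover have "\<bar>(dv x - dvs) \<bullet> w \<omega>\<bar> \<le> C * (1 + N) * (b\<^sup>2 + r\<^sup>2)"
      proof -
        have "\<bar>(dv x - dvs) \<bullet> w \<omega>\<bar> \<le> norm (dv x - dvs) * b"
          unfolding b_def by (rule Cauchy_Schwarz_ineq2)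
        also have "\<dots> \<le> (2 * C * (1 + N) * r) * b"
          using dvt b unfolding N_def r_def by (intro mult_right_mono) auto
        also have "\<dots> = C * (1 + N) * (2 * r * b)" by simp
        also have "\<dots> \<le> C * (1 + N) * (b\<^sup>2 + r\<^sup>2)"
          using C N zero_le_power2[of "b - r"] by (intro mult_left_mono) (auto simp: power2_diff algebra_simps)
        finally show ?thesis .
      qed
      ultimately have "\<bar>q\<bar> \<le> C * b\<^sup>2 + C * N * r\<^sup>2 + C * (1 + N) * (b\<^sup>2 + r\<^sup>2)" by linarith
      also have "\<dots> \<le> 3 * (C * (1 + N) * (b\<^sup>2 + r\<^sup>2))"
      proof -
        have "0 \<le> C * b\<^sup>2" "0 \<le> C * r\<^sup>2" "0 \<le> C * N * b\<^sup>2" "0 \<le> C * N * r\<^sup>2" using C N by auto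
        moreover have "C * (1 + N) * (b\<^sup>2 + r\<^sup>2) = C * b\<^sup>2 + C * r\<^sup>2 + C * N * b\<^sup>2 + C * N * r\<^sup>2"
          by (simp add: algebra_simps)
        ultimately show ?thesis by linarith
      qed
      finally show ?thesis unfolding N(3) by (simp add: algebra_simps)
    qed
    have sq: "\<bar>(\<delta> \<omega>)\<^sup>2 - (dvs \<bullet> w \<omega>)\<^sup>2\<bar> \<le> (4 * C * K1 + 4 * K1\<^sup>2) * Q b"
    proof -
      have "(\<delta> \<omega>)\<^sup>2 - (dvs \<bullet> w \<omega>)\<^sup>2 = q * (2 * (dvs \<bullet> w \<omega>) + q)"
        unfolding q_def by (simp add: power2_eq_square algebra_simps)
      also have "\<bar>\<dots>\<bar> \<le> (K1 * (b\<^sup>2 + r\<^sup>2)) * (2 * (C * b) + K1 * (b\<^sup>2 + r\<^sup>2))"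
      proof -
        have "\<bar>dvs \<bullet> w \<omega>\<bar> \<le> C * b"
          using Cauchy_Schwarz_ineq2[of dvs "w \<omega>"] cvs unfolding b_def
          by (meson mult_right_mono norm_ge_zero order_trans)
        then have "\<bar>2 * (dvs \<bullet> w \<omega>) + q\<bar> \<le> 2 * (C * b) + K1 * (b\<^sup>2 + r\<^sup>2)" using q by linarith
        then show ?thesis unfolding abs_mult using q N by (intro mult_mono) auto
      qed
      also have "\<dots> = 2 * C * K1 * (b ^ 3 + r\<^sup>2 * b) + K1\<^sup>2 * (b\<^sup>2 + r\<^sup>2)\<^sup>2"
        by (simp add: power2_eq_square power3_eq_cube algebra_simps)
      also have "\<dots> \<le> 2 * C * K1 * (2 * Q b) + K1\<^sup>2 * (4 * Q b)"
      proof (intro add_mono mult_left_mono)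
        show "b ^ 3 + r\<^sup>2 * b \<le> 2 * Q b" using Qcube[OF b] by linarith
        have "(b\<^sup>2 + r\<^sup>2)\<^sup>2 \<le> 2 * b ^ 4 + 2 * r ^ 4"
          using zero_le_power2[of "b\<^sup>2 - r\<^sup>2"] by (simp add: power2_diff power2_sum flip: power_mult)
        then show "(b\<^sup>2 + r\<^sup>2)\<^sup>2 \<le> 4 * Q b" using Qcube[OF b] by linarith
      qed (use C N in auto)
      also have "\<dots> = (4 * C * K1 + 4 * K1\<^sup>2) * Q b" by (simp add: algebra_simps)
      finally show ?thesis .
    qed
    have "\<bar>G2 * ((\<delta> \<omega>)\<^sup>2 - (dvs \<bullet> w \<omega>)\<^sup>2)\<bar> \<le> L * ((4 * C * K1 + 4 * K1\<^sup>2) * Q b)"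
      unfolding abs_mult using G2 sq L by (intro mult_mono) auto
    moreover have "\<bar>G (v (x + w \<omega>)) - G vs - G1 * \<delta> \<omega> - G2 * (\<delta> \<omega>)\<^sup>2\<bar> \<le> L * ((32 * C ^ 3 + 4 * (C * N) ^ 3) * Q b)"
      using order_trans[OF G[of "x + w \<omega>", folded \<delta>_def] mult_left_mono[OF cube L]] .
    moreover have "G2 * ((\<delta> \<omega>)\<^sup>2 - (dvs \<bullet> w \<omega>)\<^sup>2) = G2 * (\<delta> \<omega>)\<^sup>2 - G2 * (dvs \<bullet> w \<omega>)\<^sup>2"
      by (simp add: algebra_simps)
    ultimately have "\<bar>G (v (x + w \<omega>)) - G vs - G1 * \<delta> \<omega> - G2 * (dvs \<bullet> w \<omega>)\<^sup>2\<bar>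
      \<le> L * ((4 * C * K1 + 4 * K1\<^sup>2) * Q b) + L * ((32 * C ^ 3 + 4 * (C * N) ^ 3) * Q b)"
      by linarith
    then show ?thesis unfolding b_def[symmetric] by (simp add: algebra_simps)
  qed
  \<comment> \<open>On integration the \<open>G1\<close> term disappears because
    \<open>\<delta>\<close> has mean zero, and the squared inner product has mean (t - s)
    |dvs|^2.\<close>
  have "norm (\<integral>\<omega>. G (v (x + w \<omega>)) - G vs - G1 * \<delta> \<omega> - G2 * (dvs \<bullet> w \<omega>)\<^sup>2 \<partial>M)
    \<le> (\<integral>\<omega>. L * (32 * C ^ 3 + 4 * (C * N) ^ 3 + 4 * C * K1 + 4 * K1\<^sup>2) * Q (norm (w \<omega>)) \<partial>M)"
    by (rule norm_integral_le) (use iG i\<delta> iQ mom(3)[of dvs] main in \<open>auto simp: w_def\<close>)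
  also have "\<dots> = L * (32 * C ^ 3 + 4 * (C * N) ^ 3 + 4 * C * K1 + 4 * K1\<^sup>2) * (\<integral>\<omega>. Q (norm (w \<omega>)) \<partial>M)"
    by (rule integral_mult_right_zero)
  also have "\<dots> \<le> L * (32 * C ^ 3 + 4 * (C * N) ^ 3 + 4 * C * K1 + 4 * K1\<^sup>2) * ((1 + N + 3 * N\<^sup>2) * (r\<^sup>2 * r))"
    using L C N by (intro mult_left_mono EQ) auto
  also have "(\<integral>\<omega>. G (v (x + w \<omega>)) - G vs - G1 * \<delta> \<omega> - G2 * (dvs \<bullet> w \<omega>)\<^sup>2 \<partial>M)
      = (\<integral>\<omega>. G (v (x + w \<omega>)) \<partial>M) - G vs - G2 * ((t - s) * (norm dvs)\<^sup>2)"
    using iG i\<delta> mom(3,4)[of dvs] by (simp add: w_def[symmetric] prob_space)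
  finally show ?thesis unfolding w_def N_def r_def[symmetric] r(3)[symmetric]
    using r(1) by (simp add: mult.assoc add.assoc)
qed

text \<open>The heat flow \<open>v\<close> of \<open>Phi\<close> composed with the mollified
  \<open>f\<close> stays in \<open>{Phi (-c)..Phi c}\<close>, being an average of such values, and
  there \<open>inv Phi\<close> has bounded derivatives. Each property of \<open>u\<close> is carried
  over from \<open>v\<close> by \<open>inv_Phi_Taylor\<close>.\<close>

lemma value_function:
  fixes f :: "real ^ 'n \<Rightarrow> real"
  assumes f: "\<And>x. \<bar>f x\<bar> \<le> c" and uc: "uniformly_continuous_on UNIV f" and "\<epsilon> > 0"
  obtains K u du where
    "\<And>t. 0 \<le> t \<Longrightarrow> t \<le> 1 \<Longrightarrow> c11 K (u t) (du t)"
    "\<And>s t x. 0 \<le> s \<Longrightarrow> s < t \<Longrightarrow> t \<le> 1 \<Longrightarrow> \<bar>u t x - u s x\<bar> \<le> K * (t - s)"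
    "\<And>s t x. 0 \<le> s \<Longrightarrow> s < t \<Longrightarrow> t \<le> 1 \<Longrightarrow> norm (du t x - du s x) \<le> K * sqrt (t - s)"
    "\<And>s t x. 0 \<le> s \<Longrightarrow> s < t \<Longrightarrow> t \<le> 1 \<Longrightarrow>
      \<bar>(\<integral>\<omega>. u t (x + (W t \<omega> - W s \<omega>)) \<partial>M) - u s x - (t - s) / 2 * (u s x * (norm (du s x))\<^sup>2)\<bar>
        \<le> K * ((t - s) * sqrt (t - s))"
    "\<And>x. \<bar>u 1 x - f x\<bar> \<le> \<epsilon>"
    "\<bar>u 0 0 - inv Phi (\<integral>x. Phi (f x) \<partial>std_gaussian)\<bar> \<le> \<epsilon>"
proof -
  let ?p = std_normal_density
  let ?I = "{Phi (-c)..Phi c}"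
  have c0: "0 \<le> c" using f[of 0] by linarith
  obtain L where L: "L \<ge> 1"
    "\<And>y. y \<in> ?I \<Longrightarrow> 1 / ?p (inv Phi y) \<le> L"
    "\<And>y z. y \<in> ?I \<Longrightarrow> z \<in> ?I \<Longrightarrow> \<bar>inv Phi z - inv Phi y\<bar> \<le> L * \<bar>z - y\<bar>"
    "\<And>y z. y \<in> ?I \<Longrightarrow> z \<in> ?I \<Longrightarrow>
      \<bar>inv Phi z - inv Phi y - 1 / ?p (inv Phi y) * (z - y)\<bar> \<le> L * (z - y)\<^sup>2"
    "\<And>y z. y \<in> ?I \<Longrightarrow> z \<in> ?I \<Longrightarrow>
      \<bar>inv Phi z - inv Phi y - 1 / ?p (inv Phi y) * (z - y)
        - inv Phi y / (2 * (?p (inv Phi y))\<^sup>2) * (z - y)\<^sup>2\<bar> \<le> L * \<bar>z - y\<bar> ^ 3"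
  proof (rule inv_Phi_Taylor[of c], goal_cases)
    case (1 L)
    from 1(2-) show ?case by (rule 1(1))
  qed
  \<comment> \<open>\<open>Phi\<close> is 1-Lipschitz and \<open>inv Phi\<close> is L-Lipschitz on
    the interval, so a mollification error \<epsilon> / L becomes \<epsilon> in the initial
    value.\<close>
  have "0 < \<epsilon> / L" using \<open>\<epsilon> > 0\<close> L(1) by simp
  then obtain g Dg C0 where g: "c11 C0 g Dg" "\<And>x. \<bar>g x - f x\<bar> \<le> \<epsilon> / L" "\<And>x. \<bar>g x\<bar> \<le> c"
  proof (rule mollify[OF f uc], goal_cases)
    case (1 g Dg C0)
    from 1(2-) show ?case by (rule 1(1))
  qed
  define \<psi> where "\<psi> x = Phi (g x)" for x
  define D where "D x = ?p (g x) *\<^sub>R Dg x" for x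
  define C where "C = 1 + C0 + 4 * C0\<^sup>2"
  have "c11 (1 * (1 + C0 + 4 * C0\<^sup>2)) (\<lambda>x. Phi (g x)) (\<lambda>x. ?p (g x) *\<^sub>R Dg x)"
  proof (rule c11_compose[OF g(1)])
    show "\<bar>Phi (g y) - Phi (g x) - ?p (g x) * (g y - g x)\<bar> \<le> 1 * (g y - g x)\<^sup>2" for x y
      using Phi_Taylor2 by simp
    show "\<bar>Phi (g x)\<bar> \<le> 1" for x using Phi_bounds[of "g x"] by simp
    show "\<bar>?p (g x)\<bar> \<le> 1" for x
      using std_normal_density_pos[of "g x"] std_normal_density_le_1[of "g x"] by simp
  qed
  then have c\<psi>: "c11 C \<psi> D"
    unfolding \<psi>_def[abs_def] D_def[abs_def] C_def by simp
  have C: "0 \<le> C" using c11D(4)[OF c\<psi>] .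
  have \<psi>I: "\<psi> x \<in> ?I" for x using g(3)[of x] unfolding \<psi>_def by (auto intro!: Phi_mono)
  define v where "v t x = (\<integral>\<omega>. \<psi> (x + (W 1 \<omega> - W t \<omega>)) \<partial>M)" for t x
  define dv where "dv t x = (\<integral>\<omega>. D (x + (W 1 \<omega> - W t \<omega>)) \<partial>M)" for t x
  note [measurable] = c11_measurable[OF c\<psi>] c11_measurable[OF g(1)]
  have cv: "c11 C (v t) (dv t)" if "0 \<le> t" "t \<le> 1" for t
    unfolding v_def dv_def by (rule c11_expectation[OF c\<psi>]) (use that in measurable)
  have vI: "v t x \<in> ?I" if "0 \<le> t" "t \<le> 1" for t x
  proof -
    have [measurable]: "W t \<in> borel_measurable M" "W 1 \<in> borel_measurable M"
      using that by (auto intro: W_measurable_M)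
    have i: "integrable M (\<lambda>\<omega>. \<psi> (x + (W 1 \<omega> - W t \<omega>)))"
      by (rule integrable_const_bound[where B=C]) (use c11D(1)[OF c\<psi>] in auto)
    show ?thesis
      using integral_ge_const[OF i, of "Phi (-c)"] integral_le_const[OF i, of "Phi c"] \<psi>I
      unfolding v_def by auto
  qed
  define G1 where "G1 y = 1 / ?p (inv Phi y)" for y
  define u where "u t x = inv Phi (v t x)" for t x
  define du where "du t x = G1 (v t x) *\<^sub>R dv t x" for t x
  \<comment> \<open>Dominates the coefficients in use: c bounds \<open>inv Phi\<close>, L its first
    derivative and the remainders, and c L^2 covers half its second derivative.\<close>
  define L' where "L' = L + c + c * L\<^sup>2"
  have G1: "0 < G1 y" "y \<in> ?I \<Longrightarrow> G1 y \<le> L" for y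
    using std_normal_density_pos[of "inv Phi y"] L(2) unfolding G1_def by auto
  have inv: "\<bar>inv Phi y\<bar> \<le> c" if "y \<in> ?I" for y
    using Phi_inv_Phi(2,3)[of "-c" y c] that by auto
  have L': "L \<le> L'" "c \<le> L'" "c * L\<^sup>2 \<le> L'" "0 \<le> L'"
    using L(1) c0 zero_le_power2[of L] mult_nonneg_nonneg[OF c0 zero_le_power2[of L]] unfolding L'_def by auto
  have cu: "c11 (L' * (1 + C + 4 * C\<^sup>2)) (u t) (du t)" if t: "0 \<le> t" "t \<le> 1" for t
    unfolding u_def[abs_def] du_def[abs_def]
  proof (rule c11_compose[OF cv[OF t]])
    fix x y
    show "\<bar>inv Phi (v t y) - inv Phi (v t x) - G1 (v t x) * (v t y - v t x)\<bar> \<le> L' * (v t y - v t x)\<^sup>2"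
      using L(4)[OF vI[OF t, of x] vI[OF t, of y]] mult_right_mono[OF L'(1) zero_le_power2[of "v t y - v t x"]]
      unfolding G1_def by linarith
    show "\<bar>inv Phi (v t x)\<bar> \<le> L'" using inv[OF vI[OF t, of x]] L' by linarith
    show "\<bar>G1 (v t x)\<bar> \<le> L'" using G1(1)[of "v t x"] G1(2)[OF vI[OF t, of x]] L' by linarith
  qed
  define N :: real where "N = CARD('n)"
  have N: "0 \<le> N" unfolding N_def by simp
  define Ca where "Ca = L' * (1 + C + 4 * C\<^sup>2)"
  define A where "A = L * (C * N)"
  define K1 where "K1 = 3 * C * (1 + CARD('n))"
  define Cs where "Cs = L' * (32 * C ^ 3 + 4 * (C * real CARD('n)) ^ 3 + 4 * C * K1 + 4 * K1\<^sup>2)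
          * (1 + CARD('n) + 3 * (CARD('n))\<^sup>2)"
  have pos: "0 \<le> Ca" "0 \<le> A" "0 \<le> Cs"
    using L' L(1) C N unfolding Ca_def A_def Cs_def K1_def by auto
  define K where "K = Ca + 2 * (A + Ca) + Cs"
  have K: "Ca \<le> K" "A \<le> K" "2 * (A + Ca) \<le> K" "Cs \<le> K" using pos unfolding K_def by auto
  have ut: "\<bar>u t x - u s x\<bar> \<le> A * (t - s)" if st: "0 \<le> s" "s < t" "t \<le> 1" for s t x
  proof -
    have "\<bar>u t x - u s x\<bar> \<le> L * \<bar>v t x - v s x\<bar>"
      unfolding u_def using vI that by (intro L(3)) auto
    also have "\<dots> \<le> L * (C * N * (t - s))"
      using heat_flow_step(2)[OF c\<psi> st, of x] L(1) unfolding v_def N_def by (intro mult_left_mono) auto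
    finally show ?thesis by (simp add: A_def mult.assoc)
  qed
  show ?thesis
  proof (rule that[of K u du])
    fix t :: real assume t: "0 \<le> t" "t \<le> 1"
    have "K' \<ge> Ca \<Longrightarrow> c11 K' (u t) (du t)" for K'
      using cu[OF t] unfolding c11_def Ca_def[symmetric]
      by (meson mult_right_mono order_trans zero_le_power2)
    then show "c11 K (u t) (du t)" using K(1) by blast
  next
    fix s t :: real and x assume st: "0 \<le> s" "s < t" "t \<le> 1"
    then have t: "0 \<le> t" "t \<le> 1" and s: "0 \<le> s" "s \<le> 1" by auto
    show "\<bar>u t x - u s x\<bar> \<le> K * (t - s)"
      using ut[OF st, of x] mult_right_mono[OF K(2), of "t - s"] st by linarith
    \<comment> \<open>\<open>c11_gradient_close\<close> once more, now for \<open>u\<close> at two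
      times, with r = sqrt (t - s).\<close>
    have "norm (du t x - du s x) \<le> 2 * (A + Ca) * sqrt (t - s)"
      by (rule c11_gradient_close[OF cu[OF t, folded Ca_def] cu[OF s, folded Ca_def]])
         (use ut[OF st] st pos in auto)
    moreover have "2 * (A + Ca) * sqrt (t - s) \<le> K * sqrt (t - s)"
      using st by (intro mult_right_mono K(3)) auto
    ultimately show "norm (du t x - du s x) \<le> K * sqrt (t - s)" by linarith
    have [measurable]: "W t \<in> borel_measurable M" "W s \<in> borel_measurable M"
      using t s by (auto intro: W_measurable_M)
    \<comment> \<open>Half the second derivative of \<open>inv Phi\<close> at \<open>v s x\<close>.
      Since du = G1 dv, the term G2 |dv|^2 equals u |du|^2 / 2.\<close>
    define G2 where "G2 = inv Phi (v s x) / (2 * (?p (inv Phi (v s x)))\<^sup>2)"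
    have G2e: "G2 = inv Phi (v s x) * (G1 (v s x))\<^sup>2 / 2"
      unfolding G2_def G1_def by (simp add: power_divide)
    have "\<bar>(\<integral>\<omega>. inv Phi (v t (x + (W t \<omega> - W s \<omega>))) \<partial>M) - inv Phi (v s x) - G2 * ((t - s) * (norm (dv s x))\<^sup>2)\<bar>
      \<le> Cs * ((t - s) * sqrt (t - s))"
      unfolding Cs_def K1_def
    proof (rule one_step_expansion[OF st cv[OF t] c11D(2)[OF cv[OF s]] C L'(4)])
      fix y
      have "L * \<bar>v t y - v s x\<bar> ^ 3 \<le> L' * \<bar>v t y - v s x\<bar> ^ 3" using L'(1) by (intro mult_right_mono) auto
      then show "\<bar>inv Phi (v t y) - inv Phi (v s x) - G1 (v s x) * (v t y - v s x) - G2 * (v t y - v s x)\<^sup>2\<bar>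
          \<le> L' * \<bar>v t y - v s x\<bar> ^ 3"
        using L(5)[OF vI[OF s, of x] vI[OF t, of y]] unfolding G1_def G2_def by linarith
    next
      have "\<bar>inv Phi (v s x)\<bar> * (G1 (v s x))\<^sup>2 \<le> c * L\<^sup>2"
        using inv[OF vI[OF s, of x]] G1(1)[of "v s x"] G1(2)[OF vI[OF s, of x]] c0
        by (intro mult_mono power_mono) auto
      moreover have "0 \<le> c * L\<^sup>2" using c0 by simp
      ultimately show "\<bar>G2\<bar> \<le> L'" using L'(3) unfolding G2e by (simp add: abs_mult)
      show "(\<integral>\<omega>. v t (x + (W t \<omega> - W s \<omega>)) \<partial>M) = v s x"
        "\<bar>v t x - v s x\<bar> \<le> C * CARD('n) * (t - s)"
        "norm (dv t x - dv s x) \<le> 2 * C * (1 + CARD('n)) * sqrt (t - s)"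
        using heat_flow_step[OF c\<psi> st, of x] unfolding v_def dv_def by auto
      show "integrable M (\<lambda>\<omega>. inv Phi (v t (x + (W t \<omega> - W s \<omega>))))"
      proof (rule integrable_const_bound[where B=c])
        show "(\<lambda>\<omega>. inv Phi (v t (x + (W t \<omega> - W s \<omega>)))) \<in> borel_measurable M"
          using c11_measurable(1)[OF cu[OF t]] unfolding u_def[abs_def] by measurable
      qed (use inv vI[OF t] in auto)
    qed
    moreover have "G2 * ((t - s) * (norm (dv s x))\<^sup>2) = (t - s) / 2 * (u s x * (norm (du s x))\<^sup>2)"
      unfolding G2e du_def u_def by (simp add: power_mult_distrib)
    moreover have "Cs * ((t - s) * sqrt (t - s)) \<le> K * ((t - s) * sqrt (t - s))"
      using st by (intro mult_right_mono K(4)) auto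
    ultimately show "\<bar>(\<integral>\<omega>. u t (x + (W t \<omega> - W s \<omega>)) \<partial>M) - u s x - (t - s) / 2 * (u s x * (norm (du s x))\<^sup>2)\<bar>
        \<le> K * ((t - s) * sqrt (t - s))"
      unfolding u_def by linarith
  next
    fix x
    have "u 1 x = g x" unfolding u_def v_def \<psi>_def by (simp add: prob_space)
    moreover have "\<epsilon> / L \<le> \<epsilon>" using L(1) \<open>\<epsilon> > 0\<close> by (simp add: field_simps)
    ultimately show "\<bar>u 1 x - f x\<bar> \<le> \<epsilon>" using g(2)[of x] by linarith
  next
    interpret G: prob_space "std_gaussian :: (real ^ 'n) measure" by (rule prob_space_std_gaussian)
    \<comment> \<open>Over the unit interval the increment is standard Gaussian, so the heat flow
      started at the origin is the Gaussian integral.\<close>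
    have "(\<integral>\<omega>. \<psi> (0 + (W 1 \<omega> - W 0 \<omega>)) \<partial>M) = (\<integral>x. \<psi> (0 + sqrt (1 - 0) *\<^sub>R x) \<partial>std_gaussian)"
      by (rule increment_integral) auto
    then have v0: "v 0 0 = (\<integral>x. \<psi> x \<partial>std_gaussian)" unfolding v_def by simp
    have [measurable]: "Phi \<in> borel_measurable borel"
      by (rule borel_measurable_continuous_onI) (simp add: isCont_Phi continuous_at_imp_continuous_on)
    have [measurable]: "f \<in> borel_measurable borel"
      by (intro borel_measurable_continuous_onI uniformly_continuous_imp_continuous uc)
    have i\<psi>: "integrable std_gaussian \<psi>"
      by (rule G.integrable_const_bound[where B=C]) (use c11D(1)[OF c\<psi>] in auto)
    have iPf: "integrable std_gaussian (\<lambda>x. Phi (f x))"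
      by (rule G.integrable_const_bound[where B=1]) (use Phi_bounds in auto)
    have fI: "Phi (f x) \<in> ?I" for x using f[of x] by (auto intro!: Phi_mono)
    have "(\<integral>x. Phi (f x) \<partial>std_gaussian) \<in> ?I"
      using G.integral_ge_const[OF iPf, of "Phi (-c)"] G.integral_le_const[OF iPf, of "Phi c"] fI
      by auto
    then have "\<bar>u 0 0 - inv Phi (\<integral>x. Phi (f x) \<partial>std_gaussian)\<bar> \<le> L * \<bar>v 0 0 - (\<integral>x. Phi (f x) \<partial>std_gaussian)\<bar>"
      unfolding u_def using vI by (intro L(3)) auto
    also have "\<bar>v 0 0 - (\<integral>x. Phi (f x) \<partial>std_gaussian)\<bar> = norm (\<integral>x. \<psi> x - Phi (f x) \<partial>std_gaussian)"
      unfolding v0 using i\<psi> iPf by simp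
    also have "\<dots> \<le> (\<integral>x. \<epsilon> / L \<partial>(std_gaussian :: (real ^ 'n) measure))"
    proof (rule norm_integral_le)
      show "norm (\<psi> x - Phi (f x)) \<le> \<epsilon> / L" for x
        using Phi_lipschitz[of "g x" "f x"] g(2)[of x] unfolding \<psi>_def by simp
    qed (use i\<psi> iPf in auto)
    also have "L * \<dots> = \<epsilon>" using L(1) G.prob_space by simp
    finally show "\<bar>u 0 0 - inv Phi (\<integral>x. Phi (f x) \<partial>std_gaussian)\<bar> \<le> \<epsilon>"
      using L(1) by (simp add: mult_left_mono)
  qed
qed

end

section \<open>Discounting along a path\<close>

lemma set_integral_split:
  fixes f :: "real \<Rightarrow> 'b::{banach, second_countable_topology}"
  assumes "set_integrable lborel {a..c} f" "a \<le> b" "b \<le> c"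
  shows "(LINT x:{a..c}|lborel. f x) = (LINT x:{a..b}|lborel. f x) + (LINT x:{b..c}|lborel. f x)"
proof -
  have i: "set_integrable lborel {a..b} f" "set_integrable lborel {b..c} f"
    by (rule set_integrable_subset[OF assms(1)]; use assms in auto)+
  have "{a..c} = {a..b} \<union> {b..c}" using assms by auto
  moreover have "(LINT x:{a..b} \<union> {b..c}|lborel. f x) = (LINT x:{a..b}|lborel. f x) + (LINT x:{b..c}|lborel. f x)"
  proof (rule set_integral_Un_AE[OF _ _ _ i])
    show "AE x in lborel. \<not> (x \<in> {a..b} \<and> x \<in> {b..c})"
      using AE_lborel_singleton[of b] by eventually_elim auto
  qed auto
  ultimately show ?thesis by simp
qed

lemma set_integrable_const_Icc: "set_integrable lborel {s..t::real} (\<lambda>_. c :: real)"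
  by (rule borel_integrable_atLeastAtMost') simp

text \<open>A condition on a single path. It sees only times in \<open>{0..1}\<close>, as the
  processes are unconstrained elsewhere.\<close>

definition square_integrable :: "(real \<Rightarrow> 'v::euclidean_space) \<Rightarrow> bool" where
  "square_integrable b \<longleftrightarrow> set_borel_measurable lborel {0..1} b \<and>
     set_integrable lborel {0..1} (\<lambda>s. (norm (b s))\<^sup>2)"

definition cost :: "(real \<Rightarrow> 'v::euclidean_space) \<Rightarrow> real \<Rightarrow> real" where
  "cost b t = (LINT s:{0..t}|lborel. (norm (b s))\<^sup>2)"

definition discount :: "(real \<Rightarrow> 'v::euclidean_space) \<Rightarrow> real \<Rightarrow> real" where
  "discount b t = exp (- (1 / 2) * cost b t)"

lemma cost_nonneg: "0 \<le> cost b t"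
  unfolding cost_def set_lebesgue_integral_def by (rule integral_nonneg_AE) simp

lemma discount_le_1: "discount b t \<le> 1"
  using cost_nonneg by (simp add: discount_def)

lemma discount_pos: "0 < discount b t"
  by (simp add: discount_def)

context
  fixes b :: "real \<Rightarrow> 'v::euclidean_space"
  assumes b: "square_integrable b"
begin

lemma square_integrable_sq:
  assumes "0 \<le> s" "t \<le> 1"
  shows "set_integrable lborel {s..t} (\<lambda>s. (norm (b s))\<^sup>2)"
  using b assms unfolding square_integrable_def by (auto intro: set_integrable_subset)

lemma square_integrable_meas:
  assumes "0 \<le> s" "t \<le> 1"
  shows "set_borel_measurable lborel {s..t} b"
  using b assms set_borel_measurable_subset[of lborel "{0..1}" b "{s..t}"]
  unfolding square_integrable_def by auto

lemma square_integrable_integrable: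
  assumes "0 \<le> s" "t \<le> 1"
  shows "set_integrable lborel {s..t} b" "set_integrable lborel {s..t} (\<lambda>s. norm (b s))"
proof -
  have i: "set_integrable lborel {s..t} (\<lambda>s. 1 + (norm (b s))\<^sup>2)"
    by (intro set_integral_add set_integrable_const_Icc square_integrable_sq[OF assms])
  have le: "x \<le> 1 + x\<^sup>2" for x :: real
    using zero_le_power2[of "x - 1"] zero_le_power2[of "x"] by (simp only: power2_diff) (smt (verit) power_one)
  show *: "set_integrable lborel {s..t} b"
    by (rule set_integrable_bound[OF i square_integrable_meas[OF assms]])
       (use le in \<open>auto simp: abs_of_nonneg\<close>)
  show "set_integrable lborel {s..t} (\<lambda>s. norm (b s))"
    using set_integrable_norm[OF *] by simp
qed

lemma cost_diff:
  assumes "0 \<le> s" "s \<le> t" "t \<le> 1"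
  shows "cost b t - cost b s = (LINT s:{s..t}|lborel. (norm (b s))\<^sup>2)"
  using set_integral_split[OF square_integrable_sq[of 0 t], of s] assms by (simp add: cost_def)

lemma cost_mono:
  assumes "0 \<le> s" "s \<le> t" "t \<le> 1"
  shows "cost b s \<le> cost b t"
proof -
  have "0 \<le> (LINT s:{s..t}|lborel. (norm (b s))\<^sup>2)"
    unfolding set_lebesgue_integral_def by (rule integral_nonneg_AE) simp
  then show ?thesis using cost_diff[OF assms] by simp
qed

lemma discount_mono: "0 \<le> s \<Longrightarrow> s \<le> t \<Longrightarrow> t \<le> 1 \<Longrightarrow> discount b t \<le> discount b s"
  using cost_mono unfolding discount_def by simp

lemma cost_continuous: "continuous_on {0..1} (cost b)"
proof -
  have "(\<lambda>s. (norm (b s))\<^sup>2) integrable_on {0..1}"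
    using set_borel_integral_eq_integral(1)[OF square_integrable_sq[of 0 1]] by simp
  then have "continuous_on {0..1} (\<lambda>t. integral {0..t} (\<lambda>s. (norm (b s))\<^sup>2))"
    by (rule indefinite_integral_continuous_1)
  then show ?thesis
    by (rule continuous_on_eq)
       (auto simp: cost_def set_borel_integral_eq_integral(2)[OF square_integrable_sq])
qed

lemma discount_continuous: "continuous_on {0..1} (discount b)"
  unfolding discount_def[abs_def] by (intro continuous_intros cost_continuous)

lemma discount_measurable: "set_borel_measurable lborel {0..1} (discount b)"
  unfolding set_borel_measurable_def
  using borel_measurable_continuous_on_indicator[OF _ discount_continuous] by simp

lemma discount_integrable:
  assumes f: "set_integrable lborel {s..t} f" and st: "0 \<le> s" "t \<le> 1"
  shows "set_integrable lborel {s..t} (\<lambda>r. discount b r *\<^sub>R (f r :: 'b::euclidean_space))"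
proof (rule set_integrable_bound[OF f])
  have "set_borel_measurable lborel {s..t} (discount b)"
    using discount_measurable st set_borel_measurable_subset[of lborel "{0..1}" "discount b" "{s..t}"] by auto
  then have m: "(\<lambda>x. indicator {s..t} x *\<^sub>R discount b x) \<in> borel_measurable lborel"
    unfolding set_borel_measurable_def .
  have "(\<lambda>x. (indicator {s..t} x *\<^sub>R discount b x) *\<^sub>R (indicator {s..t} x *\<^sub>R f x)) \<in> borel_measurable lborel"
    using m borel_measurable_integrable[OF f[unfolded set_integrable_def]] by (rule borel_measurable_scaleR)
  then show "set_borel_measurable lborel {s..t} (\<lambda>r. discount b r *\<^sub>R f r)"
    unfolding set_borel_measurable_def by (rule measurable_cong[THEN iffD1, rotated]) (auto split: split_indicator)
  show "AE x in lborel. x \<in> {s..t} \<longrightarrow> norm (discount b x *\<^sub>R f x) \<le> norm (f x)"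
    using discount_le_1[of b] discount_pos[of b]
    by (intro AE_I2) (auto intro!: mult_left_le_one_le simp: abs_of_pos less_imp_le)
qed

text \<open>The chain rule for the absolutely continuous function \<open>cost b\<close>: on an interval on which
  the cost increases by \<open>\<Delta>\<close> the two sides differ by at most \<open>\<Delta>\<^sup>2\<close>, and repeatedly halving the
  cost increment improves this bound to zero.\<close>
lemma discount_cost_integral:
  assumes "0 \<le> s" "s \<le> t" "t \<le> 1"
  shows "(LINT r:{s..t}|lborel. discount b r * (norm (b r))\<^sup>2) = 2 * (discount b s - discount b t)"
proof -
  define D where "D s t = (LINT r:{s..t}|lborel. discount b r * (norm (b r))\<^sup>2) - 2 * (discount b s - discount b t)" for s t
  have int: "set_integrable lborel {s..t} (\<lambda>r. discount b r * (norm (b r))\<^sup>2)" if "0 \<le> s" "t \<le> 1" for s t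
    using discount_integrable[OF square_integrable_sq[OF that] that] by simp
  \<comment> \<open>The discount is decreasing, so the integral lies between
    \<open>discount b t * \<Delta>\<close> and \<open>discount b s * \<Delta>\<close>; by exp x
    \<ge> 1 + x so does twice the decrement. The two bounds differ by at most \<Delta>^2.\<close>
  have D0: "\<bar>D s t\<bar> \<le> (cost b t - cost b s)\<^sup>2" if st: "0 \<le> s" "s \<le> t" "t \<le> 1" for s t
  proof -
    define \<Delta> where "\<Delta> = cost b t - cost b s"
    have \<Delta>: "0 \<le> \<Delta>" using cost_mono[OF st] by (simp add: \<Delta>_def)
    note sq = square_integrable_sq[OF st(1,3)]
    have "(LINT r:{s..t}|lborel. discount b t * (norm (b r))\<^sup>2) \<le> (LINT r:{s..t}|lborel. discount b r * (norm (b r))\<^sup>2)"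
      using st by (intro set_integral_mono int set_integrable_mult_right sq mult_right_mono discount_mono) auto
    then have 1: "discount b t * \<Delta> \<le> (LINT r:{s..t}|lborel. discount b r * (norm (b r))\<^sup>2)"
      using cost_diff[OF st] by (simp add: \<Delta>_def)
    have "(LINT r:{s..t}|lborel. discount b r * (norm (b r))\<^sup>2) \<le> (LINT r:{s..t}|lborel. discount b s * (norm (b r))\<^sup>2)"
      using st by (intro set_integral_mono int set_integrable_mult_right sq mult_right_mono discount_mono) auto
    then have 2: "(LINT r:{s..t}|lborel. discount b r * (norm (b r))\<^sup>2) \<le> discount b s * \<Delta>"
      using cost_diff[OF st] by (simp add: \<Delta>_def)
    have e: "discount b t = discount b s * exp (- (\<Delta> / 2))"
      unfolding discount_def \<Delta>_def by (simp add: field_simps flip: exp_add)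
    have e': "discount b s = discount b t * exp (\<Delta> / 2)"
      unfolding e by (simp flip: exp_add)
    have 3: "discount b s - discount b t \<le> discount b s * (\<Delta> / 2)"
    proof -
      have "discount b s * (1 - exp (- (\<Delta> / 2))) \<le> discount b s * (\<Delta> / 2)"
        using exp_ge_add_one_self[of "- (\<Delta> / 2)"] discount_pos[of b s] by (intro mult_left_mono) auto
      then show ?thesis unfolding e by (simp add: algebra_simps)
    qed
    have 4: "discount b t * (\<Delta> / 2) \<le> discount b s - discount b t"
    proof -
      have "discount b t * (\<Delta> / 2) \<le> discount b t * (exp (\<Delta> / 2) - 1)"
      proof (rule mult_left_mono)
        show "\<Delta> / 2 \<le> exp (\<Delta> / 2) - 1" using exp_ge_add_one_self[of "\<Delta> / 2"] by linarith
      qed (simp add: discount_pos less_imp_le)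
      then show ?thesis using e' by (simp add: algebra_simps)
    qed
    have "discount b s * (\<Delta> / 2) \<le> 1 * (\<Delta> / 2)"
      using discount_le_1[of b s] st \<Delta> by (intro mult_right_mono) auto
    then have "discount b s - discount b t \<le> \<Delta>" using 3 \<Delta> by linarith
    then have "(discount b s - discount b t) * \<Delta> \<le> \<Delta>\<^sup>2"
      using \<Delta> by (simp add: power2_eq_square mult_right_mono)
    then show ?thesis using 1 2 3 4 unfolding D_def \<Delta>_def[symmetric] by (simp add: algebra_simps abs_le_iff)
  qed
  have Dn: "\<bar>D s t\<bar> \<le> (cost b t - cost b s)\<^sup>2 / 2 ^ n" if "0 \<le> s" "s \<le> t" "t \<le> 1" for s t n
    using that
  proof (induction n arbitrary: s t)
    case 0
    then show ?case using D0 by simp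
  next
    case (Suc n)
    have "continuous_on {s..t} (cost b)"
      using Suc.prems by (intro continuous_on_subset[OF cost_continuous]) auto
    \<comment> \<open>\<open>m\<close> halves the cost, not the time: the two squares then add up to
      2 (\<Delta> / 2)^2 = \<Delta>^2 / 2.\<close>
    then obtain m where m: "s \<le> m" "m \<le> t" "cost b m = (cost b s + cost b t) / 2"
      using IVT'[of "cost b" s "(cost b s + cost b t) / 2" t] cost_mono[OF Suc.prems] Suc.prems by auto
    have "D s t = D s m + D m t"
      using set_integral_split[OF int m(1,2)] Suc.prems unfolding D_def by simp
    also have "\<bar>\<dots>\<bar> \<le> (cost b m - cost b s)\<^sup>2 / 2 ^ n + (cost b t - cost b m)\<^sup>2 / 2 ^ n"
      using m Suc.prems by (intro order_trans[OF abs_triangle_ineq] add_mono Suc.IH) auto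
    also have "\<dots> = (cost b t - cost b s)\<^sup>2 / 2 ^ Suc n"
      unfolding m(3) by (simp add: power2_eq_square field_simps)
    finally show ?case .
  qed
  have "(\<lambda>n. (cost b t - cost b s)\<^sup>2 * (1 / 2) ^ n) \<longlonglongrightarrow> (cost b t - cost b s)\<^sup>2 * 0"
    by (intro tendsto_intros LIMSEQ_realpow_zero) auto
  then have "\<bar>D s t\<bar> \<le> 0"
    using Dn[OF assms] by (intro LIMSEQ_le_const) (auto simp: power_one_over field_simps)
  then show ?thesis by (simp add: D_def)
qed

lemma norm_set_integral_power2_le:
  assumes "0 \<le> s" "s \<le> t" "t \<le> 1"
  shows "(LINT r:{s..t}|lborel. norm (b r))\<^sup>2 \<le> (t - s) * (cost b t - cost b s)"
    and "norm (LINT r:{s..t}|lborel. b r) \<le> (LINT r:{s..t}|lborel. norm (b r))"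
    and "(norm (LINT r:{s..t}|lborel. b r))\<^sup>2 \<le> (t - s) * (cost b t - cost b s)"
proof -
  note i = square_integrable_integrable[OF assms(1,3)] square_integrable_sq[OF assms(1,3)]
  let ?I = "LINT r:{s..t}|lborel. norm (b r)"
  show 1: "?I\<^sup>2 \<le> (t - s) * (cost b t - cost b s)"
  proof (cases "s = t")
    case True
    have "?I = 0" unfolding set_lebesgue_integral_def True
      by (rule integral_eq_zero_AE) (use AE_lborel_singleton[of t] in \<open>eventually_elim, auto\<close>)
    then show ?thesis using True by simp
  next
    case False
    then have h: "0 < t - s" using assms by simp
    \<comment> \<open>The mean of |b| on the interval; that the integral of (|b| - c)^2 is
      nonnegative is the Cauchy-Schwarz inequality.\<close>
    define c where "c = ?I / (t - s)"
    have ci: "set_integrable lborel {s..t} (\<lambda>r. c\<^sup>2)" by (rule set_integrable_const_Icc)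
    have "0 \<le> (LINT r:{s..t}|lborel. (norm (b r) - c)\<^sup>2)"
      unfolding set_lebesgue_integral_def by (rule integral_nonneg_AE) simp
    also have "\<dots> = (LINT r:{s..t}|lborel. ((norm (b r))\<^sup>2 + c\<^sup>2) - (2 * c) * norm (b r))"
      by (simp add: power2_diff algebra_simps)
    also have "\<dots> = (LINT r:{s..t}|lborel. (norm (b r))\<^sup>2) + (t - s) * c\<^sup>2 - 2 * c * ?I"
      using i ci h assms(2) by (simp add: set_integral_diff set_integral_add) (simp add: set_lebesgue_integral_def)
    also have "\<dots> = (cost b t - cost b s) - ?I\<^sup>2 / (t - s)"
    proof -
      have I: "?I = c * (t - s)" using h by (simp add: c_def)
      have "?I\<^sup>2 / (t - s) = c\<^sup>2 * (t - s)" unfolding I using h by (simp add: power2_eq_square)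
      moreover have "2 * c * ?I = 2 * (c\<^sup>2 * (t - s))" unfolding I by (simp add: power2_eq_square)
      ultimately show ?thesis unfolding cost_diff[OF assms] by (simp add: mult.commute)
    qed
    finally show ?thesis using h by (simp add: field_simps)
  qed
  show 2: "norm (LINT r:{s..t}|lborel. b r) \<le> ?I"
    by (rule set_integral_norm_bound[OF i(1)])
  have "(norm (LINT r:{s..t}|lborel. b r))\<^sup>2 \<le> ?I\<^sup>2" using 2 by (intro power_mono) auto
  then show "(norm (LINT r:{s..t}|lborel. b r))\<^sup>2 \<le> (t - s) * (cost b t - cost b s)" using 1 by linarith
qed

end

lemma square_integrable_inner:
  fixes a b :: "real \<Rightarrow> 'v::euclidean_space"
  assumes a: "square_integrable a" and b: "square_integrable b" and st: "0 \<le> s" "t \<le> 1"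
  shows "set_integrable lborel {s..t} (\<lambda>r. a r \<bullet> b r)"
proof -
  have i: "set_integrable lborel {s..t} (\<lambda>r. (norm (a r))\<^sup>2 + (norm (b r))\<^sup>2)"
    using square_integrable_sq[OF a st] square_integrable_sq[OF b st] by simp
  show ?thesis
  proof (rule set_integrable_bound[OF i])
    have "(\<lambda>r. (indicator {s..t} r *\<^sub>R a r) \<bullet> (indicator {s..t} r *\<^sub>R b r)) \<in> borel_measurable lborel"
      using square_integrable_meas[OF a st] square_integrable_meas[OF b st]
      unfolding set_borel_measurable_def by measurable
    then show "set_borel_measurable lborel {s..t} (\<lambda>r. a r \<bullet> b r)"
      unfolding set_borel_measurable_def
      by (rule measurable_cong[THEN iffD1, rotated]) (auto split: split_indicator)
    have "\<bar>x \<bullet> y\<bar> \<le> (norm x)\<^sup>2 + (norm y)\<^sup>2" for x y :: 'v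
    proof -
      have "0 \<le> (norm x - norm y)\<^sup>2" by simp
      then have "2 * (norm x * norm y) \<le> (norm x)\<^sup>2 + (norm y)\<^sup>2" by (simp add: power2_diff)
      moreover have "0 \<le> norm x * norm y" by simp
      ultimately show ?thesis using Cauchy_Schwarz_ineq2[of x y] by linarith
    qed
    then show "AE r in lborel. r \<in> {s..t} \<longrightarrow> norm (a r \<bullet> b r) \<le> norm ((norm (a r))\<^sup>2 + (norm (b r))\<^sup>2)"
      by (simp add: abs_of_nonneg)
  qed
qed

lemma set_integral_grid:
  fixes f :: "real \<Rightarrow> 'b::{banach, second_countable_topology}"
  assumes "set_integrable lborel {0..1} f" "0 < N" "k \<le> N"
  shows "(LINT x:{0..real k / real N}|lborel. f x)
    = (\<Sum>j<k. LINT x:{real j / real N..real (Suc j) / real N}|lborel. f x)"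
  using assms(3)
proof (induction k)
  case 0
  have "(LINT x:{0..0}|lborel. f x) = 0" unfolding set_lebesgue_integral_def
    by (rule integral_eq_zero_AE) (use AE_lborel_singleton[of "0::real"] in \<open>eventually_elim, auto\<close>)
  then show ?case by simp
next
  case (Suc k)
  have "real (Suc k) / real N \<le> 1" "real k / real N \<le> real (Suc k) / real N"
    using Suc.prems assms(2) by (auto simp: field_simps)
  moreover from this have "set_integrable lborel {0..real (Suc k) / real N} f"
    using assms(1) by (auto intro: set_integrable_subset)
  ultimately have "(LINT x:{0..real (Suc k) / real N}|lborel. f x) = (LINT x:{0..real k / real N}|lborel. f x)
      + (LINT x:{real k / real N..real (Suc k) / real N}|lborel. f x)"
    by (intro set_integral_split) auto
  then show ?case using Suc by simp
qed

section \<open>Controls and strategies\<close>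

text \<open>Clamping time to \<open>{0..t}\<close> is a measurable retraction, so a function on the
  strip extends to the whole line and is then cut off by the indicator. Progressive measurability
  thus becomes a statement about plain product measures.\<close>

lemma borel_measurable_pair_restrict_iff:
  fixes g :: "real \<times> 'w \<Rightarrow> 'v::euclidean_space"
  assumes t: "0 \<le> t"
  shows "g \<in> borel_measurable (restrict_space borel {0..t} \<Otimes>\<^sub>M N)
    \<longleftrightarrow> (\<lambda>(s, \<omega>). indicator {0..t} s *\<^sub>R g (s, \<omega>)) \<in> borel_measurable (borel \<Otimes>\<^sub>M N)"
    (is "?L \<longleftrightarrow> ?R")
proof
  assume [measurable]: ?L
  define clip where "clip s = max 0 (min t s)" for s :: real
  have clip: "clip \<in> measurable borel (restrict_space borel {0..t})"
    unfolding clip_def[abs_def] using t by (intro measurable_restrict_space2) auto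
  have "(\<lambda>z. (clip (fst z), snd z)) \<in> measurable (borel \<Otimes>\<^sub>M N) (restrict_space borel {0..t} \<Otimes>\<^sub>M N)"
    by (intro measurable_Pair measurable_compose[OF measurable_fst clip] measurable_snd)
  from measurable_compose[OF this \<open>?L\<close>]
  have "(\<lambda>z. indicator {0..t} (fst z) *\<^sub>R g (clip (fst z), snd z)) \<in> borel_measurable (borel \<Otimes>\<^sub>M N)"
    by measurable
  moreover have "(\<lambda>z. indicator {0..t} (fst z) *\<^sub>R g (clip (fst z), snd z)) = (\<lambda>(s, \<omega>). indicator {0..t} s *\<^sub>R g (s, \<omega>))"
    by (auto simp: fun_eq_iff clip_def split: split_indicator)
  ultimately show ?R by simp
next
  assume R: ?R
  have "(\<lambda>z. (fst z, snd z)) \<in> measurable (restrict_space borel {0..t} \<Otimes>\<^sub>M N) (borel \<Otimes>\<^sub>M N)"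
    by (intro measurable_Pair measurable_snd measurable_compose[OF measurable_fst]
        measurable_restrict_space1) auto
  from measurable_compose[OF this R]
  show ?L
    by (rule measurable_cong[THEN iffD1, rotated]) (auto simp: space_pair_measure space_restrict_space)
qed

lemma progressively_measurable_iff:
  "progressively_measurable F \<beta> \<longleftrightarrow> (\<forall>t\<in>{0..1}.
     (\<lambda>(s, \<omega>). indicator {0..t} s *\<^sub>R \<beta> s \<omega>) \<in> borel_measurable (borel \<Otimes>\<^sub>M F t))"
  unfolding progressively_measurable_def by (simp add: borel_measurable_pair_restrict_iff)

lemma measurable_set_integral_param:
  fixes g :: "real \<Rightarrow> 'w \<Rightarrow> 'v::euclidean_space"
  assumes [measurable]: "(\<lambda>(s, \<omega>). g s \<omega>) \<in> borel_measurable (borel \<Otimes>\<^sub>M N)"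
  shows "(\<lambda>\<omega>. LINT s:{a..b}|lborel. g s \<omega>) \<in> borel_measurable N"
proof -
  have "(\<lambda>(\<omega>, s). indicator {a..b} s *\<^sub>R g s \<omega>) \<in> borel_measurable (N \<Otimes>\<^sub>M lborel)"
    by measurable
  from lborel.borel_measurable_lebesgue_integral[OF this]
  show ?thesis unfolding set_lebesgue_integral_def by simp
qed

context brownian
begin

lemma control_prog:
  assumes "\<beta> \<in> controls M F" "0 \<le> t" "t \<le> 1"
  shows "(\<lambda>(s, \<omega>). indicator {0..t} s *\<^sub>R \<beta> s \<omega>) \<in> borel_measurable (borel \<Otimes>\<^sub>M F t)"
  using assms by (auto simp: controls_def progressively_measurable_iff)

lemma control_joint:
  assumes "\<beta> \<in> controls M F"
  shows "(\<lambda>(s, \<omega>). indicator {0..1} s *\<^sub>R \<beta> s \<omega>) \<in> borel_measurable (borel \<Otimes>\<^sub>M M)"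
proof -
  have "(\<lambda>z. z) \<in> measurable (borel \<Otimes>\<^sub>M M) (borel \<Otimes>\<^sub>M F 1)"
    using measurable_F_M[of "\<lambda>x. x" 1 "F 1"]
    by (intro measurable_pair) (auto simp: comp_def intro: measurable_compose[OF measurable_snd])
  from measurable_compose[OF this control_prog[OF assms, of 1]] show ?thesis by simp
qed

lemma control_integral_measurable:
  assumes \<beta>: "\<beta> \<in> controls M F" and t: "0 \<le> a" "b \<le> t" "0 \<le> t" "t \<le> 1"
  shows "(\<lambda>\<omega>. LINT s:{a..b}|lborel. \<beta> s \<omega>) \<in> borel_measurable (F t)"
proof -
  note [measurable] = control_prog[OF \<beta> t(3,4)]
  have "(\<lambda>\<omega>. LINT s:{a..b}|lborel. indicator {0..t} s *\<^sub>R \<beta> s \<omega>) \<in> borel_measurable (F t)"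
    by (rule measurable_set_integral_param) measurable
  moreover have "(LINT s:{a..b}|lborel. indicator {0..t} s *\<^sub>R \<beta> s \<omega>) = (LINT s:{a..b}|lborel. \<beta> s \<omega>)" for \<omega>
    by (rule set_lebesgue_integral_cong) (use t in auto)
  ultimately show ?thesis by simp
qed

lemma control_cost_measurable:
  assumes \<beta>: "\<beta> \<in> controls M F" and t: "0 \<le> t" "t \<le> 1"
  shows "(\<lambda>\<omega>. cost (\<lambda>s. \<beta> s \<omega>) t) \<in> borel_measurable (F t)"
proof -
  note [measurable] = control_prog[OF \<beta> t]
  have "(\<lambda>\<omega>. LINT s:{0..t}|lborel. (norm (indicator {0..t} s *\<^sub>R \<beta> s \<omega>))\<^sup>2) \<in> borel_measurable (F t)"
    by (rule measurable_set_integral_param) measurable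
  moreover have "(LINT s:{0..t}|lborel. (norm (indicator {0..t} s *\<^sub>R \<beta> s \<omega>))\<^sup>2) = cost (\<lambda>s. \<beta> s \<omega>) t" for \<omega>
    unfolding cost_def by (rule set_lebesgue_integral_cong) auto
  ultimately show ?thesis by simp
qed

lemma control_discount_measurable:
  assumes \<beta>: "\<beta> \<in> controls M F" and t: "0 \<le> t" "t \<le> 1"
  shows "(\<lambda>\<omega>. discount (\<lambda>s. \<beta> s \<omega>) t) \<in> borel_measurable (F t)"
  unfolding discount_def using control_cost_measurable[OF assms] by measurable

lemma running_reward_measurable:
  assumes \<alpha>: "\<alpha> \<in> controls M F" and \<beta>: "\<beta> \<in> controls M F"
  shows "(\<lambda>\<omega>. LINT t:{0..1}|lborel. discount (\<lambda>s. \<beta> s \<omega>) t * (\<alpha> t \<omega> \<bullet> \<beta> t \<omega>)) \<in> borel_measurable M"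
proof -
  define a where "a z = indicator {0..1} (fst z) *\<^sub>R \<alpha> (fst z) (snd z)" for z
  define b where "b z = indicator {0..1} (fst z) *\<^sub>R \<beta> (fst z) (snd z)" for z
  \<comment> \<open>The running cost as a function of time and path. The upper limit of integration
    is moved into the integrand, so that joint measurability follows by integrating out
    \<open>s\<close>.\<close>
  define c where "c z = (\<integral>s. (if 0 \<le> s \<and> s \<le> fst z then (norm (b (s, snd z)))\<^sup>2 else 0) \<partial>lborel)" for z
  have [measurable]: "a \<in> borel_measurable (borel \<Otimes>\<^sub>M M)" "b \<in> borel_measurable (borel \<Otimes>\<^sub>M M)"
    using control_joint[OF \<alpha>] control_joint[OF \<beta>] unfolding a_def[abs_def] b_def[abs_def]
    by (simp_all add: split_beta')
  have [measurable]: "c \<in> borel_measurable (borel \<Otimes>\<^sub>M M)"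
    unfolding c_def[abs_def]
  proof (rule lborel.borel_measurable_lebesgue_integral)
    have "(\<lambda>x. (snd x, snd (fst x))) \<in> measurable ((borel \<Otimes>\<^sub>M M) \<Otimes>\<^sub>M lborel) (borel \<Otimes>\<^sub>M M)"
      by measurable
    from measurable_compose[OF this, of b borel]
    have [measurable]: "(\<lambda>x. b (snd x, snd (fst x))) \<in> borel_measurable ((borel \<Otimes>\<^sub>M M) \<Otimes>\<^sub>M lborel)"
      by simp
    show "(\<lambda>(z, s). if 0 \<le> s \<and> s \<le> fst z then (norm (b (s, snd z)))\<^sup>2 else 0)
        \<in> borel_measurable ((borel \<Otimes>\<^sub>M M) \<Otimes>\<^sub>M lborel)"
      unfolding split_beta' by measurable
  qed
  have "(\<lambda>\<omega>. LINT t:{0..1}|lborel. exp (- (1/2) * c (t, \<omega>)) * (a (t, \<omega>) \<bullet> b (t, \<omega>))) \<in> borel_measurable M"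
    by (rule measurable_set_integral_param) measurable
  moreover have "(LINT t:{0..1}|lborel. exp (- (1/2) * c (t, \<omega>)) * (a (t, \<omega>) \<bullet> b (t, \<omega>)))
     = (LINT t:{0..1}|lborel. discount (\<lambda>s. \<beta> s \<omega>) t * (\<alpha> t \<omega> \<bullet> \<beta> t \<omega>))" for \<omega>
  proof (rule set_lebesgue_integral_cong)
    have "c (t, \<omega>) = cost (\<lambda>s. \<beta> s \<omega>) t" if "t \<le> 1" for t
      unfolding c_def cost_def set_lebesgue_integral_def b_def
      by (rule Bochner_Integration.integral_cong) (use that in \<open>auto split: split_indicator\<close>)
    then show "\<forall>t. t \<in> {0..1} \<longrightarrow> exp (- (1/2) * c (t, \<omega>)) * (a (t, \<omega>) \<bullet> b (t, \<omega>))
      = discount (\<lambda>s. \<beta> s \<omega>) t * (\<alpha> t \<omega> \<bullet> \<beta> t \<omega>)"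
      by (auto simp: discount_def a_def b_def)
  qed simp
  ultimately show ?thesis by simp
qed

lemma J_eq:
  "J M W f \<alpha> \<beta> = (\<integral>\<omega>. (LINT t:{0..1}|lborel. discount (\<lambda>s. \<beta> s \<omega>) t * (\<alpha> t \<omega> \<bullet> \<beta> t \<omega>))
     + discount (\<lambda>s. \<beta> s \<omega>) 1 * f (W 1 \<omega> + (LINT t:{0..1}|lborel. \<alpha> t \<omega>)) \<partial>M)"
  unfolding J_def discount_def cost_def ..

lemma energy_measurable:
  assumes "\<beta> \<in> controls M F"
  shows "(\<lambda>\<omega>. \<integral>\<^sup>+s\<in>{0..1}. ennreal ((norm (\<beta> s \<omega>))\<^sup>2) \<partial>lborel) \<in> borel_measurable M"
proof -
  note [measurable] = control_joint[OF assms]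
  have "(\<lambda>\<omega>. \<integral>\<^sup>+s. ennreal ((norm (indicator {0..1} s *\<^sub>R \<beta> s \<omega>))\<^sup>2) \<partial>lborel) \<in> borel_measurable M"
    by measurable
  moreover have "(\<integral>\<^sup>+s. ennreal ((norm (indicator {0..1} s *\<^sub>R \<beta> s \<omega>))\<^sup>2) \<partial>lborel)
     = (\<integral>\<^sup>+s\<in>{0..1}. ennreal ((norm (\<beta> s \<omega>))\<^sup>2) \<partial>lborel)" for \<omega>
    by (rule nn_integral_cong) (auto split: split_indicator)
  ultimately show ?thesis by simp
qed

text \<open>Finite expected energy makes the energy of almost every path finite. The second conjunct
  links the Lebesgue integral in \<open>cost\<close> with the nonnegative integral in
  \<open>energy\<close>.\<close>

lemma control_square_integrable:
  assumes "\<beta> \<in> controls M F"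
  shows "AE \<omega> in M. square_integrable (\<lambda>s. \<beta> s \<omega>) \<and>
    ennreal (cost (\<lambda>s. \<beta> s \<omega>) 1) = (\<integral>\<^sup>+s\<in>{0..1}. ennreal ((norm (\<beta> s \<omega>))\<^sup>2) \<partial>lborel)"
proof -
  have fin: "energy M \<beta> < \<infinity>" using assms by (auto simp: controls_def)
  have "AE \<omega> in M. (\<integral>\<^sup>+s\<in>{0..1}. ennreal ((norm (\<beta> s \<omega>))\<^sup>2) \<partial>lborel) \<noteq> \<infinity>"
    by (rule nn_integral_PInf_AE[OF energy_measurable[OF assms]]) (use fin in \<open>auto simp: energy_def\<close>)
  then show ?thesis
    using AE_space
  proof eventually_elim
    case (elim \<omega>)
    have m: "(\<lambda>s. indicator {0..1} s *\<^sub>R \<beta> s \<omega>) \<in> borel_measurable borel"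
      using measurable_compose[OF measurable_Pair2'[OF elim(2), of borel] control_joint[OF assms]] by simp
    then have "(\<lambda>s. (norm (indicator {0..1} s *\<^sub>R \<beta> s \<omega>))\<^sup>2) \<in> borel_measurable lborel" by measurable
    moreover have "(\<lambda>s. (norm (indicator {0..1} s *\<^sub>R \<beta> s \<omega>))\<^sup>2) = (\<lambda>s. indicator {0..1} s * (norm (\<beta> s \<omega>))\<^sup>2)"
      by (auto simp: fun_eq_iff split: split_indicator)
    ultimately have m2: "(\<lambda>s. indicator {0..1} s * (norm (\<beta> s \<omega>))\<^sup>2) \<in> borel_measurable lborel"
      by simp
    have e: "(\<integral>\<^sup>+s. ennreal (indicator {0..1} s * (norm (\<beta> s \<omega>))\<^sup>2) \<partial>lborel)
        = (\<integral>\<^sup>+s\<in>{0..1}. ennreal ((norm (\<beta> s \<omega>))\<^sup>2) \<partial>lborel)"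
      by (rule nn_integral_cong) (auto split: split_indicator)
    have i: "integrable lborel (\<lambda>s. indicator {0..1} s * (norm (\<beta> s \<omega>))\<^sup>2)"
      by (rule integrableI_nonneg[OF m2]) (use elim(1) e in \<open>auto simp: top.not_eq_extremum\<close>)
    have "ennreal (cost (\<lambda>s. \<beta> s \<omega>) 1) = (\<integral>\<^sup>+s\<in>{0..1}. ennreal ((norm (\<beta> s \<omega>))\<^sup>2) \<partial>lborel)"
      using nn_integral_eq_integral[OF i] e unfolding cost_def set_lebesgue_integral_def by simp
    with m i show ?case
      unfolding square_integrable_def set_borel_measurable_def set_integrable_def by simp
  qed
qed

lemma control_cost_integrable:
  assumes "\<beta> \<in> controls M F"
  shows "integrable M (\<lambda>\<omega>. cost (\<lambda>s. \<beta> s \<omega>) 1)"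
    and "ennreal (\<integral>\<omega>. cost (\<lambda>s. \<beta> s \<omega>) 1 \<partial>M) = energy M \<beta>"
proof -
  have n: "(\<integral>\<^sup>+\<omega>. ennreal (cost (\<lambda>s. \<beta> s \<omega>) 1) \<partial>M) = energy M \<beta>"
    unfolding energy_def by (rule nn_integral_cong_AE) (use control_square_integrable[OF assms] in eventually_elim, auto)
  have fin: "energy M \<beta> < \<infinity>" using assms by (auto simp: controls_def)
  have m: "(\<lambda>\<omega>. cost (\<lambda>s. \<beta> s \<omega>) 1) \<in> borel_measurable M"
    using measurable_F_M[OF control_cost_measurable[OF assms, of 1]] by simp
  have nn: "AE \<omega> in M. 0 \<le> cost (\<lambda>s. \<beta> s \<omega>) 1" by (simp add: cost_nonneg)
  have "(\<integral>\<^sup>+\<omega>. ennreal (cost (\<lambda>s. \<beta> s \<omega>) 1) \<partial>M) < \<infinity>" unfolding n by (rule fin)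
  then show i: "integrable M (\<lambda>\<omega>. cost (\<lambda>s. \<beta> s \<omega>) 1)"
    by (rule integrableI_nonneg[OF m nn])
  show "ennreal (\<integral>\<omega>. cost (\<lambda>s. \<beta> s \<omega>) 1 \<partial>M) = energy M \<beta>"
    using nn_integral_eq_integral[OF i nn] n by (simp only:)
qed

end

text \<open>Grid controls are prescribed on half-open intervals while integrals run over closed
  ones; the right end point is a null set.\<close>

lemma set_integral_cong_half_open:
  fixes g h :: "real \<Rightarrow> 'b::{banach, second_countable_topology}"
  assumes "\<And>s. a \<le> s \<Longrightarrow> s < b \<Longrightarrow> g s = h s"
  shows "(LINT s:{a..b}|lborel. g s) = (LINT s:{a..b}|lborel. h s)"
  unfolding set_lebesgue_integral_def
  by (rule integral_discrete_difference[where X="{b}"]) (use assms in \<open>auto split: split_indicator\<close>)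

context brownian
begin

text \<open>Fubini in both orders: a null set of pairs becomes, for almost every path, a null set of
  times. In this form integrals along one path can be compared.\<close>

lemma agree_upto_iff:
  assumes "\<beta> \<in> controls M F" "\<beta>' \<in> controls M F" "0 \<le> t" "t \<le> 1"
  shows "agree_upto M t \<beta> \<beta>' \<longleftrightarrow>
    (AE \<omega> in M. AE s in lborel. 0 \<le> s \<and> s \<le> t \<longrightarrow> \<beta> s \<omega> = \<beta>' s \<omega>)"
proof -
  let ?R = "restrict_space lborel {0..t}"
  interpret R: finite_measure ?R
    by (rule finite_measureI) (use assms(3) in \<open>simp add: emeasure_restrict_space space_restrict_space\<close>)
  interpret P: pair_sigma_finite ?R M ..
  define b where "b z = indicator {0..1} (fst z) *\<^sub>R \<beta> (fst z) (snd z)" for z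
  define b' where "b' z = indicator {0..1} (fst z) *\<^sub>R \<beta>' (fst z) (snd z)" for z
  have [measurable]: "b \<in> borel_measurable (borel \<Otimes>\<^sub>M M)" "b' \<in> borel_measurable (borel \<Otimes>\<^sub>M M)"
    using control_joint[OF assms(1)] control_joint[OF assms(2)] unfolding b_def[abs_def] b'_def[abs_def]
    by (simp_all add: split_beta')
  have i: "(\<lambda>z. (fst z, snd z)) \<in> measurable (?R \<Otimes>\<^sub>M M) (borel \<Otimes>\<^sub>M M)"
    by (intro measurable_Pair measurable_snd measurable_compose[OF measurable_fst]
        measurable_restrict_space1) auto
  have "{z \<in> space (?R \<Otimes>\<^sub>M M). b (fst z, snd z) = b' (fst z, snd z)} \<in> sets (?R \<Otimes>\<^sub>M M)"
    using measurable_compose[OF i, of b borel] measurable_compose[OF i, of b' borel] by simp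
  also have "{z \<in> space (?R \<Otimes>\<^sub>M M). b (fst z, snd z) = b' (fst z, snd z)}
     = {z \<in> space (?R \<Otimes>\<^sub>M M). \<beta> (fst z) (snd z) = \<beta>' (fst z) (snd z)}"
    using assms(3,4) by (auto simp: b_def b'_def space_pair_measure space_restrict_space)
  finally have m: "{z \<in> space (?R \<Otimes>\<^sub>M M). \<beta> (fst z) (snd z) = \<beta>' (fst z) (snd z)} \<in> sets (?R \<Otimes>\<^sub>M M)" .
  have "agree_upto M t \<beta> \<beta>' \<longleftrightarrow> (AE z in ?R \<Otimes>\<^sub>M M. \<beta> (fst z) (snd z) = \<beta>' (fst z) (snd z))"
    by (simp add: agree_upto_def split_beta')
  also have "\<dots> \<longleftrightarrow> (AE s in ?R. AE \<omega> in M. \<beta> s \<omega> = \<beta>' s \<omega>)"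
    by (rule P.AE_pair_iff[symmetric, OF m])
  also have "\<dots> \<longleftrightarrow> (AE \<omega> in M. AE s in ?R. \<beta> s \<omega> = \<beta>' s \<omega>)"
    by (rule P.AE_commute[OF m])
  finally show ?thesis by (simp add: AE_restrict_space_iff)
qed

lemma agree_upto_integral:
  assumes "\<beta> \<in> controls M F" "\<beta>' \<in> controls M F" "0 \<le> t" "t \<le> 1"
    and agree: "agree_upto M t \<beta> \<beta>'"
  shows "AE \<omega> in M. (LINT s:{0..t}|lborel. \<beta> s \<omega>) = (LINT s:{0..t}|lborel. \<beta>' s \<omega>)"
  using agree[unfolded agree_upto_iff[OF assms(1-4)]]
    control_square_integrable[OF assms(1)] control_square_integrable[OF assms(2)]
proof eventually_elim
  case (elim \<omega>)
  have "(\<lambda>s. indicator {0..t} s *\<^sub>R \<beta> s \<omega>) \<in> borel_measurable lborel"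
    "(\<lambda>s. indicator {0..t} s *\<^sub>R \<beta>' s \<omega>) \<in> borel_measurable lborel"
    using square_integrable_meas[of "\<lambda>s. \<beta> s \<omega>" 0 t] square_integrable_meas[of "\<lambda>s. \<beta>' s \<omega>" 0 t]
      elim assms(4) unfolding set_borel_measurable_def by auto
  then show ?case unfolding set_lebesgue_integral_def
    by (rule integral_cong_AE) (use elim(1) in \<open>eventually_elim, auto split: split_indicator\<close>)
qed

text \<open>Up to a time before \<open>a\<close> only \<open>\<gamma>\<close> is seen, and from
  \<open>a\<close> on the coefficients are known. The affine form covers the feedback control (c =
  0) and the responding strategy (c = u / 2) alike.\<close>

lemma progressively_measurable_piecewise:
  fixes \<beta> \<gamma> :: "real \<Rightarrow> 'w \<Rightarrow> real ^ 'm::finite"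
  assumes \<beta>: "progressively_measurable F \<beta>" and \<gamma>: "progressively_measurable F \<gamma>"
    and a: "0 \<le> a" and c: "c \<in> borel_measurable (F a)" and d: "d \<in> borel_measurable (F a)"
  shows "progressively_measurable F (\<lambda>s \<omega>. if a \<le> s \<and> s < b then c \<omega> *\<^sub>R \<beta> s \<omega> + d \<omega> else \<gamma> s \<omega>)"
  unfolding progressively_measurable_iff
proof
  fix t :: real assume t: "t \<in> {0..1}"
  define B where "B z = indicator {0..t} (fst z) *\<^sub>R \<beta> (fst z) (snd z)" for z
  define G where "G z = indicator {0..t} (fst z) *\<^sub>R \<gamma> (fst z) (snd z)" for z
  have BG [measurable]: "B \<in> borel_measurable (borel \<Otimes>\<^sub>M F t)" "G \<in> borel_measurable (borel \<Otimes>\<^sub>M F t)"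
    using \<beta> \<gamma> t unfolding progressively_measurable_iff B_def[abs_def] G_def[abs_def]
    by (auto simp: split_beta')
  show "(\<lambda>(s, \<omega>). indicator {0..t} s *\<^sub>R (if a \<le> s \<and> s < b then c \<omega> *\<^sub>R \<beta> s \<omega> + d \<omega> else \<gamma> s \<omega>))
      \<in> borel_measurable (borel \<Otimes>\<^sub>M F t)"
  proof (cases "a \<le> t")
    case True
    have [measurable]: "c \<in> borel_measurable (F t)" "d \<in> borel_measurable (F t)"
      using measurable_F_mono[OF c a True] measurable_F_mono[OF d a True] t by auto
    have "(\<lambda>z. if a \<le> fst z \<and> fst z < b then indicator {0..t} (fst z) *\<^sub>R (c (snd z) *\<^sub>R B z + d (snd z)) else G z)
        \<in> borel_measurable (borel \<Otimes>\<^sub>M F t)" by measurable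
    moreover have "(\<lambda>z. if a \<le> fst z \<and> fst z < b then indicator {0..t} (fst z) *\<^sub>R (c (snd z) *\<^sub>R B z + d (snd z)) else G z)
      = (\<lambda>(s, \<omega>). indicator {0..t} s *\<^sub>R (if a \<le> s \<and> s < b then c \<omega> *\<^sub>R \<beta> s \<omega> + d \<omega> else \<gamma> s \<omega>))"
      by (auto simp: fun_eq_iff B_def G_def split: split_indicator)
    ultimately show ?thesis by simp
  next
    case False
    then have "G = (\<lambda>(s, \<omega>). indicator {0..t} s *\<^sub>R (if a \<le> s \<and> s < b then c \<omega> *\<^sub>R \<beta> s \<omega> + d \<omega> else \<gamma> s \<omega>))"
      by (auto simp: fun_eq_iff G_def split: split_indicator)
    with BG(2) show ?thesis by (simp only:)
  qed
qed

lemma progressively_measurable_zero: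
  "progressively_measurable F (\<lambda>_ _. 0 :: real ^ 'm::finite)"
  unfolding progressively_measurable_iff by simp

lemma energy_le:
  fixes \<beta> \<gamma> :: "real \<Rightarrow> 'w \<Rightarrow> real ^ 'm::finite"
  assumes \<beta>: "\<beta> \<in> controls M F" and c: "0 \<le> c" "0 \<le> d"
    and le: "\<And>s \<omega>. (norm (\<gamma> s \<omega>))\<^sup>2 \<le> c * (norm (\<beta> s \<omega>))\<^sup>2 + d"
  shows "energy M \<gamma> \<le> ennreal c * energy M \<beta> + ennreal d"
proof -
  note [measurable] = control_joint[OF \<beta>]
  have m: "(\<lambda>s. indicator {0..1} s *\<^sub>R \<beta> s \<omega>) \<in> borel_measurable borel" if "\<omega> \<in> space M" for \<omega>
    using measurable_compose[OF measurable_Pair2'[OF that, of borel] control_joint[OF \<beta>]] by simp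
  have m': "(\<lambda>s. ennreal ((norm (\<beta> s \<omega>))\<^sup>2) * indicator {0..1} s) \<in> borel_measurable lborel" if "\<omega> \<in> space M" for \<omega>
  proof -
    have "(\<lambda>s. ennreal ((norm (indicator {0..1} s *\<^sub>R \<beta> s \<omega>))\<^sup>2)) \<in> borel_measurable lborel"
      using m[OF that] by measurable
    moreover have "(\<lambda>s. ennreal ((norm (indicator {0..1} s *\<^sub>R \<beta> s \<omega>))\<^sup>2)) = (\<lambda>s. ennreal ((norm (\<beta> s \<omega>))\<^sup>2) * indicator {0..1} s)"
      by (auto simp: fun_eq_iff split: split_indicator)
    ultimately show ?thesis by (simp only:)
  qed
  have "(\<integral>\<^sup>+s\<in>{0..1}. ennreal ((norm (\<gamma> s \<omega>))\<^sup>2) \<partial>lborel)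
      \<le> ennreal c * (\<integral>\<^sup>+s\<in>{0..1}. ennreal ((norm (\<beta> s \<omega>))\<^sup>2) \<partial>lborel) + ennreal d" if \<omega>: "\<omega> \<in> space M" for \<omega>
  proof -
    have "(\<integral>\<^sup>+s\<in>{0..1}. ennreal ((norm (\<gamma> s \<omega>))\<^sup>2) \<partial>lborel)
      \<le> (\<integral>\<^sup>+s. ennreal c * (ennreal ((norm (\<beta> s \<omega>))\<^sup>2) * indicator {0..1} s) + ennreal d * indicator {0..1} s \<partial>lborel)"
    proof (rule nn_integral_mono)
      fix s
      have "ennreal ((norm (\<gamma> s \<omega>))\<^sup>2) \<le> ennreal (c * (norm (\<beta> s \<omega>))\<^sup>2 + d)"
        by (rule ennreal_leI[OF le])
      also have "\<dots> = ennreal c * ennreal ((norm (\<beta> s \<omega>))\<^sup>2) + ennreal d"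
        using c by (simp add: ennreal_mult)
      finally show "ennreal ((norm (\<gamma> s \<omega>))\<^sup>2) * indicator {0..1} s
          \<le> ennreal c * (ennreal ((norm (\<beta> s \<omega>))\<^sup>2) * indicator {0..1} s) + ennreal d * indicator {0..1} s"
        by (auto split: split_indicator)
    qed
    also have "\<dots> = ennreal c * (\<integral>\<^sup>+s\<in>{0..1}. ennreal ((norm (\<beta> s \<omega>))\<^sup>2) \<partial>lborel) + ennreal d"
      using m'[OF \<omega>] by (simp add: nn_integral_add nn_integral_cmult nn_integral_cmult_indicator)
    finally show ?thesis .
  qed
  then have "energy M \<gamma> \<le> (\<integral>\<^sup>+\<omega>. ennreal c * (\<integral>\<^sup>+s\<in>{0..1}. ennreal ((norm (\<beta> s \<omega>))\<^sup>2) \<partial>lborel) + ennreal d \<partial>M)"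
    unfolding energy_def by (rule nn_integral_mono)
  also have "\<dots> = ennreal c * energy M \<beta> + ennreal d"
    using energy_measurable[OF \<beta>] unfolding energy_def
    by (simp add: nn_integral_add nn_integral_cmult emeasure_space_1)
  finally show ?thesis .
qed

lemma zero_control: "(\<lambda>_ _. 0 :: real ^ 'm::finite) \<in> controls M F" "energy M (\<lambda>_ _. 0 :: real ^ 'm::finite) = 0"
  by (auto simp: controls_def energy_def progressively_measurable_zero)

lemma strategy_control: "\<alpha> \<in> strategies M F \<Longrightarrow> \<beta> \<in> controls M F \<Longrightarrow> \<alpha> \<beta> \<in> controls M F"
  by (auto simp: strategies_def elliott_kalton_strategy_def)

end

section \<open>Expansion of the payoff\<close>

text \<open>Records the conclusions of \<open>value_function\<close> for one mollification, so that
  the game argument uses \<open>u\<close> only through these bounds. \<open>\<epsilon>\<close> and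
  \<open>K\<close> stay fixed while the grid is refined.\<close>

locale approximate_value = brownian M F W
  for M :: "'w measure" and F :: "real \<Rightarrow> 'w measure" and W :: "real \<Rightarrow> 'w \<Rightarrow> real ^ 'n::finite" +
  fixes f :: "real ^ 'n \<Rightarrow> real" and K \<epsilon> :: real
    and u :: "real \<Rightarrow> real ^ 'n \<Rightarrow> real" and du :: "real \<Rightarrow> real ^ 'n \<Rightarrow> real ^ 'n"
  assumes f_measurable [measurable]: "f \<in> borel_measurable borel"
    and u_c11: "0 \<le> t \<Longrightarrow> t \<le> 1 \<Longrightarrow> c11 K (u t) (du t)"
    and u_time: "0 \<le> s \<Longrightarrow> s < t \<Longrightarrow> t \<le> 1 \<Longrightarrow> \<bar>u t x - u s x\<bar> \<le> K * (t - s)"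
    and du_time: "0 \<le> s \<Longrightarrow> s < t \<Longrightarrow> t \<le> 1 \<Longrightarrow> norm (du t x - du s x) \<le> K * sqrt (t - s)"
    and u_step: "0 \<le> s \<Longrightarrow> s < t \<Longrightarrow> t \<le> 1 \<Longrightarrow>
      \<bar>(\<integral>\<omega>. u t (x + (W t \<omega> - W s \<omega>)) \<partial>M) - u s x - (t - s) / 2 * (u s x * (norm (du s x))\<^sup>2)\<bar>
        \<le> K * ((t - s) * sqrt (t - s))"
    and u_final: "\<bar>u 1 x - f x\<bar> \<le> \<epsilon>"
begin

lemma K_nonneg: "0 \<le> K" using c11D(4)[OF u_c11[of 0]] by simp

lemma u_bound: "0 \<le> t \<Longrightarrow> t \<le> 1 \<Longrightarrow> \<bar>u t x\<bar> \<le> K"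
  and du_bound: "0 \<le> t \<Longrightarrow> t \<le> 1 \<Longrightarrow> norm (du t x) \<le> K"
  using c11D(1,2)[OF u_c11] by auto

lemma u_measurable: "0 \<le> t \<Longrightarrow> t \<le> 1 \<Longrightarrow> u t \<in> borel_measurable borel"
  and du_measurable: "0 \<le> t \<Longrightarrow> t \<le> 1 \<Longrightarrow> du t \<in> borel_measurable borel"
  using c11_measurable[OF u_c11] by auto

definition state :: "(real \<Rightarrow> 'w \<Rightarrow> real ^ 'n) \<Rightarrow> real \<Rightarrow> 'w \<Rightarrow> real ^ 'n" where
  "state \<alpha> t \<omega> = W t \<omega> + (LINT s:{0..t}|lborel. \<alpha> s \<omega>)"

lemma state_measurable:
  assumes "\<alpha> \<in> controls M F" "0 \<le> t" "t \<le> 1"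
  shows "state \<alpha> t \<in> borel_measurable (F t)"
  unfolding state_def[abs_def] using assms
  by (intro borel_measurable_add W_measurable control_integral_measurable) auto

text \<open>A deterministic bound for one step: \<open>w\<close> is the Brownian increment,
  \<open>A\<close> the displacement by the control, and Z, Z' the discounts at the two ends. The
  powers of \<open>l\<close> are chosen so that, over l^-4 steps, the first term telescopes and the
  next two have expectation of order at most l; the last is left to the particular control.\<close>

lemma step_remainder:
  fixes x w A :: "real ^ 'n"
  assumes st: "0 \<le> s" "s < t" "t \<le> 1" and l: "0 < l" "l \<le> 1" "t - s = l ^ 4"
    and Z: "0 < Z'" "Z' \<le> Z" "Z \<le> 1"
  shows "\<bar>Z' * u t (x + w + A) - Z * u s x
      - ((Z' - Z) * u s x + Z' * (du s x \<bullet> A) + (t - s) / 2 * (Z * (u s x * (norm (du s x))\<^sup>2)))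
      - Z * (u t (x + w) - u s x - (t - s) / 2 * (u s x * (norm (du s x))\<^sup>2))\<bar>
    \<le> K * (4 * l * (Z - Z') + 2 * (norm w) ^ 4 / l ^ 3 + 6 * l\<^sup>2 * ((norm w)\<^sup>2 + l ^ 4)
        + 7 * (Z' * (norm A)\<^sup>2 / l\<^sup>2))"
proof -
  have t01: "0 \<le> t" "s \<le> 1" using st by auto
  define b where "b = norm w"
  define c where "c = norm A"
  have bc: "0 \<le> b" "0 \<le> c" by (simp_all add: b_def c_def)
  have sq: "sqrt (t - s) = l\<^sup>2" using l by (simp add: real_sqrt_unique)
  have l4: "l ^ 4 \<le> l\<^sup>2" using l by (intro power_decreasing) auto
  have ut: "\<bar>u t (x + w) - u s x\<bar> \<le> 2 * K * (b + l\<^sup>2)"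
  proof -
    have "\<bar>u t (x + w) - u t x\<bar> \<le> 2 * K * b" unfolding b_def by (rule c11_lipschitz[OF u_c11[OF t01(1) st(3)]])
    moreover have "\<bar>u t x - u s x\<bar> \<le> K * l\<^sup>2"
      using u_time[OF st, of x] mult_left_mono[OF l4 K_nonneg] l by simp
    moreover have "K * l\<^sup>2 \<le> 2 * K * l\<^sup>2" using K_nonneg by simp
    ultimately have "\<bar>u t (x + w) - u s x\<bar> \<le> 2 * K * b + 2 * K * l\<^sup>2" by linarith
    then show ?thesis by (simp add: distrib_left)
  qed
  have uA: "\<bar>u t (x + w + A) - u t (x + w) - du s x \<bullet> A\<bar> \<le> K * c\<^sup>2 + 6 * K * (b + l\<^sup>2) * c"
  proof -
    have "\<bar>u t (x + w + A) - u t (x + w) - du t (x + w) \<bullet> A\<bar> \<le> K * c\<^sup>2"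
      unfolding c_def by (rule c11D(3)[OF u_c11[OF t01(1) st(3)]])
    moreover have "\<bar>(du t (x + w) - du s x) \<bullet> A\<bar> \<le> 6 * K * (b + l\<^sup>2) * c"
    proof -
      have "norm (du t (x + w) - du t x) \<le> 6 * K * b"
        unfolding b_def by (rule c11_gradient_lipschitz[OF u_c11[OF t01(1) st(3)]])
      moreover have "norm (du t x - du s x) \<le> K * l\<^sup>2" using du_time[OF st, of x] sq by simp
      moreover have "norm (du t (x + w) - du s x) \<le> norm (du t (x + w) - du t x) + norm (du t x - du s x)"
        using norm_triangle_ineq[of "du t (x + w) - du t x" "du t x - du s x"] by simp
      moreover have "0 \<le> K * l\<^sup>2" using K_nonneg by simp
      ultimately have "norm (du t (x + w) - du s x) \<le> 6 * K * (b + l\<^sup>2)" by (simp add: distrib_left)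
      then show ?thesis
        using Cauchy_Schwarz_ineq2[of "du t (x + w) - du s x" A] bc unfolding c_def
        by (meson mult_right_mono norm_ge_zero order_trans)
    qed
    ultimately show ?thesis by (simp add: inner_diff_left)
  qed
  have y1: "(Z - Z') * (b + l\<^sup>2) \<le> 2 * l * (Z - Z') + b ^ 4 / l ^ 3"
  proof -
    \<comment> \<open>Either b \<le> l, or b = b^4 / b^3 \<le> b^4 / l^3. The small part l is to be
      multiplied by the telescoping Z - Z', while the other has expectation of order l^5 for a
      Brownian increment.\<close>
    have "b \<le> l + b ^ 4 / l ^ 3"
    proof (cases "b \<le> l")
      case False
      then have "l ^ 3 \<le> b ^ 3" using l by (intro power_mono) auto
      then have "b * l ^ 3 \<le> b * b ^ 3" using bc by (intro mult_left_mono) auto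
      then have "b \<le> b ^ 4 / l ^ 3" using l by (simp add: field_simps power4_eq_xxxx power3_eq_cube)
      then show ?thesis using l by simp
    qed (use bc l in \<open>simp add: add_increasing2\<close>)
    moreover have "l\<^sup>2 \<le> l" using l by (simp add: power2_eq_square mult_left_le)
    ultimately have "(Z - Z') * (b + l\<^sup>2) \<le> (Z - Z') * (2 * l + b ^ 4 / l ^ 3)"
      using Z by (intro mult_left_mono) auto
    moreover have "(Z - Z') * (b ^ 4 / l ^ 3) \<le> 1 * (b ^ 4 / l ^ 3)"
      using Z l bc by (intro mult_right_mono) auto
    ultimately show ?thesis by (simp add: algebra_simps)
  qed
  have y2: "Z' * ((b + l\<^sup>2) * c) \<le> l\<^sup>2 * (b\<^sup>2 + l ^ 4) + Z' * c\<^sup>2 / l\<^sup>2"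
  proof -
    \<comment> \<open>Young's inequality with weight l^2: the Brownian part becomes of order l^6 in
      expectation, at the price of c^2 / l^2.\<close>
    have "0 \<le> (l\<^sup>2 * (b + l\<^sup>2) - c)\<^sup>2 / l\<^sup>2" using l by simp
    also have "\<dots> = l\<^sup>2 * (b + l\<^sup>2)\<^sup>2 + c\<^sup>2 / l\<^sup>2 - 2 * ((b + l\<^sup>2) * c)"
      using l by (simp add: power2_eq_square field_simps)
    finally have "2 * ((b + l\<^sup>2) * c) \<le> l\<^sup>2 * (b + l\<^sup>2)\<^sup>2 + c\<^sup>2 / l\<^sup>2" by simp
    moreover have "(b + l\<^sup>2)\<^sup>2 \<le> 2 * (b\<^sup>2 + l ^ 4)"
      using zero_le_power2[of "b - l\<^sup>2"] by (simp add: power2_sum power2_diff flip: power_mult)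
    then have "l\<^sup>2 * (b + l\<^sup>2)\<^sup>2 \<le> l\<^sup>2 * (2 * (b\<^sup>2 + l ^ 4))" by (intro mult_left_mono) auto
    moreover have "0 \<le> c\<^sup>2 / l\<^sup>2" by simp
    ultimately have "(b + l\<^sup>2) * c \<le> l\<^sup>2 * (b\<^sup>2 + l ^ 4) + c\<^sup>2 / l\<^sup>2" by linarith
    then have "Z' * ((b + l\<^sup>2) * c) \<le> Z' * (l\<^sup>2 * (b\<^sup>2 + l ^ 4) + c\<^sup>2 / l\<^sup>2)"
      using Z by (intro mult_left_mono) auto
    then have "Z' * ((b + l\<^sup>2) * c) \<le> Z' * (l\<^sup>2 * (b\<^sup>2 + l ^ 4)) + Z' * (c\<^sup>2 / l\<^sup>2)"
      by (simp only: distrib_left)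
    moreover have "Z' * (l\<^sup>2 * (b\<^sup>2 + l ^ 4)) \<le> 1 * (l\<^sup>2 * (b\<^sup>2 + l ^ 4))"
      using Z by (intro mult_right_mono) auto
    ultimately show ?thesis by simp
  qed
  have y3: "Z' * c\<^sup>2 \<le> Z' * c\<^sup>2 / l\<^sup>2"
  proof -
    have "l\<^sup>2 \<le> 1" using l by (simp add: power_le_one)
    then have "Z' * c\<^sup>2 * l\<^sup>2 \<le> Z' * c\<^sup>2 * 1" using Z by (intro mult_left_mono) auto
    then show ?thesis using l by (simp add: field_simps)
  qed
  \<comment> \<open>The Ito corrections cancel exactly. What remains is the error in the reaction to
    \<open>A\<close> and the product of two small changes, in the discount and in the value.\<close>
  have "Z' * u t (x + w + A) - Z * u s x
      - ((Z' - Z) * u s x + Z' * (du s x \<bullet> A) + (t - s) / 2 * (Z * (u s x * (norm (du s x))\<^sup>2)))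
      - Z * (u t (x + w) - u s x - (t - s) / 2 * (u s x * (norm (du s x))\<^sup>2))
    = Z' * (u t (x + w + A) - u t (x + w) - du s x \<bullet> A) - (Z - Z') * (u t (x + w) - u s x)"
    by (simp add: algebra_simps)
  also have "\<bar>\<dots>\<bar> \<le> Z' * (K * c\<^sup>2 + 6 * K * (b + l\<^sup>2) * c) + (Z - Z') * (2 * K * (b + l\<^sup>2))"
  proof -
    have "\<bar>Z' * (u t (x + w + A) - u t (x + w) - du s x \<bullet> A)\<bar> \<le> Z' * (K * c\<^sup>2 + 6 * K * (b + l\<^sup>2) * c)"
      using uA Z by (simp add: abs_mult)
    moreover have "\<bar>(Z - Z') * (u t (x + w) - u s x)\<bar> \<le> (Z - Z') * (2 * K * (b + l\<^sup>2))"
      using mult_left_mono[OF ut, of "Z - Z'"] Z by (simp add: abs_mult)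
    ultimately show ?thesis by linarith
  qed
  also have "\<dots> = K * (Z' * c\<^sup>2 + 6 * (Z' * ((b + l\<^sup>2) * c)) + 2 * ((Z - Z') * (b + l\<^sup>2)))"
    by (simp add: algebra_simps)
  \<comment> \<open>The 7 in the claim is 1 from the quadratic remainder in \<open>A\<close> plus 6
    from the Lipschitz constant of the gradient.\<close>
  also have "\<dots> \<le> K * (Z' * c\<^sup>2 / l\<^sup>2 + 6 * (l\<^sup>2 * (b\<^sup>2 + l ^ 4) + Z' * c\<^sup>2 / l\<^sup>2)
      + 2 * (2 * l * (Z - Z') + b ^ 4 / l ^ 3))"
    using y1 y2 y3 K_nonneg by (intro mult_left_mono add_mono) auto
  also have "\<dots> = K * (4 * l * (Z - Z') + 2 * b ^ 4 / l ^ 3 + 6 * l\<^sup>2 * (b\<^sup>2 + l ^ 4) + 7 * (Z' * c\<^sup>2 / l\<^sup>2))"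
    by (simp add: algebra_simps)
  finally show ?thesis unfolding b_def c_def .
qed

text \<open>The running reward on \<open>[s, t]\<close> plus the first-order conditional change of the discounted value.
  Either player secures the value by a strategy that makes this term small.\<close>
definition main_term ::
  "(real \<Rightarrow> 'w \<Rightarrow> real ^ 'n) \<Rightarrow> (real \<Rightarrow> 'w \<Rightarrow> real ^ 'n) \<Rightarrow> real \<Rightarrow> real \<Rightarrow> 'w \<Rightarrow> real" where
  "main_term \<alpha> \<beta> s t \<omega> = (let Z = discount (\<lambda>r. \<beta> r \<omega>); x = state \<alpha> s \<omega> in
     (LINT r:{s..t}|lborel. Z r * (\<alpha> r \<omega> \<bullet> \<beta> r \<omega>))
     + ((Z t - Z s) * u s x + Z t * (du s x \<bullet> (LINT r:{s..t}|lborel. \<alpha> r \<omega>))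
        + (t - s) / 2 * (Z s * (u s x * (norm (du s x))\<^sup>2))))"

text \<open>The contribution of the Brownian increment, not small pathwise but almost centred given
  \<open>F s\<close>. Path and increment form a pair so that \<open>increment_expectation\<close>
  can freeze the path.\<close>

definition noise_term ::
  "(real \<Rightarrow> 'w \<Rightarrow> real ^ 'n) \<Rightarrow> (real \<Rightarrow> 'w \<Rightarrow> real ^ 'n) \<Rightarrow> real \<Rightarrow> real \<Rightarrow> 'w \<times> (real ^ 'n) \<Rightarrow> real" where
  "noise_term \<alpha> \<beta> s t z = (let x = state \<alpha> s (fst z) in discount (\<lambda>r. \<beta> r (fst z)) s *
     (u t (x + snd z) - u s x - (t - s) / 2 * (u s x * (norm (du s x))\<^sup>2)))"

text \<open>With the path up to \<open>s\<close> frozen, the mean over the increment is a discount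
  at most 1 times the error in \<open>u_step\<close>.\<close>

lemma noise_term_expectation:
  assumes \<alpha>: "\<alpha> \<in> controls M F" and \<beta>: "\<beta> \<in> controls M F" and st: "0 \<le> s" "s < t" "t \<le> 1"
  shows "integrable M (\<lambda>\<omega>. noise_term \<alpha> \<beta> s t (\<omega>, W t \<omega> - W s \<omega>))"
    and "\<bar>\<integral>\<omega>. noise_term \<alpha> \<beta> s t (\<omega>, W t \<omega> - W s \<omega>) \<partial>M\<bar> \<le> K * ((t - s) * sqrt (t - s))"
proof -
  have t01: "0 \<le> t" "s \<le> 1" using st by auto
  note [measurable] = u_measurable[OF t01(1) st(3)] u_measurable[OF st(1) t01(2)] du_measurable[OF st(1) t01(2)]
    state_measurable[OF \<alpha> st(1) t01(2)] control_discount_measurable[OF \<beta> st(1) t01(2)]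
  have m: "noise_term \<alpha> \<beta> s t \<in> borel_measurable (F s \<Otimes>\<^sub>M borel)"
    unfolding noise_term_def[abs_def] Let_def by measurable
  have bd: "norm (noise_term \<alpha> \<beta> s t z) \<le> 2 * K + K ^ 3" for z
  proof -
    define x where "x = state \<alpha> s (fst z)"
    have "\<bar>(t - s) / 2 * (u s x * (norm (du s x))\<^sup>2)\<bar> \<le> 1 * (K * K\<^sup>2)"
      unfolding abs_mult using st u_bound[OF st(1) t01(2), of x] du_bound[OF st(1) t01(2), of x] K_nonneg
      by (intro mult_mono) (auto intro: power_mono)
    then have "\<bar>u t (x + snd z) - u s x - (t - s) / 2 * (u s x * (norm (du s x))\<^sup>2)\<bar> \<le> 2 * K + K ^ 3"
      using u_bound[OF st(1) t01(2), of x] u_bound[OF t01(1) st(3), of "x + snd z"]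
      by (simp add: power2_eq_square power3_eq_cube)
    then have "\<bar>discount (\<lambda>r. \<beta> r (fst z)) s\<bar> * \<bar>u t (x + snd z) - u s x - (t - s) / 2 * (u s x * (norm (du s x))\<^sup>2)\<bar>
        \<le> 1 * (2 * K + K ^ 3)"
      using discount_le_1[of "\<lambda>r. \<beta> r (fst z)" s] discount_pos[of "\<lambda>r. \<beta> r (fst z)" s]
      by (intro mult_mono) auto
    then show ?thesis unfolding noise_term_def Let_def x_def by (simp add: abs_mult)
  qed
  have [measurable]: "W t \<in> borel_measurable M" "W s \<in> borel_measurable M"
    using st by (auto intro: W_measurable_M)
  have id: "(\<lambda>\<omega>. \<omega>) \<in> measurable (F s) (F s)" by simp
  have "(\<lambda>\<omega>. (\<omega>, W t \<omega> - W s \<omega>)) \<in> measurable M (F s \<Otimes>\<^sub>M borel)"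
    using measurable_F_M[OF id st(1) t01(2)] by measurable
  from measurable_compose[OF this m]
  show "integrable M (\<lambda>\<omega>. noise_term \<alpha> \<beta> s t (\<omega>, W t \<omega> - W s \<omega>))"
    by (rule integrable_const_bound[where B="2 * K + K ^ 3", rotated]) (use bd in auto)
  have inner: "\<bar>\<integral>\<omega>'. noise_term \<alpha> \<beta> s t (\<omega>, W t \<omega>' - W s \<omega>') \<partial>M\<bar> \<le> K * ((t - s) * sqrt (t - s))" for \<omega>
  proof -
    define x where "x = state \<alpha> s \<omega>"
    have iu: "integrable M (\<lambda>\<omega>'. u t (x + (W t \<omega>' - W s \<omega>')))"
      by (rule integrable_const_bound[where B=K]) (use u_bound t01 st in auto)
    have "(\<integral>\<omega>'. noise_term \<alpha> \<beta> s t (\<omega>, W t \<omega>' - W s \<omega>') \<partial>M)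
      = discount (\<lambda>r. \<beta> r \<omega>) s * ((\<integral>\<omega>'. u t (x + (W t \<omega>' - W s \<omega>')) \<partial>M) - u s x
          - (t - s) / 2 * (u s x * (norm (du s x))\<^sup>2))"
      unfolding noise_term_def Let_def using iu by (simp add: x_def[symmetric] prob_space)
    also have "\<bar>\<dots>\<bar> \<le> 1 * (K * ((t - s) * sqrt (t - s)))"
      unfolding abs_mult using u_step[OF st, of x] discount_le_1[of "\<lambda>r. \<beta> r \<omega>" s] discount_pos[of "\<lambda>r. \<beta> r \<omega>" s]
      by (intro mult_mono) auto
    finally show ?thesis by simp
  qed
  have eq: "(\<integral>\<omega>. noise_term \<alpha> \<beta> s t (\<omega>, W t \<omega> - W s \<omega>) \<partial>M)
    = (\<integral>\<omega>. (\<integral>\<omega>'. noise_term \<alpha> \<beta> s t (\<omega>, W t \<omega>' - W s \<omega>') \<partial>M) \<partial>M)"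
    by (rule increment_expectation[OF st id m bd])
  show "\<bar>\<integral>\<omega>. noise_term \<alpha> \<beta> s t (\<omega>, W t \<omega> - W s \<omega>) \<partial>M\<bar> \<le> K * ((t - s) * sqrt (t - s))"
  proof (cases "integrable M (\<lambda>\<omega>. (\<integral>\<omega>'. noise_term \<alpha> \<beta> s t (\<omega>, W t \<omega>' - W s \<omega>') \<partial>M))")
    case True
    have "norm (\<integral>\<omega>. (\<integral>\<omega>'. noise_term \<alpha> \<beta> s t (\<omega>, W t \<omega>' - W s \<omega>') \<partial>M) \<partial>M) \<le> (\<integral>\<omega>. K * ((t - s) * sqrt (t - s)) \<partial>M)"
      by (rule norm_integral_le[OF True]) (use inner in auto)
    then show ?thesis unfolding eq by (simp add: prob_space)
  next
    \<comment> \<open>The integral of a non-integrable function is 0 by convention, so the bound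
      holds here as well.\<close>
    case False
    then show ?thesis unfolding eq using st K_nonneg by (simp add: not_integrable_integral_eq)
  qed
qed

text \<open>The grid has \<open>m ^ 4\<close> intervals, so that both the square root and the fourth root of the step
  size, which occur as Brownian increment and as weight in Young's inequality, are powers of \<open>1 / m\<close>.
  Only the discounted sum \<open>Q\<close> has to be controlled: the energy of \<open>\<beta>\<close> is not bounded uniformly.\<close>
lemma J_approximation:
  fixes m N :: nat
  assumes \<alpha>: "\<alpha> \<in> controls M F" and \<beta>: "\<beta> \<in> controls M F"
    and m: "1 \<le> m" and N: "N = m ^ 4" and Q: "integrable M Q"
    and bound: "AE \<omega> in M. (\<Sum>k<N. \<bar>main_term \<alpha> \<beta> (real k / N) (real (Suc k) / N) \<omega>\<bar>
       + 7 * K * (real m)\<^sup>2 * (discount (\<lambda>r. \<beta> r \<omega>) (real (Suc k) / N)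
           * (norm (LINT r:{real k / N..real (Suc k) / N}|lborel. \<alpha> r \<omega>))\<^sup>2)) \<le> Q \<omega>"
  shows "\<bar>J M W f \<alpha> \<beta> - u 0 0\<bar> \<le> \<epsilon> + (\<integral>\<omega>. Q \<omega> \<partial>M) + K * (11 + 6 * CARD('n) + 6 * (CARD('n))\<^sup>2) / m"
proof -
  define t where "t k = real k / real N" for k
  define l where "l = 1 / real m"
  define n :: real where "n = CARD('n)"
  have l: "0 < l" "l \<le> 1" "real m = 1 / l" using m unfolding l_def by auto
  have N0: "0 < N" using m N by simp
  have Nl: "real N * l ^ 4 = 1" using m unfolding N l_def by (simp add: power_divide)
  have t0: "t 0 = 0" "t N = 1" using N0 unfolding t_def by auto
  have tk: "0 \<le> t k" "t k < t (Suc k)" "t (Suc k) \<le> 1" "t (Suc k) - t k = l ^ 4" if "k < N" for k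
  proof -
    show "0 \<le> t k" "t k < t (Suc k)" "t (Suc k) \<le> 1"
      using that N0 unfolding t_def by (auto simp: field_simps)
    have "t (Suc k) - t k = 1 / real N" unfolding t_def by (simp add: add_divide_distrib)
    moreover have "l ^ 4 = 1 / real N" using Nl N0 by (simp add: eq_divide_eq mult.commute)
    ultimately show "t (Suc k) - t k = l ^ 4" by simp
  qed
  have sq: "sqrt (l ^ 4) = l\<^sup>2" using l by (simp add: real_sqrt_unique)
  define w where "w k \<omega> = W (t (Suc k)) \<omega> - W (t k) \<omega>" for k \<omega>
  define I where "I \<omega> = (LINT t:{0..1}|lborel. discount (\<lambda>s. \<beta> s \<omega>) t * (\<alpha> t \<omega> \<bullet> \<beta> t \<omega>))
     + discount (\<lambda>s. \<beta> s \<omega>) 1 * f (W 1 \<omega> + (LINT t:{0..1}|lborel. \<alpha> t \<omega>))" for \<omega>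
  define Y where "Y k \<omega> = noise_term \<alpha> \<beta> (t k) (t (Suc k)) (\<omega>, w k \<omega>)" for k \<omega>
  \<comment> \<open>The remainders that involve only Brownian increments; 4 l covers the telescoped
    decrements of the discount.\<close>
  define S where "S \<omega> = 4 * l + (\<Sum>k<N. 2 * (norm (w k \<omega>)) ^ 4 / l ^ 3 + 6 * l\<^sup>2 * ((norm (w k \<omega>))\<^sup>2 + l ^ 4))" for \<omega>
  have I_eq: "J M W f \<alpha> \<beta> = (\<integral>\<omega>. I \<omega> \<partial>M)" unfolding J_eq I_def ..
  have W0: "AE \<omega> in M. W 0 \<omega> = 0" using bm by (auto simp: brownian_motion_def)
  have pathwise: "AE \<omega> in M. \<bar>I \<omega> - u 0 0 - (\<Sum>k<N. Y k \<omega>)\<bar> \<le> \<epsilon> + Q \<omega> + K * S \<omega>"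
    using control_square_integrable[OF \<alpha>] control_square_integrable[OF \<beta>] bound W0
  proof eventually_elim
    case (elim \<omega>)
    define a where "a = (\<lambda>s. \<alpha> s \<omega>)"
    define b where "b = (\<lambda>s. \<beta> s \<omega>)"
    have sqa: "square_integrable a" and sqb: "square_integrable b"
      using elim unfolding a_def b_def by auto
    define Z where "Z k = discount b (t k)" for k
    define X where "X k = state \<alpha> (t k) \<omega>" for k
    define P where "P k = (LINT r:{t k..t (Suc k)}|lborel. discount b r * (a r \<bullet> b r))" for k
    define A where "A k = (LINT r:{t k..t (Suc k)}|lborel. a r)" for k
    define v where "v k = Z k * u (t k) (X k)" for k
    define mt where "mt k = main_term \<alpha> \<beta> (t k) (t (Suc k)) \<omega>" for k
    have iP: "set_integrable lborel {0..1} (\<lambda>r. discount b r * (a r \<bullet> b r))"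
      using discount_integrable[OF sqb square_integrable_inner[OF sqa sqb, of 0 1]] by simp
    have X_Suc: "X (Suc k) = X k + w k \<omega> + A k" if "k < N" for k
    proof -
      have "(LINT s:{0..t (Suc k)}|lborel. a s) = (LINT s:{0..t k}|lborel. a s) + A k"
        unfolding A_def using tk[OF that] square_integrable_integrable(1)[OF sqa, of 0 "t (Suc k)"]
        by (intro set_integral_split) auto
      then show ?thesis unfolding X_def state_def w_def a_def by simp
    qed
    have Z0: "Z 0 = 1"
    proof -
      have "cost b 0 = 0" unfolding cost_def set_lebesgue_integral_def
        by (rule integral_eq_zero_AE) (use AE_lborel_singleton[of "0::real"] in \<open>eventually_elim, auto\<close>)
      then show ?thesis by (simp add: Z_def t0 discount_def)
    qed
    have X0: "X 0 = 0"
    proof -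
      have "(LINT s:{0..0}|lborel. a s) = 0" unfolding set_lebesgue_integral_def
        by (rule integral_eq_zero_AE) (use AE_lborel_singleton[of "0::real"] in \<open>eventually_elim, auto\<close>)
      then show ?thesis using elim by (simp add: X_def state_def t0 a_def)
    qed
    have Zk: "0 < Z (Suc k)" "Z (Suc k) \<le> Z k" "Z k \<le> 1" if "k < N" for k
      using discount_mono[OF sqb, of "t k" "t (Suc k)"] tk[OF that] discount_pos[of b] discount_le_1[of b]
      unfolding Z_def by auto
    \<comment> \<open>Reward plus change of the discounted value minus noise is
      \<open>main_term\<close> plus the error of \<open>step_remainder\<close>; the factor m^2 in
      the hypothesis is the 1 / l^2 found there.\<close>
    have step: "\<bar>P k + v (Suc k) - v k - Y k \<omega>\<bar> \<le> \<bar>mt k\<bar> + 7 * K * (real m)\<^sup>2 * (Z (Suc k) * (norm (A k))\<^sup>2)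
        + K * (4 * l * (Z k - Z (Suc k)) + (2 * (norm (w k \<omega>)) ^ 4 / l ^ 3 + 6 * l\<^sup>2 * ((norm (w k \<omega>))\<^sup>2 + l ^ 4)))"
      if k: "k < N" for k
    proof -
      let ?x = "X k" and ?s = "t k" and ?t = "t (Suc k)"
      note rem = step_remainder[OF tk(1-3)[OF k] l(1,2) tk(4)[OF k] Zk[OF k], of ?x "w k \<omega>" "A k"]
      have mt: "mt k = P k + ((Z (Suc k) - Z k) * u ?s ?x + Z (Suc k) * (du ?s ?x \<bullet> A k)
          + (?t - ?s) / 2 * (Z k * (u ?s ?x * (norm (du ?s ?x))\<^sup>2)))"
        unfolding mt_def main_term_def Let_def P_def Z_def A_def X_def a_def b_def by simp
      have Y: "Y k \<omega> = Z k * (u ?t (?x + w k \<omega>) - u ?s ?x - (?t - ?s) / 2 * (u ?s ?x * (norm (du ?s ?x))\<^sup>2))"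
        unfolding Y_def noise_term_def Let_def Z_def X_def b_def by simp
      have v: "v (Suc k) = Z (Suc k) * u ?t (?x + w k \<omega> + A k)" "v k = Z k * u ?s ?x"
        unfolding v_def X_Suc[OF k] by auto
      have e: "7 * (Z (Suc k) * (norm (A k))\<^sup>2 / l\<^sup>2) = 7 * (real m)\<^sup>2 * (Z (Suc k) * (norm (A k))\<^sup>2)"
        unfolding l(3) by (simp add: power_divide)
      show ?thesis using rem unfolding mt Y v e
        by (simp add: distrib_left mult.assoc)
    qed
    have "I \<omega> = (\<Sum>k<N. P k) + Z N * f (X N)"
      using set_integral_grid[OF iP N0 order_refl] N0
      unfolding I_def P_def Z_def X_def state_def t0 a_def b_def t_def[abs_def] by simp
    \<comment> \<open>The discounted value telescopes from discount 1 at the origin to the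
      discounted terminal value, where \<open>u 1\<close> is then compared with
      \<open>f\<close>.\<close>
    moreover have "v N - u 0 0 = (\<Sum>k<N. v (Suc k) - v k)"
      using sum_lessThan_telescope[of v N] by (simp add: v_def Z0 X0 t0)
    ultimately have "I \<omega> - u 0 0 - (\<Sum>k<N. Y k \<omega>)
      = Z N * (f (X N) - u 1 (X N)) + (\<Sum>k<N. P k + v (Suc k) - v k - Y k \<omega>)"
      unfolding v_def[of N] t0 by (simp add: sum.distrib sum_subtractf algebra_simps)
    also have "\<bar>\<dots>\<bar> \<le> \<epsilon> + (\<Sum>k<N. \<bar>P k + v (Suc k) - v k - Y k \<omega>\<bar>)"
    proof -
      have "\<bar>Z N * (f (X N) - u 1 (X N))\<bar> \<le> 1 * \<epsilon>"
        unfolding abs_mult using u_final[of "X N"] discount_pos[of b "t N"] discount_le_1[of b "t N"]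
        unfolding Z_def by (intro mult_mono) auto
      then show ?thesis using sum_abs[of "\<lambda>k. P k + v (Suc k) - v k - Y k \<omega>" "{..<N}"] by linarith
    qed
    also have "(\<Sum>k<N. \<bar>P k + v (Suc k) - v k - Y k \<omega>\<bar>)
      \<le> (\<Sum>k<N. (\<bar>mt k\<bar> + 7 * K * (real m)\<^sup>2 * (Z (Suc k) * (norm (A k))\<^sup>2))
        + K * (4 * l * (Z k - Z (Suc k)) + (2 * (norm (w k \<omega>)) ^ 4 / l ^ 3 + 6 * l\<^sup>2 * ((norm (w k \<omega>))\<^sup>2 + l ^ 4))))"
      by (rule sum_mono) (use step in auto)
    also have "\<dots> = (\<Sum>k<N. \<bar>mt k\<bar> + 7 * K * (real m)\<^sup>2 * (Z (Suc k) * (norm (A k))\<^sup>2))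
        + K * (4 * l * (Z 0 - Z N) + (S \<omega> - 4 * l))"
      unfolding S_def by (simp add: sum.distrib sum_distrib_left[symmetric] sum_lessThan_telescope'[symmetric])
    also have "\<dots> \<le> Q \<omega> + K * S \<omega>"
    proof -
      have "4 * l * (Z 0 - Z N) \<le> 4 * l * 1"
        using l discount_pos[of b "t N"] unfolding Z0 Z_def[of N] by (intro mult_left_mono) auto
      then have "K * (4 * l * (Z 0 - Z N) + (S \<omega> - 4 * l)) \<le> K * S \<omega>"
        using K_nonneg by (intro mult_left_mono) auto
      moreover have "(\<Sum>k<N. \<bar>mt k\<bar> + 7 * K * (real m)\<^sup>2 * (Z (Suc k) * (norm (A k))\<^sup>2)) \<le> Q \<omega>"
        using elim unfolding mt_def Z_def A_def a_def b_def t_def by simp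
      ultimately show ?thesis by linarith
    qed
    finally show ?case by simp
  qed
  have iS: "integrable M S" and ES: "(\<integral>\<omega>. S \<omega> \<partial>M) \<le> (10 + 6 * n + 6 * n\<^sup>2) * l"
  proof -
    note mom = increment_moments[OF tk(1-3), folded w_def]
    have i: "integrable M (\<lambda>\<omega>. (norm (w k \<omega>)) ^ 4)" "integrable M (\<lambda>\<omega>. (norm (w k \<omega>))\<^sup>2)" if "k < N" for k
      using mom[OF that that that] by auto
    define T where "T k \<omega> = 2 * (norm (w k \<omega>)) ^ 4 / l ^ 3 + 6 * l\<^sup>2 * ((norm (w k \<omega>))\<^sup>2 + l ^ 4)" for k \<omega>
    have iT: "integrable M (T k)" and ET: "(\<integral>\<omega>. T k \<omega> \<partial>M) = 2 * (\<integral>\<omega>. (norm (w k \<omega>)) ^ 4 \<partial>M) / l ^ 3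
        + 6 * l\<^sup>2 * ((\<integral>\<omega>. (norm (w k \<omega>))\<^sup>2 \<partial>M) + l ^ 4)" if "k < N" for k
      using i[OF that] unfolding T_def by (auto simp: prob_space)
    have S: "S = (\<lambda>\<omega>. 4 * l + (\<Sum>k<N. T k \<omega>))" unfolding S_def T_def ..
    have iST: "integrable M (\<lambda>\<omega>. \<Sum>k<N. T k \<omega>)"
      using iT by (intro Bochner_Integration.integrable_sum) auto
    then show "integrable M S" unfolding S by simp
    have "(\<integral>\<omega>. S \<omega> \<partial>M) = 4 * l + (\<Sum>k<N. \<integral>\<omega>. T k \<omega> \<partial>M)"
      unfolding S using iT iST by (simp add: prob_space Bochner_Integration.integral_sum)
    also have "\<dots> = 4 * l + (\<Sum>k<N. 2 * (\<integral>\<omega>. (norm (w k \<omega>)) ^ 4 \<partial>M) / l ^ 3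
        + 6 * l\<^sup>2 * ((\<integral>\<omega>. (norm (w k \<omega>))\<^sup>2 \<partial>M) + l ^ 4))"
      using ET by simp
    also have "\<dots> \<le> 4 * l + (\<Sum>k<N. 2 * ((l ^ 4)\<^sup>2 * (3 * n\<^sup>2)) / l ^ 3 + 6 * l\<^sup>2 * (l ^ 4 * n + l ^ 4))"
    proof (intro add_left_mono sum_mono add_mono)
      fix k assume "k \<in> {..<N}"
      then have k: "k < N" by simp
      show "2 * (\<integral>\<omega>. (norm (w k \<omega>)) ^ 4 \<partial>M) / l ^ 3 \<le> 2 * ((l ^ 4)\<^sup>2 * (3 * n\<^sup>2)) / l ^ 3"
        using mom(8)[OF k k k] l unfolding tk(4)[OF k] n_def by (intro divide_right_mono mult_left_mono) auto
      show "6 * l\<^sup>2 * ((\<integral>\<omega>. (norm (w k \<omega>))\<^sup>2 \<partial>M) + l ^ 4) \<le> 6 * l\<^sup>2 * (l ^ 4 * n + l ^ 4)"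
        using mom(6)[OF k k k] unfolding tk(4)[OF k] n_def by simp
    qed
    \<comment> \<open>The fourth moments give l^8 / l^3 per step, hence order l after the l^-4
      steps; the second moments give order l^2.\<close>
    also have "\<dots> = 4 * l + (real N * l ^ 4) * (6 * n\<^sup>2 * l + 6 * l\<^sup>2 * (n + 1))"
      using l by (simp add: field_simps power2_eq_square power3_eq_cube power4_eq_xxxx)
    also have "\<dots> \<le> 4 * l + (6 * n\<^sup>2 * l + 6 * l * (n + 1))"
    proof -
      have "l\<^sup>2 * (n + 1) \<le> l * (n + 1)"
        using l by (intro mult_right_mono) (auto simp: power2_eq_square mult_left_le n_def)
      then show ?thesis unfolding Nl by simp
    qed
    finally show "(\<integral>\<omega>. S \<omega> \<partial>M) \<le> (10 + 6 * n + 6 * n\<^sup>2) * l" by (simp add: algebra_simps)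
  qed
  have iY: "integrable M (Y k)" and EY: "\<bar>\<integral>\<omega>. Y k \<omega> \<partial>M\<bar> \<le> K * (l ^ 4 * l\<^sup>2)" if "k < N" for k
    using noise_term_expectation[OF \<alpha> \<beta> tk(1-3)[OF that]] unfolding Y_def w_def tk(4)[OF that] sq by auto
  have I_meas: "I \<in> borel_measurable M"
  proof -
    have [measurable]: "(\<lambda>\<omega>. LINT t:{0..1}|lborel. \<alpha> t \<omega>) \<in> borel_measurable M"
      "(\<lambda>\<omega>. discount (\<lambda>s. \<beta> s \<omega>) 1) \<in> borel_measurable M" "W 1 \<in> borel_measurable M"
      using measurable_F_M[OF control_integral_measurable[OF \<alpha>, of 0 1 1], of ]
        measurable_F_M[OF control_discount_measurable[OF \<beta>, of 1]] W_measurable_M[of 1] by auto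
    note [measurable] = running_reward_measurable[OF \<alpha> \<beta>]
    show ?thesis unfolding I_def[abs_def] by measurable
  qed
  \<comment> \<open>\<open>D\<close> is dominated by an integrable function, which also makes the
    payoff integrable, as \<open>D\<close> differs from it by integrable terms.\<close>
  define D where "D \<omega> = I \<omega> - u 0 0 - (\<Sum>k<N. Y k \<omega>)" for \<omega>
  have iB: "integrable M (\<lambda>\<omega>. \<epsilon> + Q \<omega> + K * S \<omega>)" using Q iS by simp
  have [measurable]: "k < N \<Longrightarrow> Y k \<in> borel_measurable M" for k using iY by auto
  have D_meas: "D \<in> borel_measurable M" unfolding D_def[abs_def] using I_meas by measurable
  have iD: "integrable M D"
    by (rule Bochner_Integration.integrable_bound[OF iB D_meas])
       (use pathwise in \<open>eventually_elim, auto simp: D_def\<close>)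
  have iSY: "integrable M (\<lambda>\<omega>. \<Sum>k<N. Y k \<omega>)"
    using iY by (intro Bochner_Integration.integrable_sum) auto
  have "(\<integral>\<omega>. I \<omega> \<partial>M) = (\<integral>\<omega>. D \<omega> + u 0 0 + (\<Sum>k<N. Y k \<omega>) \<partial>M)" by (simp add: D_def)
  also have "\<dots> = (\<integral>\<omega>. D \<omega> \<partial>M) + u 0 0 + (\<Sum>k<N. \<integral>\<omega>. Y k \<omega> \<partial>M)"
    using iD iSY iY by (simp add: prob_space Bochner_Integration.integral_sum)
  finally have "J M W f \<alpha> \<beta> - u 0 0 = (\<integral>\<omega>. D \<omega> \<partial>M) + (\<Sum>k<N. \<integral>\<omega>. Y k \<omega> \<partial>M)" unfolding I_eq by simp
  moreover have "\<bar>\<Sum>k<N. \<integral>\<omega>. Y k \<omega> \<partial>M\<bar> \<le> K * l"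
  proof -
    have "\<bar>\<Sum>k<N. \<integral>\<omega>. Y k \<omega> \<partial>M\<bar> \<le> (\<Sum>k<N. K * (l ^ 4 * l\<^sup>2))"
      by (rule order_trans[OF sum_abs sum_mono]) (use EY in auto)
    also have "\<dots> = K * l\<^sup>2 * (real N * l ^ 4)" by simp
    also have "\<dots> \<le> K * l" unfolding Nl
      using K_nonneg l by (simp add: power2_eq_square mult_left_mono mult_left_le)
    finally show ?thesis .
  qed
  moreover have "\<bar>\<integral>\<omega>. D \<omega> \<partial>M\<bar> \<le> \<epsilon> + (\<integral>\<omega>. Q \<omega> \<partial>M) + K * ((10 + 6 * n + 6 * n\<^sup>2) * l)"
  proof -
    have "\<bar>\<integral>\<omega>. D \<omega> \<partial>M\<bar> \<le> (\<integral>\<omega>. \<bar>D \<omega>\<bar> \<partial>M)" by (rule integral_abs_bound)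
    also have "\<dots> \<le> (\<integral>\<omega>. \<epsilon> + Q \<omega> + K * S \<omega> \<partial>M)"
      using pathwise unfolding D_def[symmetric] by (intro integral_mono_AE integrable_abs iD iB)
    also have "\<dots> = \<epsilon> + (\<integral>\<omega>. Q \<omega> \<partial>M) + K * (\<integral>\<omega>. S \<omega> \<partial>M)" using Q iS by (simp add: prob_space)
    also have "\<dots> \<le> \<epsilon> + (\<integral>\<omega>. Q \<omega> \<partial>M) + K * ((10 + 6 * n + 6 * n\<^sup>2) * l)"
      using ES K_nonneg by (simp add: mult_left_mono)
    finally show ?thesis .
  qed
  ultimately have "\<bar>J M W f \<alpha> \<beta> - u 0 0\<bar> \<le> \<epsilon> + (\<integral>\<omega>. Q \<omega> \<partial>M) + (K * ((10 + 6 * n + 6 * n\<^sup>2) * l) + K * l)"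
    by linarith
  \<comment> \<open>10 = 4 + 6 stems from \<open>S\<close>, the extra 1 from the noise
    terms.\<close>
  also have "K * ((10 + 6 * n + 6 * n\<^sup>2) * l) + K * l = K * (11 + 6 * n + 6 * n\<^sup>2) * l"
    by (simp add: algebra_simps)
  finally show ?thesis unfolding n_def l_def by simp
qed

end

section \<open>A control against every strategy\<close>

context approximate_value
begin

text \<open>Against an arbitrary strategy \<open>\<alpha>\<close>, the feedback \<open>\<beta> = - du (t, state)\<close> removes \<open>\<alpha>\<close> from
  the first-order expansion. It is frozen on the intervals of the grid, so that it can be built
  interval by interval although \<open>\<alpha>\<close> reacts to it instantaneously.\<close>
primrec feedback ::
  "((real \<Rightarrow> 'w \<Rightarrow> real ^ 'n) \<Rightarrow> (real \<Rightarrow> 'w \<Rightarrow> real ^ 'n)) \<Rightarrow> nat \<Rightarrow> nat \<Rightarrow> real \<Rightarrow> 'w \<Rightarrow> real ^ 'n" where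
  "feedback \<alpha> N 0 = (\<lambda>_ _. 0)"
| "feedback \<alpha> N (Suc k) = (\<lambda>s \<omega>. if real k / N \<le> s \<and> s < real (Suc k) / N
     then - du (real k / N) (state (\<alpha> (feedback \<alpha> N k)) (real k / N) \<omega>) else feedback \<alpha> N k s \<omega>)"

lemma grid_bounds:
  assumes "k < N"
  shows "0 \<le> real k / real N" "real k / real N < real (Suc k) / real N" "real (Suc k) / real N \<le> 1"
    "real k / real N \<le> 1"
  using assms by (auto simp: field_simps)

text \<open>The gradient is bounded by \<open>K\<close>, so the energy bound does not depend on the
  grid. It is the level at which the boundedness of a strategy is invoked in
  \<open>feedback_payoff\<close>.\<close>

lemma feedback_control:
  assumes \<alpha>: "\<alpha> \<in> strategies M F" and "k \<le> N"
  shows "feedback \<alpha> N k \<in> controls M F \<and> (\<forall>s \<omega>. norm (feedback \<alpha> N k s \<omega>) \<le> K)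
    \<and> energy M (feedback \<alpha> N k) \<le> ennreal (K\<^sup>2)"
  using assms(2)
proof (induction k)
  case 0
  then show ?case using zero_control[where 'm='n] K_nonneg by simp
next
  case (Suc k)
  let ?t = "real k / real N"
  from Suc have IH: "feedback \<alpha> N k \<in> controls M F" "\<And>s \<omega>. norm (feedback \<alpha> N k s \<omega>) \<le> K"
    and k: "k < N" by auto
  note t = grid_bounds[OF k]
  have st: "state (\<alpha> (feedback \<alpha> N k)) ?t \<in> borel_measurable (F ?t)"
    using state_measurable[OF strategy_control[OF \<alpha> IH(1)]] t by auto
  have "progressively_measurable F (\<lambda>s \<omega>. if ?t \<le> s \<and> s < real (Suc k) / real N
     then 0 *\<^sub>R feedback \<alpha> N k s \<omega> + - du ?t (state (\<alpha> (feedback \<alpha> N k)) ?t \<omega>) else feedback \<alpha> N k s \<omega>)"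
    using IH(1) t st measurable_compose[OF st du_measurable[OF t(1,4)]]
    by (intro progressively_measurable_piecewise) (auto simp: controls_def)
  then have prog: "progressively_measurable F (feedback \<alpha> N (Suc k))" by (simp cong: if_cong)
  have bd: "norm (feedback \<alpha> N (Suc k) s \<omega>) \<le> K" for s \<omega>
    using IH(2)[of s \<omega>] du_bound[OF t(1,4)] by simp
  have "energy M (feedback \<alpha> N (Suc k)) \<le> ennreal 0 * energy M (\<lambda>_ _. 0 :: real ^ 'n) + ennreal (K\<^sup>2)"
  proof (rule energy_le[OF zero_control(1)])
    show "(norm (feedback \<alpha> N (Suc k) s \<omega>))\<^sup>2 \<le> 0 * (norm (0 :: real ^ 'n))\<^sup>2 + K\<^sup>2" for s \<omega>
      using power_mono[OF bd[of s \<omega>], of 2] by simp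
  qed auto
  then have en: "energy M (feedback \<alpha> N (Suc k)) \<le> ennreal (K\<^sup>2)" by (simp add: zero_control)
  then have "energy M (feedback \<alpha> N (Suc k)) < \<infinity>" using le_less_trans by fastforce
  with prog en bd show ?case by (simp add: controls_def)
qed

lemma feedback_eq:
  assumes "j \<le> k" "s < real j / real N"
  shows "feedback \<alpha> N k s \<omega> = feedback \<alpha> N j s \<omega>"
  using assms(1)
proof (induction k rule: dec_induct)
  case (step k)
  have "real j / real N \<le> real k / real N" using step by (intro divide_right_mono) auto
  then show ?case using step assms(2) by simp
qed simp

text \<open>The non-anticipation of \<open>\<alpha>\<close> enters here: later stages alter the
  control only from time k / N on, so the answers, and with them the states at k / N, agree almost
  surely. The one time k / N itself is a null set.\<close>

lemma feedback_agree:
  assumes \<alpha>: "\<alpha> \<in> strategies M F" and k: "k < N"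
  shows "AE \<omega> in M. state (\<alpha> (feedback \<alpha> N N)) (real k / N) \<omega> = state (\<alpha> (feedback \<alpha> N k)) (real k / N) \<omega>"
proof -
  let ?t = "real k / real N"
  note t = grid_bounds[OF k]
  have c: "feedback \<alpha> N N \<in> controls M F" "feedback \<alpha> N k \<in> controls M F"
    using feedback_control[OF \<alpha>] k by auto
  have "AE s in lborel. 0 \<le> s \<and> s \<le> ?t \<longrightarrow> feedback \<alpha> N N s \<omega> = feedback \<alpha> N k s \<omega>" for \<omega>
    using AE_lborel_singleton[of ?t] by eventually_elim (use k in \<open>auto intro!: feedback_eq\<close>)
  then have "agree_upto M ?t (feedback \<alpha> N N) (feedback \<alpha> N k)"
    unfolding agree_upto_iff[OF c t(1,4)] by simp
  then have "agree_upto M ?t (\<alpha> (feedback \<alpha> N N)) (\<alpha> (feedback \<alpha> N k))"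
    using \<alpha> c t unfolding strategies_def elliott_kalton_strategy_def by auto
  from agree_upto_integral[OF strategy_control[OF \<alpha> c(1)] strategy_control[OF \<alpha> c(2)] t(1,4) this]
  show ?thesis by eventually_elim (simp add: state_def)
qed

text \<open>Closes the loop: the completed control is the feedback of the state it produces itself,
  not merely of the state of an earlier stage.\<close>

lemma feedback_value:
  assumes \<alpha>: "\<alpha> \<in> strategies M F" and k: "k < N"
  shows "AE \<omega> in M. \<forall>s. real k / N \<le> s \<and> s < real (Suc k) / N \<longrightarrow>
    feedback \<alpha> N N s \<omega> = - du (real k / N) (state (\<alpha> (feedback \<alpha> N N)) (real k / N) \<omega>)"
  using feedback_agree[OF assms]
proof eventually_elim
  case (elim \<omega>)
  show ?case
  proof (intro allI impI)
    fix s assume s: "real k / real N \<le> s \<and> s < real (Suc k) / real N"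
    have "feedback \<alpha> N N s \<omega> = feedback \<alpha> N (Suc k) s \<omega>"
      using k s by (intro feedback_eq) auto
    then show "feedback \<alpha> N N s \<omega> = - du (real k / N) (state (\<alpha> (feedback \<alpha> N N)) (real k / N) \<omega>)"
      using s elim by simp
  qed
qed

text \<open>Two cancellations: the reward offsets the drift of the value except for the variation of
  the discount within the step (\<open>E\<close>), and the decay of the discount offsets the Ito
  correction to second order (\<open>R\<close>). The bound is an increment of time plus cost of
  \<alpha>, so it telescopes over the grid.\<close>

lemma main_term_feedback:
  assumes st: "0 \<le> s" "s < t" "t \<le> 1" and l: "0 < l" "l \<le> 1" "t - s = l ^ 4"
    and a: "square_integrable (\<lambda>r. \<alpha> r \<omega>)" and b: "square_integrable (\<lambda>r. \<beta> r \<omega>)"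
    and fb: "\<And>r. s \<le> r \<Longrightarrow> r < t \<Longrightarrow> \<beta> r \<omega> = - du s (state \<alpha> s \<omega>)"
  shows "\<bar>main_term \<alpha> \<beta> s t \<omega>\<bar> \<le> (K ^ 3 + K ^ 5) * l\<^sup>2 *
      ((t - s) + (cost (\<lambda>r. \<alpha> r \<omega>) t - cost (\<lambda>r. \<alpha> r \<omega>) s))"
proof -
  define Z where "Z = discount (\<lambda>r. \<beta> r \<omega>)"
  define U where "U = u s (state \<alpha> s \<omega>)"
  define D where "D = du s (state \<alpha> s \<omega>)"
  define h where "h = t - s"
  define ca where "ca = cost (\<lambda>r. \<alpha> r \<omega>) t - cost (\<lambda>r. \<alpha> r \<omega>) s"
  define I where "I = (LINT r:{s..t}|lborel. norm (\<alpha> r \<omega>))"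
  have s1: "s \<le> 1" using st by simp
  have h: "0 < h" "h = l ^ 4" using st l by (auto simp: h_def)
  have U: "\<bar>U\<bar> \<le> K" and D: "norm D \<le> K" unfolding U_def D_def using u_bound du_bound st(1) s1 by auto
  have K0: "0 \<le> K" by (rule K_nonneg)
  have Zb: "0 < Z r" "Z r \<le> 1" for r unfolding Z_def using discount_pos discount_le_1 by auto
  have Zm: "Z t \<le> Z r" "Z r \<le> Z s" if "s \<le> r" "r \<le> t" for r
    unfolding Z_def using discount_mono[OF b] that st by auto
  have ca: "0 \<le> ca" using cost_mono[OF a st(1) less_imp_le[OF st(2)] st(3)] by (simp add: ca_def)
  define y where "y = h * (norm D)\<^sup>2 / 2"
  have y: "0 \<le> y" "y \<le> h * K\<^sup>2 / 2"
    unfolding y_def using h power_mono[OF D, of 2] by (auto intro!: divide_right_mono mult_left_mono)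
  have cost_b: "cost (\<lambda>r. \<beta> r \<omega>) t - cost (\<lambda>r. \<beta> r \<omega>) s = h * (norm D)\<^sup>2"
  proof -
    have "cost (\<lambda>r. \<beta> r \<omega>) t - cost (\<lambda>r. \<beta> r \<omega>) s = (LINT r:{s..t}|lborel. (norm (\<beta> r \<omega>))\<^sup>2)"
      using st by (intro cost_diff[OF b]) auto
    also have "\<dots> = (LINT r:{s..t}|lborel. (norm D)\<^sup>2)"
      by (rule set_integral_cong_half_open) (use fb in \<open>auto simp: D_def\<close>)
    also have "\<dots> = h * (norm D)\<^sup>2" using st by (simp add: set_lebesgue_integral_def h_def)
    finally show ?thesis .
  qed
  have Zt: "Z t = Z s * exp (- y)"
    using cost_b unfolding Z_def discount_def y_def by (simp add: field_simps flip: exp_add)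
  have e1: "1 - exp (- y) \<le> y" using exp_ge_add_one_self[of "- y"] by linarith
  have e2: "y - (1 - exp (- y)) \<le> y\<^sup>2"
  proof -
    have "1 / (1 + y) \<ge> exp (- y)"
      using exp_ge_add_one_self[of y] y by (simp add: exp_minus field_simps)
    \<comment> \<open>Through exp (- y) \<le> 1 / (1 + y) \<le> 1 - y + y^2.\<close>
    have "exp (- y) \<le> 1 - y + y\<^sup>2"
    proof -
      have "1 / (1 + y) \<le> 1 - y + y\<^sup>2"
        using y by (simp add: field_simps power2_eq_square power3_eq_cube)
      then show ?thesis using \<open>1 / (1 + y) \<ge> exp (- y)\<close> by linarith
    qed
    then show ?thesis by simp
  qed
  have dZ: "0 \<le> Z s - Z t" "Z s - Z t \<le> h * K\<^sup>2 / 2"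
  proof -
    show "0 \<le> Z s - Z t" using Zm[of s] st by simp
    have "Z s - Z t = Z s * (1 - exp (- y))" unfolding Zt by (simp add: algebra_simps)
    also have "\<dots> \<le> 1 * y" using Zb[of s] e1 y by (intro mult_mono) auto
    finally show "Z s - Z t \<le> h * K\<^sup>2 / 2" using y by simp
  qed
  have Ib: "I \<le> l\<^sup>2 * (1 + ca)" "0 \<le> I"
  proof -
    show "0 \<le> I" unfolding I_def set_lebesgue_integral_def by (rule integral_nonneg_AE) simp
    \<comment> \<open>Cauchy-Schwarz gives only the square root of the cost; enlarging ca to (1 +
      ca)^2 makes the bound on \<open>I\<close> linear in the cost, which can be summed.\<close>
    have "I\<^sup>2 \<le> l ^ 4 * ca"
      using norm_set_integral_power2_le(1)[OF a st(1) less_imp_le[OF st(2)] st(3)]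
      unfolding I_def ca_def l(3) .
    also have "\<dots> \<le> (l\<^sup>2 * (1 + ca))\<^sup>2"
    proof -
      have "ca \<le> (1 + ca)\<^sup>2" using ca zero_le_power2[of ca] by (simp add: power2_sum)
      then have "l ^ 4 * ca \<le> l ^ 4 * (1 + ca)\<^sup>2" by (intro mult_left_mono) auto
      then show ?thesis by (simp add: power_mult_distrib flip: power_mult)
    qed
    finally show "I \<le> l\<^sup>2 * (1 + ca)" by (rule power2_le_imp_le) (use ca in auto)
  qed
  have ia: "set_integrable lborel {s..t} (\<lambda>r. \<alpha> r \<omega>)" "set_integrable lborel {s..t} (\<lambda>r. norm (\<alpha> r \<omega>))"
    using square_integrable_integrable[OF a st(1,3)] by auto
  have iaD: "set_integrable lborel {s..t} (\<lambda>r. \<alpha> r \<omega> \<bullet> D)"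
    using ia(1) unfolding set_integrable_def by (simp add: integrable_inner_left flip: inner_scaleR_left)
  have iZ: "set_integrable lborel {s..t} (\<lambda>r. Z r * (\<alpha> r \<omega> \<bullet> D))"
    using discount_integrable[OF b iaD st(1,3)] unfolding Z_def by simp
  have aD: "(LINT r:{s..t}|lborel. \<alpha> r \<omega> \<bullet> D) = (LINT r:{s..t}|lborel. \<alpha> r \<omega>) \<bullet> D"
    using integral_inner_left[OF ia(1)[unfolded set_integrable_def], of D]
    unfolding set_lebesgue_integral_def by simp
  define E where "E = (LINT r:{s..t}|lborel. (Z t - Z r) * (\<alpha> r \<omega> \<bullet> D))"
  have "(LINT r:{s..t}|lborel. Z r * (\<alpha> r \<omega> \<bullet> \<beta> r \<omega>)) = (LINT r:{s..t}|lborel. - (Z r * (\<alpha> r \<omega> \<bullet> D)))"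
    by (rule set_integral_cong_half_open) (use fb in \<open>auto simp: D_def\<close>)
  also have "\<dots> = - (LINT r:{s..t}|lborel. Z r * (\<alpha> r \<omega> \<bullet> D))"
    unfolding set_lebesgue_integral_def by simp
  finally have P: "(LINT r:{s..t}|lborel. Z r * (\<alpha> r \<omega> \<bullet> \<beta> r \<omega>)) = - (LINT r:{s..t}|lborel. Z r * (\<alpha> r \<omega> \<bullet> D))" .
  have E: "E = Z t * (D \<bullet> (LINT r:{s..t}|lborel. \<alpha> r \<omega>)) + (LINT r:{s..t}|lborel. Z r * (\<alpha> r \<omega> \<bullet> \<beta> r \<omega>))"
  proof -
    have "E = (LINT r:{s..t}|lborel. Z t * (\<alpha> r \<omega> \<bullet> D) - Z r * (\<alpha> r \<omega> \<bullet> D))"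
      unfolding E_def by (simp add: left_diff_distrib)
    also have "\<dots> = Z t * (LINT r:{s..t}|lborel. \<alpha> r \<omega> \<bullet> D) - (LINT r:{s..t}|lborel. Z r * (\<alpha> r \<omega> \<bullet> D))"
      using iaD iZ by (subst set_integral_diff) auto
    finally show ?thesis unfolding P aD by (simp add: inner_commute)
  qed
  have E_le: "\<bar>E\<bar> \<le> h * K ^ 3 / 2 * I"
  proof -
    have "\<bar>E\<bar> \<le> (LINT r:{s..t}|lborel. h * K ^ 3 / 2 * norm (\<alpha> r \<omega>))"
      unfolding E_def set_lebesgue_integral_def real_norm_def[symmetric]
    proof (rule norm_integral_le)
      have "set_integrable lborel {s..t} (\<lambda>r. Z t * (\<alpha> r \<omega> \<bullet> D) - Z r * (\<alpha> r \<omega> \<bullet> D))"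
        using iaD iZ by (intro set_integral_diff) auto
      then show "integrable lborel (\<lambda>r. indicator {s..t} r *\<^sub>R ((Z t - Z r) * (\<alpha> r \<omega> \<bullet> D)))"
        unfolding set_integrable_def by (simp add: left_diff_distrib)
      show "integrable lborel (\<lambda>r. indicator {s..t} r *\<^sub>R (h * K ^ 3 / 2 * norm (\<alpha> r \<omega>)))"
        using set_integrable_mult_right[of "h * K ^ 3 / 2", OF ia(2)] unfolding set_integrable_def .
      fix r
      show "norm (indicator {s..t} r *\<^sub>R ((Z t - Z r) * (\<alpha> r \<omega> \<bullet> D))) \<le> indicator {s..t} r *\<^sub>R (h * K ^ 3 / 2 * norm (\<alpha> r \<omega>))"
      proof (cases "r \<in> {s..t}")
        case True
        then have "\<bar>Z t - Z r\<bar> \<le> h * K\<^sup>2 / 2" using Zm[of r] dZ by auto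
        moreover have "\<bar>\<alpha> r \<omega> \<bullet> D\<bar> \<le> norm (\<alpha> r \<omega>) * K"
          using Cauchy_Schwarz_ineq2[of "\<alpha> r \<omega>" D] D by (meson mult_left_mono norm_ge_zero order_trans)
        ultimately have "\<bar>Z t - Z r\<bar> * \<bar>\<alpha> r \<omega> \<bullet> D\<bar> \<le> (h * K\<^sup>2 / 2) * (norm (\<alpha> r \<omega>) * K)"
          using h by (intro mult_mono) auto
        also have "\<dots> = h * K ^ 3 / 2 * norm (\<alpha> r \<omega>)" by (simp add: power2_eq_square power3_eq_cube)
        finally show ?thesis using True by (simp add: abs_mult)
      qed simp
    qed
    then show ?thesis by (simp add: I_def)
  qed
  have R: "\<bar>(Z t - Z s) * U + h / 2 * (Z s * (U * (norm D)\<^sup>2))\<bar> \<le> K * (h * K\<^sup>2 / 2)\<^sup>2"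
  proof -
    have "(Z t - Z s) * U + h / 2 * (Z s * (U * (norm D)\<^sup>2)) = (Z s * U) * (y - (1 - exp (- y)))"
      unfolding Zt y_def by (simp add: algebra_simps)
    also have "\<bar>\<dots>\<bar> = (Z s * \<bar>U\<bar>) * (y - (1 - exp (- y)))" using Zb[of s] e1 by (simp add: abs_mult)
    also have "\<dots> \<le> (1 * K) * (h * K\<^sup>2 / 2)\<^sup>2"
    proof (rule mult_mono)
      show "y - (1 - exp (- y)) \<le> (h * K\<^sup>2 / 2)\<^sup>2" using e2 power_mono[OF y(2,1), of 2] by linarith
      show "Z s * \<bar>U\<bar> \<le> 1 * K" using Zb[of s] U by (intro mult_mono) auto
    qed (use K0 e1 in auto)
    finally show ?thesis by simp
  qed
  have "main_term \<alpha> \<beta> s t \<omega> = E + ((Z t - Z s) * U + h / 2 * (Z s * (U * (norm D)\<^sup>2)))"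
    unfolding main_term_def Let_def E Z_def[symmetric] U_def[symmetric] D_def[symmetric] h_def[symmetric] by simp
  then have "\<bar>main_term \<alpha> \<beta> s t \<omega>\<bar> \<le> h * K ^ 3 / 2 * I + K * (h * K\<^sup>2 / 2)\<^sup>2" using E_le R by linarith
  also have "h * K ^ 3 / 2 * I \<le> h * K ^ 3 / 2 * (l\<^sup>2 * (1 + ca))"
    using Ib h K0 by (intro mult_left_mono) auto
  also have "h * K ^ 3 / 2 * (l\<^sup>2 * (1 + ca)) \<le> K ^ 3 * l\<^sup>2 * (h + ca)"
  proof -
    have "h \<le> 1" using st by (simp add: h_def)
    then have "h * ca \<le> 1 * ca" using ca by (intro mult_right_mono) auto
    then have "h * (1 + ca) \<le> h + ca" by (simp add: distrib_left)
    then have "h * (1 + ca) / 2 \<le> (h + ca) / 2" by (intro divide_right_mono) auto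
    also have "\<dots> \<le> h + ca" using h(1) ca by simp
    finally have "h * (1 + ca) / 2 \<le> h + ca" .
    then have "(K ^ 3 * l\<^sup>2) * (h * (1 + ca) / 2) \<le> (K ^ 3 * l\<^sup>2) * (h + ca)"
      using K0 by (intro mult_left_mono) auto
    then show ?thesis by (simp add: algebra_simps)
  qed
  also have "K * (h * K\<^sup>2 / 2)\<^sup>2 \<le> K ^ 5 * l\<^sup>2 * (h + ca)"
  proof -
    have "h * h \<le> l\<^sup>2 * (h + ca)"
    proof (rule mult_mono)
      show "h \<le> l\<^sup>2" unfolding h(2) using l by (intro power_decreasing) auto
    qed (use h ca in auto)
    then have "K ^ 5 * (h * h) \<le> K ^ 5 * (l\<^sup>2 * (h + ca))" using K0 by (intro mult_left_mono) auto
    moreover have "K * (h * K\<^sup>2 / 2)\<^sup>2 = K ^ 5 * (h * h) / 4"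
      by (simp add: power2_eq_square eval_nat_numeral)
    moreover have "0 \<le> K ^ 5 * (h * h)" using K0 by simp
    ultimately show ?thesis by (simp add: mult.assoc)
  qed
  finally show ?thesis unfolding h_def ca_def by (simp add: algebra_simps)
qed

text \<open>All grid feedbacks have energy at most K^2, so the definition of
  \<open>strategies\<close> bounds the energy of the answers by one number \<open>e\<close>. Hence
  \<open>C\<close> depends on \<alpha> but not on \<open>m\<close>.\<close>

lemma feedback_payoff:
  assumes \<alpha>: "\<alpha> \<in> strategies M F"
  obtains C where "\<And>m. 1 \<le> m \<Longrightarrow> \<exists>\<beta>\<in>controls M F. \<bar>J M W f (\<alpha> \<beta>) \<beta> - u 0 0\<bar> \<le> \<epsilon> + C / real m"
proof -
  define B where "B = (SUP \<beta>\<in>{\<beta>\<in>controls M F. energy M \<beta> \<le> ennreal (K\<^sup>2)}. energy M (\<alpha> \<beta>))"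
  define e where "e = enn2real B"
  have "B < \<infinity>" using \<alpha> unfolding strategies_def B_def by auto
  then have B: "B = ennreal e" "0 \<le> e" unfolding e_def by auto
  \<comment> \<open>K^3 + K^5 comes from \<open>main_term_feedback\<close>, 7 K from the squared
    displacement in \<open>J_approximation\<close>, where m^2 l^4 = l^2.\<close>
  define c where "c = K ^ 3 + K ^ 5 + 7 * K"
  have c: "0 \<le> c" using K_nonneg unfolding c_def by simp
  show ?thesis
  proof (rule that)
    fix m :: nat assume m: "1 \<le> m"
    define N where "N = m ^ 4"
    define l where "l = 1 / real m"
    have N0: "0 < N" using m by (simp add: N_def)
    have l: "0 < l" "l \<le> 1" "real m = 1 / l" "l\<^sup>2 \<le> l"
      using m unfolding l_def by (auto simp: power2_eq_square divide_le_eq)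
    have Nl: "1 / real N = l ^ 4" unfolding N_def l_def by (simp add: power_one_over)
    define \<beta> where "\<beta> = feedback \<alpha> N N"
    have \<beta>: "\<beta> \<in> controls M F" "energy M \<beta> \<le> ennreal (K\<^sup>2)"
      using feedback_control[OF \<alpha>, of N N] unfolding \<beta>_def by auto
    note \<alpha>\<beta> = strategy_control[OF \<alpha> \<beta>(1)]
    define Q where "Q \<omega> = c * l * (1 + cost (\<lambda>s. \<alpha> \<beta> s \<omega>) 1)" for \<omega>
    have iQ: "integrable M Q" unfolding Q_def using control_cost_integrable(1)[OF \<alpha>\<beta>] by simp
    have fv: "AE \<omega> in M. \<forall>k\<in>{..<N}. \<forall>s. real k / N \<le> s \<and> s < real (Suc k) / N \<longrightarrow>
        \<beta> s \<omega> = - du (real k / N) (state (\<alpha> \<beta>) (real k / N) \<omega>)"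
      unfolding \<beta>_def by (rule AE_finite_allI) (use feedback_value[OF \<alpha>] in auto)
    have "AE \<omega> in M. (\<Sum>k<N. \<bar>main_term (\<alpha> \<beta>) \<beta> (real k / N) (real (Suc k) / N) \<omega>\<bar>
       + 7 * K * (real m)\<^sup>2 * (discount (\<lambda>r. \<beta> r \<omega>) (real (Suc k) / N)
           * (norm (LINT r:{real k / N..real (Suc k) / N}|lborel. \<alpha> \<beta> r \<omega>))\<^sup>2)) \<le> Q \<omega>"
      using control_square_integrable[OF \<alpha>\<beta>] control_square_integrable[OF \<beta>(1)] fv
    proof eventually_elim
      case (elim \<omega>)
      define a where "a = cost (\<lambda>s. \<alpha> \<beta> s \<omega>)"
      \<comment> \<open>Time plus cost of \<alpha>, increasing along the grid: each step costs at
        most c l^2 times its increment.\<close>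
      define g where "g k = real k / real N + a (real k / real N)" for k
      have sa: "square_integrable (\<lambda>s. \<alpha> \<beta> s \<omega>)" and sb: "square_integrable (\<lambda>s. \<beta> s \<omega>)" using elim by auto
      have "\<bar>main_term (\<alpha> \<beta>) \<beta> (real k / N) (real (Suc k) / N) \<omega>\<bar>
         + 7 * K * (real m)\<^sup>2 * (discount (\<lambda>r. \<beta> r \<omega>) (real (Suc k) / N)
           * (norm (LINT r:{real k / N..real (Suc k) / N}|lborel. \<alpha> \<beta> r \<omega>))\<^sup>2) \<le> c * l\<^sup>2 * (g (Suc k) - g k)"
        if k: "k < N" for k
      proof -
        let ?s = "real k / real N" and ?t = "real (Suc k) / real N"
        note st = grid_bounds[OF k]
        have h: "?t - ?s = l ^ 4" unfolding Nl[symmetric] by (simp add: add_divide_distrib)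
        have g: "g (Suc k) - g k = (?t - ?s) + (a ?t - a ?s)" unfolding g_def by simp
        have 1: "\<bar>main_term (\<alpha> \<beta>) \<beta> ?s ?t \<omega>\<bar> \<le> (K ^ 3 + K ^ 5) * l\<^sup>2 * (g (Suc k) - g k)"
          unfolding g a_def using elim(3) k
          by (intro main_term_feedback[where \<alpha>="\<alpha> \<beta>" and \<beta>=\<beta> and \<omega>=\<omega>, OF st(1-3) l(1,2) h sa sb]) auto
        have "discount (\<lambda>r. \<beta> r \<omega>) ?t * (norm (LINT r:{?s..?t}|lborel. \<alpha> \<beta> r \<omega>))\<^sup>2 \<le> 1 * (l ^ 4 * (a ?t - a ?s))"
          using norm_set_integral_power2_le(3)[OF sa st(1) less_imp_le[OF st(2)] st(3)] discount_le_1 discount_pos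
          unfolding a_def h by (intro mult_mono) (auto simp: less_imp_le)
        also have "\<dots> \<le> l ^ 4 * (g (Suc k) - g k)"
          unfolding g using st(2) by (simp add: mult_left_mono)
        finally have "7 * K * (real m)\<^sup>2 * (discount (\<lambda>r. \<beta> r \<omega>) ?t * (norm (LINT r:{?s..?t}|lborel. \<alpha> \<beta> r \<omega>))\<^sup>2)
           \<le> 7 * K * (real m)\<^sup>2 * (l ^ 4 * (g (Suc k) - g k))"
          using K_nonneg by (intro mult_left_mono) auto
        also have "\<dots> = 7 * K * l\<^sup>2 * (g (Suc k) - g k)"
          unfolding l(3) using l(1) by (simp add: field_simps power2_eq_square power4_eq_xxxx)
        finally show ?thesis using 1 unfolding c_def by (simp add: distrib_right)
      qed
      then have "(\<Sum>k<N. \<bar>main_term (\<alpha> \<beta>) \<beta> (real k / N) (real (Suc k) / N) \<omega>\<bar>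
       + 7 * K * (real m)\<^sup>2 * (discount (\<lambda>r. \<beta> r \<omega>) (real (Suc k) / N)
           * (norm (LINT r:{real k / N..real (Suc k) / N}|lborel. \<alpha> \<beta> r \<omega>))\<^sup>2)) \<le> (\<Sum>k<N. c * l\<^sup>2 * (g (Suc k) - g k))"
        by (intro sum_mono) auto
      also have "\<dots> = c * l\<^sup>2 * (g N - g 0)" by (simp only: sum_distrib_left[symmetric] sum_lessThan_telescope)
      also have "\<dots> \<le> c * l * (1 + a 1)"
      proof (rule mult_mono)
        show "g N - g 0 \<le> 1 + a 1" using N0 cost_nonneg unfolding g_def a_def by simp
        have "g 0 \<le> g N" unfolding g_def a_def using cost_mono[OF sa, of 0 1] N0 by simp
        then show "0 \<le> g N - g 0" by simp
      qed (use c l in \<open>auto intro: mult_left_mono\<close>)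
      finally show ?case unfolding Q_def a_def .
    qed
    from J_approximation[OF \<alpha>\<beta> \<beta>(1) m N_def iQ this]
    have "\<bar>J M W f (\<alpha> \<beta>) \<beta> - u 0 0\<bar> \<le> \<epsilon> + (\<integral>\<omega>. Q \<omega> \<partial>M) + K * (11 + 6 * CARD('n) + 6 * (CARD('n))\<^sup>2) / m" .
    also have "(\<integral>\<omega>. Q \<omega> \<partial>M) \<le> c * l * (1 + e)"
    proof -
      have "ennreal (\<integral>\<omega>. cost (\<lambda>s. \<alpha> \<beta> s \<omega>) 1 \<partial>M) \<le> B"
        unfolding control_cost_integrable(2)[OF \<alpha>\<beta>] B_def using \<beta> by (intro SUP_upper) auto
      then have "(\<integral>\<omega>. cost (\<lambda>s. \<alpha> \<beta> s \<omega>) 1 \<partial>M) \<le> e" unfolding B(1) using B(2) by simp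
      moreover have "(\<integral>\<omega>. Q \<omega> \<partial>M) = c * l * (1 + (\<integral>\<omega>. cost (\<lambda>s. \<alpha> \<beta> s \<omega>) 1 \<partial>M))"
        unfolding Q_def using control_cost_integrable(1)[OF \<alpha>\<beta>] by (simp add: prob_space)
      ultimately show ?thesis using c l by (simp add: mult_left_mono)
    qed
    finally have "\<bar>J M W f (\<alpha> \<beta>) \<beta> - u 0 0\<bar> \<le> \<epsilon> + (c * (1 + e) + K * (11 + 6 * CARD('n) + 6 * (CARD('n))\<^sup>2)) / real m"
      by (simp add: l_def add_divide_distrib)
    with \<beta>(1) show "\<exists>\<beta>\<in>controls M F. \<bar>J M W f (\<alpha> \<beta>) \<beta> - u 0 0\<bar>
        \<le> \<epsilon> + (c * (1 + e) + K * (11 + 6 * CARD('n) + 6 * (CARD('n))\<^sup>2)) / real m" by blast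
  qed
qed

end

section \<open>A strategy against every control\<close>

lemma power2_sum_le: "(x + y)\<^sup>2 \<le> 2 * (x\<^sup>2 + y\<^sup>2)" for x y :: real
  using sum_squares_bound[of x y] by (simp add: power2_sum)

context approximate_value
begin

text \<open>The strategy \<open>\<alpha> = (u / 2) (\<beta> - du)\<close> turns the running reward \<open>\<alpha> \<bullet> (\<beta> + du)\<close> into
  \<open>(u / 2) (|\<beta>|\<^sup>2 - |du|\<^sup>2)\<close>, which cancels against the discount and the Ito correction
  whatever \<open>\<beta>\<close> is.\<close>
primrec response :: "nat \<Rightarrow> (real \<Rightarrow> 'w \<Rightarrow> real ^ 'n) \<Rightarrow> nat \<Rightarrow> real \<Rightarrow> 'w \<Rightarrow> real ^ 'n" where
  "response N \<beta> 0 = (\<lambda>_ _. 0)"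
| "response N \<beta> (Suc k) = (\<lambda>s \<omega>. if real k / N \<le> s \<and> s < real (Suc k) / N
     then (u (real k / N) (state (response N \<beta> k) (real k / N) \<omega>) / 2) *\<^sub>R
       (\<beta> s \<omega> - du (real k / N) (state (response N \<beta> k) (real k / N) \<omega>))
     else response N \<beta> k s \<omega>)"

text \<open>From |\<alpha>| \<le> (K / 2) (|\<beta>| + K) on the current interval. The bound
  involves neither \<open>k\<close> nor \<open>N\<close> and is linear in |\<beta>|^2, which yields
  the energy condition of \<open>strategies\<close>.\<close>

lemma response_control:
  assumes \<beta>: "\<beta> \<in> controls M F" and "k \<le> N"
  shows "response N \<beta> k \<in> controls M F
    \<and> energy M (response N \<beta> k) \<le> ennreal (K\<^sup>2) * energy M \<beta> + ennreal (K ^ 4)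
    \<and> (\<forall>s \<omega>. (norm (response N \<beta> k s \<omega>))\<^sup>2 \<le> K\<^sup>2 * (norm (\<beta> s \<omega>))\<^sup>2 + K ^ 4)"
  using assms(2)
proof (induction k)
  case 0
  then show ?case using zero_control[where 'm='n] K_nonneg by simp
next
  case (Suc k)
  let ?t = "real k / real N"
  from Suc have IH: "response N \<beta> k \<in> controls M F"
      "\<And>s \<omega>. (norm (response N \<beta> k s \<omega>))\<^sup>2 \<le> K\<^sup>2 * (norm (\<beta> s \<omega>))\<^sup>2 + K ^ 4"
    and k: "k < N" by auto
  note t = grid_bounds[OF k]
  define x where "x = state (response N \<beta> k) ?t"
  have st: "x \<in> borel_measurable (F ?t)"
    unfolding x_def using state_measurable[OF IH(1)] t by auto
  have m: "(\<lambda>\<omega>. u ?t (x \<omega>) / 2) \<in> borel_measurable (F ?t)"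
    "(\<lambda>\<omega>. - ((u ?t (x \<omega>) / 2) *\<^sub>R du ?t (x \<omega>))) \<in> borel_measurable (F ?t)"
    using measurable_compose[OF st du_measurable[OF t(1,4)]] measurable_compose[OF st u_measurable[OF t(1,4)]]
    by auto
  have "progressively_measurable F (\<lambda>s \<omega>. if ?t \<le> s \<and> s < real (Suc k) / real N
     then (u ?t (x \<omega>) / 2) *\<^sub>R \<beta> s \<omega> + - ((u ?t (x \<omega>) / 2) *\<^sub>R du ?t (x \<omega>)) else response N \<beta> k s \<omega>)"
    using IH(1) \<beta> t m by (intro progressively_measurable_piecewise) (auto simp: controls_def)
  then have prog: "progressively_measurable F (response N \<beta> (Suc k))"
    by (simp add: x_def scaleR_diff_right cong: if_cong)
  have bd: "(norm (response N \<beta> (Suc k) s \<omega>))\<^sup>2 \<le> K\<^sup>2 * (norm (\<beta> s \<omega>))\<^sup>2 + K ^ 4" for s \<omega>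
  proof (cases "?t \<le> s \<and> s < real (Suc k) / real N")
    case True
    have "norm ((u ?t (x \<omega>) / 2) *\<^sub>R (\<beta> s \<omega> - du ?t (x \<omega>))) \<le> (K / 2) * (norm (\<beta> s \<omega>) + K)"
      using u_bound[OF t(1,4), of "x \<omega>"] du_bound[OF t(1,4), of "x \<omega>"] K_nonneg
        norm_triangle_ineq4[of "\<beta> s \<omega>" "du ?t (x \<omega>)"]
      unfolding norm_scaleR by (intro mult_mono) auto
    then have "(norm ((u ?t (x \<omega>) / 2) *\<^sub>R (\<beta> s \<omega> - du ?t (x \<omega>))))\<^sup>2 \<le> ((K / 2) * (norm (\<beta> s \<omega>) + K))\<^sup>2"
      by (intro power_mono) auto
    also have "\<dots> = (K\<^sup>2 / 4) * (norm (\<beta> s \<omega>) + K)\<^sup>2" by (simp add: power_mult_distrib power_divide)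
    also have "\<dots> \<le> (K\<^sup>2 / 4) * (4 * ((norm (\<beta> s \<omega>))\<^sup>2 + K\<^sup>2))"
    proof (rule mult_left_mono)
      have "2 * ((norm (\<beta> s \<omega>))\<^sup>2 + K\<^sup>2) \<le> 4 * ((norm (\<beta> s \<omega>))\<^sup>2 + K\<^sup>2)"
        by (intro mult_right_mono) auto
      with power2_sum_le show "(norm (\<beta> s \<omega>) + K)\<^sup>2 \<le> 4 * ((norm (\<beta> s \<omega>))\<^sup>2 + K\<^sup>2)"
        by (rule order_trans)
    qed simp
    also have "\<dots> = K\<^sup>2 * (norm (\<beta> s \<omega>))\<^sup>2 + K ^ 4" by (simp add: algebra_simps flip: power_add)
    finally show ?thesis using True by (simp add: x_def)
  next
    case False
    then have "response N \<beta> (Suc k) s \<omega> = response N \<beta> k s \<omega>" by auto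
    then show ?thesis using IH(2) by simp
  qed
  have en: "energy M (response N \<beta> (Suc k)) \<le> ennreal (K\<^sup>2) * energy M \<beta> + ennreal (K ^ 4)"
    by (rule energy_le[OF \<beta> _ _ bd]) (use K_nonneg in auto)
  have "energy M \<beta> < \<infinity>" using \<beta> by (simp add: controls_def)
  then have "ennreal (K\<^sup>2) * energy M \<beta> + ennreal (K ^ 4) < \<infinity>"
    by (simp add: ennreal_mult_less_top)
  then have "energy M (response N \<beta> (Suc k)) < \<infinity>" using en le_less_trans by blast
  with prog en bd show ?case by (simp only: controls_def mem_Collect_eq) blast
qed

lemma response_eq:
  assumes "j \<le> k" "s < real j / real N"
  shows "response N \<beta> k s \<omega> = response N \<beta> j s \<omega>"
  using assms(1)
proof (induction k rule: dec_induct)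
  case (step k)
  have "real j / real N \<le> real k / real N" using step by (intro divide_right_mono) auto
  then show ?case using step assms(2) by simp
qed simp

text \<open>Holds on every path, in contrast to \<open>feedback_agree\<close>, because the strategy
  is given by an explicit formula.\<close>

lemma response_state:
  assumes "k \<le> N"
  shows "state (response N \<beta> N) (real k / N) \<omega> = state (response N \<beta> k) (real k / N) \<omega>"
  unfolding state_def
  by (intro arg_cong2[where f="(+)"] refl set_integral_cong_half_open response_eq assms)

lemma response_value:
  assumes k: "k < N" and s: "real k / N \<le> s" "s < real (Suc k) / N"
  shows "response N \<beta> N s \<omega> = (u (real k / N) (state (response N \<beta> N) (real k / N) \<omega>) / 2) *\<^sub>R
       (\<beta> s \<omega> - du (real k / N) (state (response N \<beta> N) (real k / N) \<omega>))"
proof -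
  have "response N \<beta> N s \<omega> = response N \<beta> (Suc k) s \<omega>" using k s by (intro response_eq) auto
  then show ?thesis using s k response_state[of k N \<beta> \<omega>] by simp
qed

text \<open>Induction over the intervals along one path outside a fixed null set: agreement up to a
  grid point gives equal states there and hence equal coefficients on the next interval. An interval
  starting after \<open>t\<close> changes nothing.\<close>

lemma response_agree:
  assumes \<beta>: "\<beta> \<in> controls M F" "\<beta>' \<in> controls M F" and t: "0 \<le> t" "t \<le> 1"
    and agree: "agree_upto M t \<beta> \<beta>'"
  shows "agree_upto M t (response N \<beta> N) (response N \<beta>' N)"
proof -
  have c: "response N \<beta> k \<in> controls M F" "response N \<beta>' k \<in> controls M F" if "k \<le> N" for k
    using response_control \<beta> that by auto
  have sq: "AE \<omega> in M. \<forall>k\<in>{..N}. square_integrable (\<lambda>s. response N \<beta> k s \<omega>)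
      \<and> square_integrable (\<lambda>s. response N \<beta>' k s \<omega>)"
  proof (rule AE_finite_allI)
    fix k assume "k \<in> {..N}"
    then have k: "k \<le> N" by simp
    show "AE \<omega> in M. square_integrable (\<lambda>s. response N \<beta> k s \<omega>) \<and> square_integrable (\<lambda>s. response N \<beta>' k s \<omega>)"
      using control_square_integrable[OF c(1)[OF k]] control_square_integrable[OF c(2)[OF k]]
      by eventually_elim simp
  qed simp
  have "AE \<omega> in M. AE s in lborel. 0 \<le> s \<and> s \<le> t \<longrightarrow> response N \<beta> N s \<omega> = response N \<beta>' N s \<omega>"
    using agree[unfolded agree_upto_iff[OF \<beta> t]] sq
  proof eventually_elim
    case (elim \<omega>)
    have "AE s in lborel. 0 \<le> s \<and> s \<le> t \<longrightarrow> response N \<beta> k s \<omega> = response N \<beta>' k s \<omega>" if "k \<le> N" for k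
      using that
    proof (induction k)
      case (Suc k)
      let ?t = "real k / real N"
      from Suc have k: "k < N" and IH: "AE s in lborel. 0 \<le> s \<and> s \<le> t \<longrightarrow> response N \<beta> k s \<omega> = response N \<beta>' k s \<omega>"
        by auto
      show ?case
      proof (cases "?t \<le> t")
        case True
        have "set_borel_measurable lborel {0..?t} (\<lambda>s. response N \<beta> k s \<omega>)"
          "set_borel_measurable lborel {0..?t} (\<lambda>s. response N \<beta>' k s \<omega>)"
          using elim(2) k True t by (auto intro!: square_integrable_meas)
        then have "(LINT s:{0..?t}|lborel. response N \<beta> k s \<omega>) = (LINT s:{0..?t}|lborel. response N \<beta>' k s \<omega>)"
          unfolding set_lebesgue_integral_def set_borel_measurable_def
          by (rule integral_cong_AE)
             (use IH in \<open>eventually_elim, use True in \<open>auto split: split_indicator\<close>\<close>)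
        then have st: "state (response N \<beta> k) ?t \<omega> = state (response N \<beta>' k) ?t \<omega>" by (simp add: state_def)
        show ?thesis using IH elim(1) by eventually_elim (auto simp: st)
      next
        case False
        show ?thesis using IH by eventually_elim (use False in auto)
      qed
    qed simp
    then show ?case by simp
  qed
  then show ?thesis unfolding agree_upto_iff[OF c(1)[OF order_refl] c(2)[OF order_refl] t] .
qed

lemma response_strategy: "(\<lambda>\<beta>. response N \<beta> N) \<in> strategies M F"
proof -
  have "elliott_kalton_strategy M F (\<lambda>\<beta>. response N \<beta> N)"
    unfolding elliott_kalton_strategy_def using response_control response_agree by auto
  moreover have "(SUP \<beta>\<in>{\<beta>\<in>controls M F. energy M \<beta> \<le> R}. energy M (response N \<beta> N)) < \<infinity>"
    if R: "R < \<infinity>" for R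
  proof -
    have "(SUP \<beta>\<in>{\<beta>\<in>controls M F. energy M \<beta> \<le> R}. energy M (response N \<beta> N)) \<le> ennreal (K\<^sup>2) * R + ennreal (K ^ 4)"
    proof (rule SUP_least)
      fix \<beta> :: "real \<Rightarrow> 'w \<Rightarrow> real ^ 'n"
      assume "\<beta> \<in> {\<beta>\<in>controls M F. energy M \<beta> \<le> R}"
      then have \<beta>: "\<beta> \<in> controls M F" "energy M \<beta> \<le> R" by auto
      have "energy M (response N \<beta> N) \<le> ennreal (K\<^sup>2) * energy M \<beta> + ennreal (K ^ 4)"
        using response_control[OF \<beta>(1)] by blast
      also have "\<dots> \<le> ennreal (K\<^sup>2) * R + ennreal (K ^ 4)"
        using \<beta>(2) by (intro add_right_mono mult_left_mono) auto
      finally show "energy M (response N \<beta> N) \<le> ennreal (K\<^sup>2) * R + ennreal (K ^ 4)" .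
    qed
    also have "\<dots> < \<infinity>" using R by (simp add: ennreal_mult_less_top)
    finally show ?thesis .
  qed
  ultimately show ?thesis unfolding strategies_def by blast
qed

text \<open>By \<open>discount_cost_integral\<close> the part (u / 2) |\<beta>|^2 of the reward
  cancels the change of the discount exactly. What is left carries a difference of discounts, so the
  bounds involve \<beta> only through \<open>Z s - Z t\<close>, which sums to at most 1 for any
  energy.\<close>

lemma main_term_response:
  assumes st: "0 \<le> s" "s < t" "t \<le> 1" and l: "0 < l" "l \<le> 1" "t - s = l ^ 4"
    and b: "square_integrable (\<lambda>r. \<beta> r \<omega>)"
    and rv: "\<And>r. s \<le> r \<Longrightarrow> r < t \<Longrightarrow> \<alpha> r \<omega> = (u s (state \<alpha> s \<omega>) / 2) *\<^sub>R (\<beta> r \<omega> - du s (state \<alpha> s \<omega>))"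
  defines "Z \<equiv> discount (\<lambda>r. \<beta> r \<omega>)"
  shows "\<bar>main_term \<alpha> \<beta> s t \<omega>\<bar> \<le> (K\<^sup>2 + K ^ 3) * l\<^sup>2 * (Z s - Z t)"
    and "Z t * (norm (LINT r:{s..t}|lborel. \<alpha> r \<omega>))\<^sup>2 \<le> K\<^sup>2 * l ^ 4 * (Z s - Z t) + K ^ 4 * l ^ 8"
proof -
  define U where "U = u s (state \<alpha> s \<omega>)"
  define D where "D = du s (state \<alpha> s \<omega>)"
  define h where "h = t - s"
  define cb where "cb = cost (\<lambda>r. \<beta> r \<omega>) t - cost (\<lambda>r. \<beta> r \<omega>) s"
  define B where "B = (LINT r:{s..t}|lborel. \<beta> r \<omega>)"
  have s1: "s \<le> 1" "s \<le> t" using st by auto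
  have h: "0 < h" "h = l ^ 4" using st l by (auto simp: h_def)
  have U: "\<bar>U\<bar> \<le> K" and D: "norm D \<le> K" unfolding U_def D_def using u_bound du_bound st(1) s1 by auto
  have K0: "0 \<le> K" by (rule K_nonneg)
  have Zb: "0 < Z r" "Z r \<le> 1" for r unfolding Z_def using discount_pos discount_le_1 by auto
  have Zm: "Z t \<le> Z r" "Z r \<le> Z s" if "s \<le> r" "r \<le> t" for r
    unfolding Z_def using discount_mono[OF b] that st by auto
  have dZ: "0 \<le> Z s - Z t" using Zm[of s] st by simp
  note ib = square_integrable_integrable[OF b st(1,3)]
  have ibD: "set_integrable lborel {s..t} (\<lambda>r. \<beta> r \<omega> \<bullet> D)"
    using ib(1) unfolding set_integrable_def by (simp add: integrable_inner_left flip: inner_scaleR_left)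
  have bD: "(LINT r:{s..t}|lborel. \<beta> r \<omega> \<bullet> D) = B \<bullet> D"
    using integral_inner_left[OF ib(1)[unfolded set_integrable_def], of D]
    unfolding B_def set_lebesgue_integral_def by simp
  have iZD: "set_integrable lborel {s..t} (\<lambda>r. Z r * (\<beta> r \<omega> \<bullet> D))"
    using discount_integrable[OF b ibD st(1,3)] unfolding Z_def by simp
  have iZb: "set_integrable lborel {s..t} (\<lambda>r. Z r * (norm (\<beta> r \<omega>))\<^sup>2)"
    using discount_integrable[OF b square_integrable_sq[OF b st(1,3)] st(1,3)] unfolding Z_def by simp
  have chain: "(LINT r:{s..t}|lborel. Z r * (norm (\<beta> r \<omega>))\<^sup>2) = 2 * (Z s - Z t)"
    unfolding Z_def by (rule discount_cost_integral[OF b st(1) s1(2) st(3)])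
  have const: "(LINT r:{s..t}|lborel. c) = h * c" for c :: real
    using st by (simp add: set_lebesgue_integral_def h_def)
  have A: "(LINT r:{s..t}|lborel. \<alpha> r \<omega>) = (U / 2) *\<^sub>R (B - h *\<^sub>R D)"
  proof -
    have iD: "set_integrable lborel {s..t} (\<lambda>_. D)" by (rule borel_integrable_atLeastAtMost') simp
    have "(LINT r:{s..t}|lborel. \<alpha> r \<omega>) = (LINT r:{s..t}|lborel. (U / 2) *\<^sub>R (\<beta> r \<omega> - D))"
      by (rule set_integral_cong_half_open) (use rv in \<open>auto simp: U_def D_def\<close>)
    also have "\<dots> = (U / 2) *\<^sub>R (LINT r:{s..t}|lborel. \<beta> r \<omega> - D)"
      by (rule set_integral_scaleR_right)
    also have "(LINT r:{s..t}|lborel. \<beta> r \<omega> - D) = B - h *\<^sub>R D"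
      unfolding B_def using st set_integral_diff(2)[OF ib(1) iD]
      by (simp add: set_lebesgue_integral_def h_def)
    finally show ?thesis .
  qed
  have P: "(LINT r:{s..t}|lborel. Z r * (\<alpha> r \<omega> \<bullet> \<beta> r \<omega>)) = U * (Z s - Z t) - (U / 2) * (LINT r:{s..t}|lborel. Z r * (\<beta> r \<omega> \<bullet> D))"
  proof -
    have "(LINT r:{s..t}|lborel. Z r * (\<alpha> r \<omega> \<bullet> \<beta> r \<omega>))
      = (LINT r:{s..t}|lborel. (U / 2) * (Z r * (norm (\<beta> r \<omega>))\<^sup>2) - (U / 2) * (Z r * (\<beta> r \<omega> \<bullet> D)))"
    proof (rule set_integral_cong_half_open)
      fix r assume "s \<le> r" "r < t"
      then have e: "\<alpha> r \<omega> = (U / 2) *\<^sub>R (\<beta> r \<omega> - D)" using rv by (simp add: U_def D_def)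
      show "Z r * (\<alpha> r \<omega> \<bullet> \<beta> r \<omega>) = (U / 2) * (Z r * (norm (\<beta> r \<omega>))\<^sup>2) - (U / 2) * (Z r * (\<beta> r \<omega> \<bullet> D))"
        unfolding e by (simp add: inner_diff_left power2_norm_eq_inner inner_commute algebra_simps)
    qed
    also have "\<dots> = (U / 2) * (LINT r:{s..t}|lborel. Z r * (norm (\<beta> r \<omega>))\<^sup>2) - (U / 2) * (LINT r:{s..t}|lborel. Z r * (\<beta> r \<omega> \<bullet> D))"
      using iZb iZD by (subst set_integral_diff) auto
    finally show ?thesis unfolding chain by simp
  qed
  define E where "E = (LINT r:{s..t}|lborel. (Z r - Z t) * (\<beta> r \<omega> \<bullet> D))"
  have E: "E = (LINT r:{s..t}|lborel. Z r * (\<beta> r \<omega> \<bullet> D)) - Z t * (B \<bullet> D)"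
  proof -
    have "E = (LINT r:{s..t}|lborel. Z r * (\<beta> r \<omega> \<bullet> D) - Z t * (\<beta> r \<omega> \<bullet> D))"
      unfolding E_def by (simp add: left_diff_distrib)
    also have "\<dots> = (LINT r:{s..t}|lborel. Z r * (\<beta> r \<omega> \<bullet> D)) - Z t * (LINT r:{s..t}|lborel. \<beta> r \<omega> \<bullet> D)"
      using ibD iZD by (subst set_integral_diff) auto
    finally show ?thesis unfolding bD .
  qed
  have E_le: "\<bar>E\<bar> \<le> K * ((3/2) * l\<^sup>2 * (Z s - Z t))"
  proof -
    \<comment> \<open>Young's inequality n \<le> l^2 n^2 / 2 + 1 / (2 l^2); \<open>q\<close> is the
      constant part times Z s - Z t. On an interval of length l^4 both parts integrate to order l^2
      (Z s - Z t).\<close>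
    define q where "q = (Z s - Z t) / (2 * l\<^sup>2)"
    have iq: "set_integrable lborel {s..t} (\<lambda>r. (l\<^sup>2 / 2) * (Z r * (norm (\<beta> r \<omega>))\<^sup>2) + q)"
      using iZb by (intro set_integral_add set_integrable_const_Icc) simp
    have "\<bar>E\<bar> \<le> (LINT r:{s..t}|lborel. K * ((l\<^sup>2 / 2) * (Z r * (norm (\<beta> r \<omega>))\<^sup>2) + q))"
      unfolding E_def set_lebesgue_integral_def real_norm_def[symmetric]
    proof (rule norm_integral_le)
      have "set_integrable lborel {s..t} (\<lambda>r. Z r * (\<beta> r \<omega> \<bullet> D) - Z t * (\<beta> r \<omega> \<bullet> D))"
        using ibD iZD by (intro set_integral_diff) auto
      then show "integrable lborel (\<lambda>r. indicator {s..t} r *\<^sub>R ((Z r - Z t) * (\<beta> r \<omega> \<bullet> D)))"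
        unfolding set_integrable_def by (simp add: left_diff_distrib)
      show "integrable lborel (\<lambda>r. indicator {s..t} r *\<^sub>R (K * ((l\<^sup>2 / 2) * (Z r * (norm (\<beta> r \<omega>))\<^sup>2) + q)))"
        using set_integrable_mult_right[of K, OF iq] unfolding set_integrable_def .
      fix r
      show "norm (indicator {s..t} r *\<^sub>R ((Z r - Z t) * (\<beta> r \<omega> \<bullet> D)))
          \<le> indicator {s..t} r *\<^sub>R (K * ((l\<^sup>2 / 2) * (Z r * (norm (\<beta> r \<omega>))\<^sup>2) + q))"
      proof (cases "r \<in> {s..t}")
        case True
        then have z: "0 \<le> Z r - Z t" "Z r - Z t \<le> Z s - Z t" "Z r - Z t \<le> Z r"
          using Zm[of r] Zb[of t] by auto
        define n where "n = norm (\<beta> r \<omega>)"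
        have young: "n \<le> l\<^sup>2 / 2 * n\<^sup>2 + 1 / (2 * l\<^sup>2)"
        proof -
          have "0 \<le> (l\<^sup>2 * n - 1)\<^sup>2 / (2 * l\<^sup>2)" using l by simp
          also have "\<dots> = l\<^sup>2 / 2 * n\<^sup>2 + 1 / (2 * l\<^sup>2) - n"
            using l by (simp add: power2_eq_square field_simps)
          finally show ?thesis by simp
        qed
        have "\<bar>(Z r - Z t) * (\<beta> r \<omega> \<bullet> D)\<bar> \<le> (Z r - Z t) * (n * K)"
        proof -
          have "\<bar>\<beta> r \<omega> \<bullet> D\<bar> \<le> n * K"
            using Cauchy_Schwarz_ineq2[of "\<beta> r \<omega>" D] D unfolding n_def
            by (meson mult_left_mono norm_ge_zero order_trans)
          then show ?thesis using z by (simp add: abs_mult mult_left_mono)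
        qed
        also have "\<dots> = K * ((Z r - Z t) * n)" by simp
        also have "\<dots> \<le> K * ((l\<^sup>2 / 2) * (Z r * n\<^sup>2) + q)"
        proof (rule mult_left_mono[OF _ K0])
          have "(Z r - Z t) * n \<le> (Z r - Z t) * (l\<^sup>2 / 2 * n\<^sup>2 + 1 / (2 * l\<^sup>2))"
            using young z by (intro mult_left_mono) auto
          also have "\<dots> = (Z r - Z t) * (l\<^sup>2 / 2 * n\<^sup>2) + (Z r - Z t) * (1 / (2 * l\<^sup>2))"
            by (rule distrib_left)
          also have "\<dots> \<le> Z r * (l\<^sup>2 / 2 * n\<^sup>2) + (Z s - Z t) * (1 / (2 * l\<^sup>2))"
            using z by (intro add_mono mult_right_mono) auto
          finally show "(Z r - Z t) * n \<le> (l\<^sup>2 / 2) * (Z r * n\<^sup>2) + q" by (simp add: q_def mult_ac)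
        qed
        finally show ?thesis using True by (simp add: n_def)
      qed simp
    qed
    also have "\<dots> = K * ((l\<^sup>2 / 2) * (2 * (Z s - Z t)) + h * q)"
    proof -
      have "(LINT r:{s..t}|lborel. (l\<^sup>2 / 2) * (Z r * (norm (\<beta> r \<omega>))\<^sup>2) + q) = (l\<^sup>2 / 2) * (2 * (Z s - Z t)) + h * q"
        using iZb set_integral_add(2)[of lborel "{s..t}" "\<lambda>r. (l\<^sup>2 / 2) * (Z r * (norm (\<beta> r \<omega>))\<^sup>2)" "\<lambda>_. q"]
        by (simp only: set_integrable_mult_right set_integrable_const_Icc set_integral_mult_right chain const)
      then show ?thesis by (simp only: set_integral_mult_right)
    qed
    also have "\<dots> = K * ((3/2) * l\<^sup>2 * (Z s - Z t))"
      unfolding q_def h(2) using l by (simp add: field_simps power2_eq_square power4_eq_xxxx)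
    finally show ?thesis .
  qed
  have main: "main_term \<alpha> \<beta> s t \<omega> = - (U / 2) * E + (Z s - Z t) * (h / 2) * (U * (norm D)\<^sup>2)"
  proof -
    have "main_term \<alpha> \<beta> s t \<omega> = (U * (Z s - Z t) - (U / 2) * (LINT r:{s..t}|lborel. Z r * (\<beta> r \<omega> \<bullet> D)))
      + ((Z t - Z s) * U + Z t * (D \<bullet> ((U / 2) *\<^sub>R (B - h *\<^sub>R D))) + h / 2 * (Z s * (U * (norm D)\<^sup>2)))"
      unfolding main_term_def Let_def Z_def[symmetric] P A U_def[symmetric] D_def[symmetric] h_def[symmetric] ..
    then show ?thesis unfolding E
      by (simp add: inner_diff_right power2_norm_eq_inner inner_commute field_simps)
  qed
  have "\<bar>main_term \<alpha> \<beta> s t \<omega>\<bar> \<le> (K / 2) * (K * ((3/2) * l\<^sup>2 * (Z s - Z t))) + (Z s - Z t) * (h / 2) * (K * K\<^sup>2)"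
  proof -
    have "\<bar>- (U / 2) * E\<bar> \<le> (K / 2) * (K * ((3/2) * l\<^sup>2 * (Z s - Z t)))"
      unfolding abs_mult using U E_le K0 by (intro mult_mono) auto
    moreover have "\<bar>(Z s - Z t) * (h / 2) * (U * (norm D)\<^sup>2)\<bar> \<le> (Z s - Z t) * (h / 2) * (K * K\<^sup>2)"
    proof -
      have "\<bar>U * (norm D)\<^sup>2\<bar> \<le> K * K\<^sup>2"
        unfolding abs_mult using U D K0 by (intro mult_mono) (auto intro: power_mono)
      then show ?thesis using dZ h(1) by (simp add: abs_mult[of _ "U * (norm D)\<^sup>2"] mult_left_mono)
    qed
    ultimately show ?thesis unfolding main by linarith
  qed
  also have "\<dots> \<le> (K\<^sup>2 + K ^ 3) * l\<^sup>2 * (Z s - Z t)"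
  proof -
    have "h \<le> l\<^sup>2" unfolding h(2) using l by (intro power_decreasing) auto
    then have "h * (K ^ 3 * (Z s - Z t)) \<le> l\<^sup>2 * (K ^ 3 * (Z s - Z t))"
      using K0 dZ by (intro mult_right_mono) auto
    moreover have "0 \<le> K\<^sup>2 * (l\<^sup>2 * (Z s - Z t))" "0 \<le> h * (K ^ 3 * (Z s - Z t))" using K0 dZ h by auto
    moreover have "(K / 2) * (K * ((3/2) * l\<^sup>2 * (Z s - Z t))) + (Z s - Z t) * (h / 2) * (K * K\<^sup>2)
      = (3/4) * (K\<^sup>2 * (l\<^sup>2 * (Z s - Z t))) + (1/2) * (h * (K ^ 3 * (Z s - Z t)))"
      by (simp add: power2_eq_square power3_eq_cube field_simps)
    moreover have "(K\<^sup>2 + K ^ 3) * l\<^sup>2 * (Z s - Z t) = K\<^sup>2 * (l\<^sup>2 * (Z s - Z t)) + l\<^sup>2 * (K ^ 3 * (Z s - Z t))"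
      by (simp add: algebra_simps)
    ultimately show ?thesis by linarith
  qed
  finally show "\<bar>main_term \<alpha> \<beta> s t \<omega>\<bar> \<le> (K\<^sup>2 + K ^ 3) * l\<^sup>2 * (Z s - Z t)" .
  \<comment> \<open>The cost on a step, weighted by the final discount, is at most twice the
    decrement, from 1 + x \<le> exp x. This replaces an energy bound on \<beta>.\<close>
  have Zcb: "Z t * cb \<le> 2 * (Z s - Z t)"
  proof -
    have "Z s = Z t * exp (cb / 2)"
      unfolding Z_def discount_def cb_def by (simp add: field_simps flip: exp_add)
    moreover have "Z t * (1 + cb / 2) \<le> Z t * exp (cb / 2)"
      using exp_ge_add_one_self[of "cb / 2"] Zb[of t] by (intro mult_left_mono) auto
    ultimately show ?thesis by (simp add: algebra_simps)
  qed
  have B: "(norm B)\<^sup>2 \<le> h * cb"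
    unfolding B_def h_def cb_def by (rule norm_set_integral_power2_le(3)[OF b st(1) s1(2) st(3)])
  have "(norm (LINT r:{s..t}|lborel. \<alpha> r \<omega>))\<^sup>2 \<le> (K\<^sup>2 / 2) * ((norm B)\<^sup>2 + h\<^sup>2 * K\<^sup>2)"
  proof -
    have "norm ((U / 2) *\<^sub>R (B - h *\<^sub>R D)) \<le> (K / 2) * (norm B + h * K)"
    proof -
      have "h * norm D \<le> h * K" using D h(1) by (intro mult_left_mono) auto
      moreover have "norm (B - h *\<^sub>R D) \<le> norm B + h * norm D"
        using norm_triangle_ineq4[of B "h *\<^sub>R D"] h(1) by simp
      ultimately have "norm (B - h *\<^sub>R D) \<le> norm B + h * K" by linarith
      then show ?thesis unfolding norm_scaleR using U K0 by (intro mult_mono) auto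
    qed
    then have "(norm ((U / 2) *\<^sub>R (B - h *\<^sub>R D)))\<^sup>2 \<le> ((K / 2) * (norm B + h * K))\<^sup>2" by (intro power_mono) auto
    also have "\<dots> = (K\<^sup>2 / 4) * (norm B + h * K)\<^sup>2" by (simp add: power_mult_distrib power_divide)
    also have "\<dots> \<le> (K\<^sup>2 / 4) * (2 * ((norm B)\<^sup>2 + h\<^sup>2 * K\<^sup>2))"
      using power2_sum_le[of "norm B" "h * K"] by (intro mult_left_mono) (auto simp: power_mult_distrib)
    also have "\<dots> = (K\<^sup>2 / 2) * ((norm B)\<^sup>2 + h\<^sup>2 * K\<^sup>2)" by simp
    finally show ?thesis unfolding A .
  qed
  also have "\<dots> \<le> (K\<^sup>2 / 2) * (h * cb + h\<^sup>2 * K\<^sup>2)"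
    using B by (intro mult_left_mono add_right_mono) auto
  finally have "Z t * (norm (LINT r:{s..t}|lborel. \<alpha> r \<omega>))\<^sup>2 \<le> Z t * ((K\<^sup>2 / 2) * (h * cb + h\<^sup>2 * K\<^sup>2))"
    using Zb[of t] by (intro mult_left_mono) auto
  also have "\<dots> = (K\<^sup>2 / 2) * h * (Z t * cb) + Z t * ((K\<^sup>2 / 2) * (h\<^sup>2 * K\<^sup>2))"
    by (simp add: algebra_simps)
  also have "\<dots> \<le> (K\<^sup>2 / 2) * h * (2 * (Z s - Z t)) + 1 * ((K\<^sup>2 / 2) * (h\<^sup>2 * K\<^sup>2))"
    using Zcb Zb[of t] h(1) by (intro add_mono mult_left_mono mult_right_mono) auto
  also have "\<dots> \<le> K\<^sup>2 * l ^ 4 * (Z s - Z t) + K ^ 4 * l ^ 8"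
  proof -
    have "(K\<^sup>2 / 2) * (h\<^sup>2 * K\<^sup>2) = K ^ 4 * l ^ 8 / 2" unfolding h(2) by (simp flip: power_mult power_add)
    moreover have "0 \<le> K ^ 4 * l ^ 8" by simp
    moreover have "(K\<^sup>2 / 2) * h * (2 * (Z s - Z t)) = K\<^sup>2 * l ^ 4 * (Z s - Z t)"
      unfolding h(2) by (simp add: right_diff_distrib)
    ultimately show ?thesis by linarith
  qed
  finally show "Z t * (norm (LINT r:{s..t}|lborel. \<alpha> r \<omega>))\<^sup>2 \<le> K\<^sup>2 * l ^ 4 * (Z s - Z t) + K ^ 4 * l ^ 8" .
qed

text \<open>One strategy per grid serves all controls: \<open>C\<close> involves only
  \<open>K\<close> and the dimension.\<close>

lemma response_payoff:
  obtains C where "\<And>m. 1 \<le> m \<Longrightarrow> \<exists>\<alpha>\<in>strategies M F. \<forall>\<beta>\<in>controls M F.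
    \<bar>J M W f (\<alpha> \<beta>) \<beta> - u 0 0\<bar> \<le> \<epsilon> + C / real m"
proof -
  \<comment> \<open>K^2 + K^3 comes from the main term; 7 K^3 and 7 K^5 are 7 K times the two parts
    of the bound on the squared displacement.\<close>
  define c where "c = K\<^sup>2 + K ^ 3 + 7 * K ^ 3 + 7 * K ^ 5"
  have c: "0 \<le> c" using K_nonneg unfolding c_def by simp
  define C where "C = c + K * (11 + 6 * CARD('n) + 6 * (CARD('n))\<^sup>2)"
  show ?thesis
  proof (rule that)
    fix m :: nat assume m: "1 \<le> m"
    define N where "N = m ^ 4"
    define l where "l = 1 / real m"
    have l: "0 < l" "l \<le> 1" "real m = 1 / l" "l\<^sup>2 \<le> l"
      using m unfolding l_def by (auto simp: power2_eq_square divide_le_eq)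
    have Nl: "1 / real N = l ^ 4" "real N * l ^ 4 = 1"
      using m unfolding N_def l_def by (auto simp: power_one_over)
    have "\<bar>J M W f (response N \<beta> N) \<beta> - u 0 0\<bar> \<le> \<epsilon> + C / real m" if \<beta>: "\<beta> \<in> controls M F" for \<beta>
    proof -
      define \<alpha> where "\<alpha> = response N \<beta> N"
      have \<alpha>: "\<alpha> \<in> controls M F" using response_control[OF \<beta>] unfolding \<alpha>_def by auto
      have "AE \<omega> in M. (\<Sum>k<N. \<bar>main_term \<alpha> \<beta> (real k / N) (real (Suc k) / N) \<omega>\<bar>
       + 7 * K * (real m)\<^sup>2 * (discount (\<lambda>r. \<beta> r \<omega>) (real (Suc k) / N)
           * (norm (LINT r:{real k / N..real (Suc k) / N}|lborel. \<alpha> r \<omega>))\<^sup>2)) \<le> c * l"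
        using control_square_integrable[OF \<beta>]
      proof eventually_elim
        case (elim \<omega>)
        define g where "g k = discount (\<lambda>r. \<beta> r \<omega>) (real k / real N)" for k
        have sb: "square_integrable (\<lambda>s. \<beta> s \<omega>)" using elim by auto
        have "\<bar>main_term \<alpha> \<beta> (real k / N) (real (Suc k) / N) \<omega>\<bar>
           + 7 * K * (real m)\<^sup>2 * (discount (\<lambda>r. \<beta> r \<omega>) (real (Suc k) / N)
             * (norm (LINT r:{real k / N..real (Suc k) / N}|lborel. \<alpha> r \<omega>))\<^sup>2)
           \<le> (K\<^sup>2 + K ^ 3 + 7 * K ^ 3) * l\<^sup>2 * (g k - g (Suc k)) + 7 * K ^ 5 * l ^ 6"
          if k: "k < N" for k
        proof -
          let ?s = "real k / real N" and ?t = "real (Suc k) / real N"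
          note st = grid_bounds[OF k]
          have h: "?t - ?s = l ^ 4" unfolding Nl(1)[symmetric] by (simp add: add_divide_distrib)
          note mtr = main_term_response[where \<alpha>=\<alpha> and \<beta>=\<beta> and \<omega>=\<omega>, OF st(1-3) l(1,2) h sb
              response_value[OF k, of _ \<beta> \<omega>, folded \<alpha>_def], folded g_def]
          have "7 * K * (real m)\<^sup>2 * (discount (\<lambda>r. \<beta> r \<omega>) ?t * (norm (LINT r:{?s..?t}|lborel. \<alpha> r \<omega>))\<^sup>2)
            \<le> 7 * K * (real m)\<^sup>2 * (K\<^sup>2 * l ^ 4 * (g k - g (Suc k)) + K ^ 4 * l ^ 8)"
            using mtr(2) K_nonneg unfolding g_def by (intro mult_left_mono) auto
          also have "\<dots> = 7 * K ^ 3 * l\<^sup>2 * (g k - g (Suc k)) + 7 * K ^ 5 * l ^ 6"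
            unfolding l(3) using l(1) by (simp add: field_simps eval_nat_numeral)
          finally show ?thesis using mtr(1) by (simp add: distrib_right)
        qed
        then have "(\<Sum>k<N. \<bar>main_term \<alpha> \<beta> (real k / N) (real (Suc k) / N) \<omega>\<bar>
           + 7 * K * (real m)\<^sup>2 * (discount (\<lambda>r. \<beta> r \<omega>) (real (Suc k) / N)
             * (norm (LINT r:{real k / N..real (Suc k) / N}|lborel. \<alpha> r \<omega>))\<^sup>2))
           \<le> (\<Sum>k<N. (K\<^sup>2 + K ^ 3 + 7 * K ^ 3) * l\<^sup>2 * (g k - g (Suc k)) + 7 * K ^ 5 * l ^ 6)"
          by (intro sum_mono) auto
        also have "\<dots> = (K\<^sup>2 + K ^ 3 + 7 * K ^ 3) * l\<^sup>2 * (g 0 - g N) + real N * (7 * K ^ 5 * l ^ 6)"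
          by (simp only: sum.distrib sum_distrib_left[symmetric] sum_lessThan_telescope' sum_constant card_lessThan)
            (simp add: mult_ac)
        also have "\<dots> \<le> (K\<^sup>2 + K ^ 3 + 7 * K ^ 3) * l\<^sup>2 * 1 + (real N * l ^ 4) * (7 * K ^ 5 * l\<^sup>2)"
        proof (rule add_mono)
          show "(K\<^sup>2 + K ^ 3 + 7 * K ^ 3) * l\<^sup>2 * (g 0 - g N) \<le> (K\<^sup>2 + K ^ 3 + 7 * K ^ 3) * l\<^sup>2 * 1"
          proof (rule mult_left_mono)
            show "g 0 - g N \<le> 1"
              using discount_le_1[of "\<lambda>r. \<beta> r \<omega>" "real 0 / real N"] discount_pos[of "\<lambda>r. \<beta> r \<omega>" "real N / real N"]
              unfolding g_def by linarith
          qed (use K_nonneg in simp)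
          show "real N * (7 * K ^ 5 * l ^ 6) \<le> (real N * l ^ 4) * (7 * K ^ 5 * l\<^sup>2)"
          proof -
            have e: "l ^ 6 = l ^ 4 * l\<^sup>2" by (simp flip: power_add)
            show ?thesis unfolding e by (simp only: mult_ac order_refl)
          qed
        qed
        also have "\<dots> = c * l\<^sup>2" unfolding Nl(2) c_def by (simp add: algebra_simps)
        also have "\<dots> \<le> c * l" using c l by (intro mult_left_mono) auto
        finally show ?case .
      qed
      from J_approximation[OF \<alpha> \<beta> m N_def _ this]
      show ?thesis unfolding \<alpha>_def[symmetric] C_def by (simp add: prob_space l_def add_divide_distrib)
    qed
    then show "\<exists>\<alpha>\<in>strategies M F. \<forall>\<beta>\<in>controls M F. \<bar>J M W f (\<alpha> \<beta>) \<beta> - u 0 0\<bar> \<le> \<epsilon> + C / real m"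
      by (intro bexI[of _ "\<lambda>\<beta>. response N \<beta> N"] ballI response_strategy)
  qed
qed

end

section \<open>The value of the game\<close>

context brownian
begin

lemma saddle_point:
  fixes f :: "real ^ 'n \<Rightarrow> real"
  assumes f: "\<And>x. \<bar>f x\<bar> \<le> c" and uc: "uniformly_continuous_on UNIV f" and "\<epsilon> > 0"
  defines "V \<equiv> inv Phi (\<integral>x. Phi (f x) \<partial>std_gaussian)"
  shows "\<alpha> \<in> strategies M F \<Longrightarrow> \<exists>\<beta>\<in>controls M F. \<bar>J M W f (\<alpha> \<beta>) \<beta> - V\<bar> \<le> \<epsilon>"
    and "\<exists>\<alpha>\<in>strategies M F. \<forall>\<beta>\<in>controls M F. \<bar>J M W f (\<alpha> \<beta>) \<beta> - V\<bar> \<le> \<epsilon>"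
proof -
  \<comment> \<open>One third each for the terminal error of the mollification, for its effect on
    the initial value, and for the grid.\<close>
  have e3: "0 < \<epsilon> / 3" using \<open>\<epsilon> > 0\<close> by simp
  have small: "\<exists>m\<ge>1. C / real m \<le> \<epsilon> / 3" for C
  proof -
    obtain m :: nat where m: "C / (\<epsilon> / 3) < real m" using reals_Archimedean2 by blast
    then have "C < real m * (\<epsilon> / 3)" using e3 by (simp add: divide_less_eq)
    also have "\<dots> \<le> real (Suc m) * (\<epsilon> / 3)" using e3 by (intro mult_right_mono) auto
    finally have "C / real (Suc m) \<le> \<epsilon> / 3" by (simp add: divide_le_eq mult.commute)
    then show ?thesis by (intro exI[of _ "Suc m"]) auto
  qed
  have [measurable]: "f \<in> borel_measurable borel"
    by (intro borel_measurable_continuous_onI uniformly_continuous_imp_continuous uc)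
  have "(\<alpha> \<in> strategies M F \<longrightarrow> (\<exists>\<beta>\<in>controls M F. \<bar>J M W f (\<alpha> \<beta>) \<beta> - V\<bar> \<le> \<epsilon>)) \<and>
    (\<exists>\<alpha>\<in>strategies M F. \<forall>\<beta>\<in>controls M F. \<bar>J M W f (\<alpha> \<beta>) \<beta> - V\<bar> \<le> \<epsilon>)" for \<alpha>
  proof (rule value_function[OF f uc e3], goal_cases)
    case (1 K u du)
    interpret approximate_value M F W f K "\<epsilon> / 3" u du
      by unfold_locales (use 1 in auto)
    have V: "\<bar>u 0 0 - V\<bar> \<le> \<epsilon> / 3" using 1 unfolding V_def by simp
    have tri: "\<bar>j - V\<bar> \<le> \<epsilon>" if "\<bar>j - u 0 0\<bar> \<le> \<epsilon> / 3 + d" "d \<le> \<epsilon> / 3" for j d :: real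
      using that V by linarith
    show ?case
    proof (intro conjI impI)
      assume \<alpha>: "\<alpha> \<in> strategies M F"
      show "\<exists>\<beta>\<in>controls M F. \<bar>J M W f (\<alpha> \<beta>) \<beta> - V\<bar> \<le> \<epsilon>"
      proof (rule feedback_payoff[OF \<alpha>])
        fix C assume C: "\<And>m. 1 \<le> m \<Longrightarrow> \<exists>\<beta>\<in>controls M F. \<bar>J M W f (\<alpha> \<beta>) \<beta> - u 0 0\<bar> \<le> \<epsilon> / 3 + C / real m"
        obtain m where m: "m \<ge> 1" "C / real m \<le> \<epsilon> / 3" using small by blast
        from C[OF m(1)] obtain \<beta> where \<beta>: "\<beta> \<in> controls M F"
          "\<bar>J M W f (\<alpha> \<beta>) \<beta> - u 0 0\<bar> \<le> \<epsilon> / 3 + C / real m" by (rule bexE)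
        show ?thesis by (intro bexI[OF _ \<beta>(1)] tri[OF \<beta>(2) m(2)])
      qed
    next
      show "\<exists>\<alpha>\<in>strategies M F. \<forall>\<beta>\<in>controls M F. \<bar>J M W f (\<alpha> \<beta>) \<beta> - V\<bar> \<le> \<epsilon>"
      proof (rule response_payoff)
        fix C assume C: "\<And>m. 1 \<le> m \<Longrightarrow> \<exists>\<alpha>\<in>strategies M F. \<forall>\<beta>\<in>controls M F.
            \<bar>J M W f (\<alpha> \<beta>) \<beta> - u 0 0\<bar> \<le> \<epsilon> / 3 + C / real m"
        obtain m where m: "m \<ge> 1" "C / real m \<le> \<epsilon> / 3" using small by blast
        from C[OF m(1)] obtain \<alpha> where \<alpha>: "\<alpha> \<in> strategies M F"
          "\<forall>\<beta>\<in>controls M F. \<bar>J M W f (\<alpha> \<beta>) \<beta> - u 0 0\<bar> \<le> \<epsilon> / 3 + C / real m" by (rule bexE)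
        show ?thesis by (intro bexI[OF _ \<alpha>(1)] ballI tri[OF bspec[OF \<alpha>(2)] m(2)])
      qed
    qed
  qed
  then show "\<alpha> \<in> strategies M F \<Longrightarrow> \<exists>\<beta>\<in>controls M F. \<bar>J M W f (\<alpha> \<beta>) \<beta> - V\<bar> \<le> \<epsilon>"
    and "\<exists>\<alpha>\<in>strategies M F. \<forall>\<beta>\<in>controls M F. \<bar>J M W f (\<alpha> \<beta>) \<beta> - V\<bar> \<le> \<epsilon>"
    by blast+
qed

end

text \<open>Each fact is used twice. By the first, every \<open>a\<close> has infimum at most V +
  \<epsilon> and supremum at least V - \<epsilon>; by the second, some \<open>a\<close> has infimum
  at least V - \<epsilon> and supremum at most V + \<epsilon>. In \<open>ereal\<close> all these
  bounds exist unconditionally.\<close>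

lemma saddle_SUP_INF:
  fixes j :: "'a \<Rightarrow> 'b \<Rightarrow> real"
  assumes 1: "\<And>\<epsilon> a. 0 < \<epsilon> \<Longrightarrow> a \<in> A \<Longrightarrow> \<exists>b\<in>B. \<bar>j a b - V\<bar> \<le> \<epsilon>"
    and 2: "\<And>\<epsilon>. 0 < \<epsilon> \<Longrightarrow> \<exists>a\<in>A. \<forall>b\<in>B. \<bar>j a b - V\<bar> \<le> \<epsilon>"
  shows "(SUP a\<in>A. INF b\<in>B. ereal (j a b)) = ereal V" "(INF a\<in>A. SUP b\<in>B. ereal (j a b)) = ereal V"
proof -
  have 3: "j a b \<le> V + \<epsilon>" "V - \<epsilon> \<le> j a b" if "\<bar>j a b - V\<bar> \<le> \<epsilon>" for a b \<epsilon>
    using that by linarith+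
  show "(SUP a\<in>A. INF b\<in>B. ereal (j a b)) = ereal V"
  proof (rule antisym)
    show "(SUP a\<in>A. INF b\<in>B. ereal (j a b)) \<le> ereal V"
    proof (rule SUP_least, rule ereal_le_epsilon2)
      fix a and \<epsilon> :: real assume a: "a \<in> A" and "0 < \<epsilon>"
      from 1[OF this(2,1)] obtain b where "b \<in> B" "j a b \<le> V + \<epsilon>" using 3 by blast
      then show "(INF b\<in>B. ereal (j a b)) \<le> ereal V + ereal \<epsilon>" by (intro INF_lower2[of b]) auto
    qed
    show "ereal V \<le> (SUP a\<in>A. INF b\<in>B. ereal (j a b))"
    proof (rule ereal_le_epsilon2)
      fix \<epsilon> :: real assume "0 < \<epsilon>"
      from 2[OF this] obtain a where "a \<in> A" "\<And>b. b \<in> B \<Longrightarrow> V - \<epsilon> \<le> j a b" using 3 by blast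
      then have "ereal (V - \<epsilon>) \<le> (SUP a\<in>A. INF b\<in>B. ereal (j a b))"
        by (intro SUP_upper2[of a] INF_greatest) auto
      from add_right_mono[OF this, of "ereal \<epsilon>"]
      show "ereal V \<le> (SUP a\<in>A. INF b\<in>B. ereal (j a b)) + ereal \<epsilon>" by simp
    qed
  qed
  show "(INF a\<in>A. SUP b\<in>B. ereal (j a b)) = ereal V"
  proof (rule antisym)
    show "(INF a\<in>A. SUP b\<in>B. ereal (j a b)) \<le> ereal V"
    proof (rule ereal_le_epsilon2)
      fix \<epsilon> :: real assume "0 < \<epsilon>"
      from 2[OF this] obtain a where "a \<in> A" "\<And>b. b \<in> B \<Longrightarrow> j a b \<le> V + \<epsilon>" using 3 by blast
      then show "(INF a\<in>A. SUP b\<in>B. ereal (j a b)) \<le> ereal V + ereal \<epsilon>"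
        by (intro INF_lower2[of a] SUP_least) auto
    qed
    show "ereal V \<le> (INF a\<in>A. SUP b\<in>B. ereal (j a b))"
    proof (rule INF_greatest, rule ereal_le_epsilon2)
      fix a and \<epsilon> :: real assume a: "a \<in> A" and "0 < \<epsilon>"
      from 1[OF this(2,1)] obtain b where b: "b \<in> B" "V - \<epsilon> \<le> j a b" using 3 by blast
      then have "ereal (V - \<epsilon>) \<le> (SUP b\<in>B. ereal (j a b))" by (intro SUP_upper2[of b]) auto
      from add_right_mono[OF this, of "ereal \<epsilon>"]
      show "ereal V \<le> (SUP b\<in>B. ereal (j a b)) + ereal \<epsilon>" by simp
    qed
  qed
qed

theorem theorem2p3:
  fixes M :: "'w measure" and F :: "real \<Rightarrow> 'w measure"
    and W :: "real \<Rightarrow> 'w \<Rightarrow> real ^ 'n" and f :: "real ^ 'n \<Rightarrow> real"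
  assumes "prob_space M" and "complete_measure M"
    and "complete_rc_filtration M F"
    and "brownian_motion M F W"
    and "bounded (range f)" and "uniformly_continuous_on UNIV f"
  shows "ereal (inv Phi (\<integral>x. Phi (f x) \<partial>std_gaussian))
           = (SUP \<alpha>\<in>strategies M F. INF \<beta>\<in>controls M F. ereal (J M W f (\<alpha> \<beta>) \<beta>))
       \<and> (SUP \<alpha>\<in>strategies M F. INF \<beta>\<in>controls M F. ereal (J M W f (\<alpha> \<beta>) \<beta>))
           = (INF \<alpha>\<in>strategies M F. SUP \<beta>\<in>controls M F. ereal (J M W f (\<alpha> \<beta>) \<beta>))"
proof -
  interpret prob_space M by fact
  interpret brownian M F W by unfold_locales fact+
  obtain c where c: "\<And>x. \<bar>f x\<bar> \<le> c" using assms(5) by (auto simp: bounded_iff)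
  note sp = saddle_point[OF c assms(6)]
  show ?thesis
    using saddle_SUP_INF[of "strategies M F" "controls M F" "\<lambda>\<alpha> \<beta>. J M W f (\<alpha> \<beta>) \<beta>", OF sp]
    by simp
qed

end
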